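(* Let $\gamma^+,\gamma^->0$ be fixed. Let the integers $x_1,\dots,x_k$ and the positive integers $n_1,\dots,n_k$ all depend on $N$ in such a way that $x_i-x_j$ is constant, $(n_j-N)/\sqrt N\to t_j\in\mathbb{R}$ and $x_i/\sqrt N\to c\in\mathbb{R}$ for all $1\le i,j\le k$. Write $z_+$ for $(c+\sqrt{c^2-4\gamma^+})/2$ (in the upper half-plane when $c^2<4\gamma^+$). Then $$\lim_{N\to\infty}\det[K(n_i,x_i;n_j,x_j)]_{1\le i,j\le k}=\begin{cases}0,& c\ge 2\sqrt{\gamma^+},\\ 1,& c\le-2\sqrt{\gamma^+},\\ \det[S_{z_+}(t_i-t_j;x_i-x_j)]_{1\le i,j\le k},& -2\sqrt{\gamma^+}<c<2\sqrt{\gamma^+}.\end{cases}$$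
   Context: For parameters $\gamma^\pm$, positive integers $n_1,n_2$ and integers $x_1,x_2$, the kernel $K$ (the correlation kernel of the determinantal point process on $\mathbb{Z}_+\times\mathbb{Z}$ attached to the Plancherel measures of $U(\infty)$ with parameters $\gamma^\pm$) is $$K(n_1,x_1;n_2,x_2)=-\mathbf{1}_{n_1<n_2}\frac{1}{2\pi i}\oint\frac{z^{x_1-x_2-1}}{(1-z)^{n_2-n_1}}dz+\left(\frac{1}{2\pi i}\right)^2\oint\oint \frac{e^{\gamma^-u+\gamma^+u^{-1}}u^{x_1}(1-u)^{n_1}}{e^{\gamma^-w+\gamma^+w^{-1}}w^{1+x_2}(1-w)^{n_2}}\frac{du\,dw}{u-w},$$ with $u$ over $|u|=r<1$, $w$ over $|w-1|=\epsilon<1-r$, $z$ over $|z|=r<1$ ($r,\epsilon>0$, counterclockwise). For a complex number $z_+$ in the upper half-plane, $$S_{z_+}(t_i-t_j;x_i-x_j)=\frac{1}{2\pi i}\int_{\overline{z_+}}^{z_+}u^{x_i-x_j-1}e^{(t_j-t_i)u}du,$$ where, if $t_i\ge t_j$, the integration contour crosses $(0,\infty)$ but does not cross $(-\infty,0)$, and if $t_i<t_j$, it crosses $(-\infty,0)$ but not $(0,\infty)$.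
   Formalization: Added since the claim fails for coinciding points: for c ≤ -2√γ⁺ the points (n_i,x_i) are pairwise distinct for all large N; for -2√γ⁺ < c < 2√γ⁺, whenever t_i=t_j and x_i=x_j, also n_i=n_j for all large N. Nothing is added for c ≥ 2√γ⁺. *)

theory Defs
  imports "HOL-Complex_Analysis.Complex_Analysis"
begin

text \<open>
  Correlation kernel of the Plancherel measures of U(infinity). The radii \<open>r\<close> and \<open>e\<close> of the
  contours are explicit arguments; the kernel is meant for \<open>0 < r < 1\<close> and \<open>0 < e < 1 - r\<close>.
\<close>

definition plancherel_kernel ::
    "real \<Rightarrow> real \<Rightarrow> real \<Rightarrow> real \<Rightarrow> nat \<Rightarrow> int \<Rightarrow> nat \<Rightarrow> int \<Rightarrow> complex" where
  "plancherel_kernel gp gm r e n1 x1 n2 x2 =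
     - (if n1 < n2
        then 1 / (2 * of_real pi * \<i>) *
             contour_integral (circlepath 0 r) (\<lambda>z. z powi (x1 - x2 - 1) / (1 - z) ^ (n2 - n1))
        else 0)
     + (1 / (2 * of_real pi * \<i>))\<^sup>2 *
       contour_integral (circlepath 0 r) (\<lambda>u.
         contour_integral (circlepath 1 e) (\<lambda>w.
           (exp (of_real gm * u + of_real gp * inverse u) * u powi x1 * (1 - u) ^ n1) /
           (exp (of_real gm * w + of_real gp * inverse w) * w powi (1 + x2) * (1 - w) ^ n2) *
           (1 / (u - w))))"

definition z_plus :: "real \<Rightarrow> real \<Rightarrow> complex" where
  "z_plus gp c = (of_real c + csqrt (of_real (c\<^sup>2 - 4 * gp))) / 2"

text \<open>
  Integration contours for \<open>S\<^sub>z(s; d)\<close>. The origin is excluded because the integrand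
  may have a pole there.
\<close>

definition S_contour :: "complex \<Rightarrow> real \<Rightarrow> (real \<Rightarrow> complex) \<Rightarrow> bool" where
  "S_contour z s g \<longleftrightarrow>
     valid_path g \<and> pathstart g = cnj z \<and> pathfinish g = z \<and> 0 \<notin> path_image g \<and>
     (if s \<ge> 0
      then path_image g \<inter> of_real ` {0<..} \<noteq> {} \<and> path_image g \<inter> of_real ` {..<0} = {}
      else path_image g \<inter> of_real ` {..<0} \<noteq> {} \<and> path_image g \<inter> of_real ` {0<..} = {})"

text \<open>
  \<open>S\<^sub>z(s; d)\<close> computed along the contour \<open>g\<close>; its value is the same for all \<open>g\<close> with \<open>S_contour z s g\<close>.
\<close>

definition S_kernel :: "(real \<Rightarrow> complex) \<Rightarrow> real \<Rightarrow> int \<Rightarrow> complex" where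
  "S_kernel g s d =
     1 / (2 * of_real pi * \<i>) *
     contour_integral g (\<lambda>u. u powi (d - 1) * exp (- of_real s * u))"

lemma S_contour_exists:
  assumes "Im z > 0"
  shows "\<exists>g. S_contour z s g"
proof -
  define p :: real where "p = (if s \<ge> 0 then 1 else -1)"
  define g where "g = linepath (cnj z) (of_real p) +++ linepath (of_real p) z"
  have img: "path_image g = closed_segment (cnj z) (of_real p) \<union> closed_segment (of_real p) z"
    by (simp add: g_def path_image_join)
  have only: "y = p" if "of_real y \<in> path_image g" for y
    using that assms unfolding img closed_segment_def
    by (auto simp: complex_eq_iff)
  have mem: "of_real p \<in> path_image g" by (simp add: img)
  have "valid_path g" "pathstart g = cnj z" "pathfinish g = z" by (simp_all add: g_def)
  moreover have "p \<noteq> 0" by (simp add: p_def)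
  then have "0 \<notin> path_image g" using only[of 0] by auto
  moreover have "path_image g \<inter> of_real ` X = {} \<longleftrightarrow> p \<notin> X" for X
    using mem only by blast
  ultimately have "S_contour z s g"
    unfolding S_contour_def by (simp add: p_def)
  then show ?thesis by blast
qed

end

theory Submission
  imports Defs "HOL-Real_Asymp.Real_Asymp"
begin

text \<open>
  With \<open>a = sqrt (gp / N)\<close>, substitute \<open>u = a v\<close>. The phase becomes
  \<open>(gp / a) (1 / v - v) + x log v\<close>; its real part is constant on the unit circle, where its radial derivative
  is \<open>-2 (gp / a) (cos \<theta> - b)\<close> with \<open>b = x a / (2 gp)\<close>. Hence, up to constants, the \<open>u\<close>-integrand is at most
  \<open>exp (-(gp / a) \<delta> (cos \<theta> - b)\<^sup>2)\<close> on the loop \<open>\<bar>v\<bar> = exp (\<delta> (cos \<theta> - b))\<close>, and so is the \<open>w\<close>-integrand on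
  the loop with \<open>-\<delta>\<close> in place of \<open>\<delta>\<close>. On these loops \<open>1 / \<bar>u - w\<bar>\<close> is integrable uniformly in \<open>b\<close>, so the
  double integral tends to \<open>0\<close>; uniformity covers \<open>c = \<plusminus>2 sqrt gp\<close>, where the critical
  points merge. The loops cross at the critical points, so deforming the contours onto them leaves the residues
  at \<open>u = w\<close> along the arc \<open>cos \<theta> > b\<close> of the \<open>w\<close>-loop; for \<open>n\<^sub>1 < n\<^sub>2\<close> the single integral turns this into minus
  the complementary arc. The integral over the arc tends to \<open>S\<close>, to \<open>0\<close> or to a full residue. The remaining powers
  of \<open>a\<close> are a diagonal conjugation of the matrix. In the two outer cases every permutation other than the
  identity (and for \<open>c \<ge> 2 sqrt gp\<close> also the identity) contains a factor tending to \<open>0\<close>.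
\<close>

subsection \<open>Radial loops around the origin\<close>

text \<open>The scale a balances the two large terms of the exponent: gp / u comes from the
  exponential and - n u from (1 - u)^n, and for u = a v both have size gp / a = N a = sqrt (gp N).
  The term x log v has the same order because x grows like sqrt N. The obstacle is the crossing of
  the loops: 1 / (u - w) is singular exactly where the weights give no decay. A double integral over
  the crossing loops is therefore never formed; for each w off the crossing points the u-contour is
  moved by a residue, and only then is w integrated. The singularity is split into distance^(-3/4)
  and distance^(-1/4). The first power is measured by the angle and spent on the u-integral; the
  second is measured by |cos - b|, and part of it is traded against the Gaussian weight in w. What
  remains is the factor (a / gp)^(1/16), which is all the decay that is needed. All bounds have to
  be uniform in b, because b varies with N.\<close>

definition unit_pt :: "real \<Rightarrow> complex" where
  "unit_pt t = exp (2 * of_real pi * \<i> * of_real t)"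

lemma norm_unit_pt [simp]: "norm (unit_pt t) = 1"
proof -
  have "unit_pt t = exp (\<i> * of_real (2 * pi * t))"
    by (simp add: unit_pt_def mult_ac)
  then show ?thesis by simp
qed

lemma unit_pt_nonzero [simp]: "unit_pt t \<noteq> 0"
  by (simp add: unit_pt_def)

lemma unit_pt_eq_iff: "unit_pt s = unit_pt t \<longleftrightarrow> (\<exists>k::int. s = t + of_int k)"
proof -
  have "unit_pt s = unit_pt t \<longleftrightarrow>
      (\<exists>k::int. 2 * of_real pi * \<i> * of_real s
        = 2 * of_real pi * \<i> * of_real t + of_int (2 * k) * of_real pi * \<i>)"
    unfolding unit_pt_def by (simp add: exp_eq)
  also have "\<dots> \<longleftrightarrow> (\<exists>k::int. s = t + of_int k)"
  proof (rule ex_cong1)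
    fix k :: int
    have "(2 * of_real pi * \<i> * of_real s = 2 * of_real pi * \<i> * of_real t + of_int (2 * k) * of_real pi * \<i>)
       \<longleftrightarrow> (2 * of_real pi * \<i>) * complex_of_real s = (2 * of_real pi * \<i>) * complex_of_real (t + of_int k)"
      by (simp add: algebra_simps)
    also have "\<dots> \<longleftrightarrow> complex_of_real s = complex_of_real (t + of_int k)"
      by simp
    also have "\<dots> \<longleftrightarrow> s = t + of_int k" by (simp only: of_real_eq_iff)
    finally show "(2 * of_real pi * \<i> * of_real s = 2 * of_real pi * \<i> * of_real t + of_int (2 * k) * of_real pi * \<i>)
       \<longleftrightarrow> s = t + of_int k" .
  qed
  finally show ?thesis .
qed

text \<open>Angles are measured in turns, so that a loop
  \<open>of_real (\<rho> t) * unit_pt t\<close> and \<open>circlepath\<close> have the same argument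
  at the same parameter. This is what allows loops to be compared ray by ray.\<close>

lemma circlepath_unit_pt: "circlepath 0 q t = of_real q * unit_pt t"
  by (simp add: circlepath unit_pt_def)

lemma continuous_unit_pt [continuous_intros]:
  "continuous_on S f \<Longrightarrow> continuous_on S (\<lambda>x. unit_pt (f x))"
  unfolding unit_pt_def by (intro continuous_intros)

text \<open>The straight-line homotopy moves every point along its own ray, so only the radial
  segments between the two loops have to stay in the domain.\<close>

lemma contour_integral_radial:
  assumes "open S" "f holomorphic_on S" "valid_path g" "pathfinish g = pathstart g"
    and g: "\<And>t. t \<in> {0..1} \<Longrightarrow> g t = of_real (\<rho> t) * unit_pt t"
    and seg: "\<And>t s. t \<in> {0..1} \<Longrightarrow> s \<in> closed_segment (\<rho> t) q \<Longrightarrow> of_real s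
      * unit_pt t \<in> S"
  shows "contour_integral g f = contour_integral (circlepath 0 q) f"
proof -
  have "homotopic_loops S g (circlepath 0 q)"
  proof (rule homotopic_loops_linear)
    fix t :: real assume t: "t \<in> {0..1}"
    show "closed_segment (g t) (circlepath 0 q t) \<subseteq> S"
    proof
      fix z assume "z \<in> closed_segment (g t) (circlepath 0 q t)"
      then obtain u where u: "0 \<le> u" "u \<le> 1" "z = (1 - u) *\<^sub>R g t + u *\<^sub>R circlepath 0 q t"
        by (auto simp: closed_segment_def)
      then have z: "z = of_real ((1 - u) * \<rho> t + u * q) * unit_pt t"
        by (simp add: g[OF t] circlepath_unit_pt scaleR_conv_of_real algebra_simps)
      have "(1 - u) * \<rho> t + u * q \<in> closed_segment (\<rho> t) q"
        using u by (auto simp: closed_segment_def)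
      then show "z \<in> S" unfolding z by (rule seg[OF t])
    qed
  qed (use assms in \<open>auto simp: valid_path_imp_path\<close>)
  then show ?thesis
    using Cauchy_theorem_homotopic_loops[of S g "circlepath 0 q" f] assms by auto
qed

lemma unit_pt_01: "unit_pt 1 = unit_pt 0"
  by (subst unit_pt_eq_iff) (auto intro: exI[of _ 1])

text \<open>A radial loop meets each ray once, up to the parameters 0 and 1, where closedness gives
  equal radii. Hence whether a point is inside or outside can be read off on its own ray.\<close>

lemma radial_loop_ray:
  assumes g: "pathfinish g = pathstart g" "\<And>t. t \<in> {0..1} \<Longrightarrow> g t = of_real (\<rho> t) * unit_pt t"
    and t: "t \<in> {0..1}" "t0 \<in> {0..1}" and s: "0 < s" "0 < s'"
    and eq: "of_real s' * unit_pt t = of_real s * unit_pt t0"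
  shows "s' = s \<and> \<rho> t = \<rho> t0"
proof -
  have "of_real (\<rho> 0) * unit_pt 0 = of_real (\<rho> 1) * unit_pt 1"
    using g(1) g(2)[of 0] g(2)[of 1] by (simp add: pathfinish_def pathstart_def)
  then have \<rho>01: "\<rho> 0 = \<rho> 1" by (simp add: unit_pt_01)
  have "norm (of_real s' * unit_pt t) = norm (of_real s * unit_pt t0)" using eq by simp
  then have ss: "s' = s" using s by (simp add: norm_mult)
  then have "unit_pt t = unit_pt t0" using eq s by simp
  then obtain k :: int where k: "t = t0 + of_int k" by (auto simp: unit_pt_eq_iff)
  have "\<bar>of_int k :: real\<bar> \<le> 1" using k t by auto
  then have "k = 0 \<or> k = 1 \<or> k = -1" by linarith
  then have "t = t0 \<or> (t = 1 \<and> t0 = 0) \<or> (t = 0 \<and> t0 = 1)" using k t by auto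
  then show ?thesis using ss \<rho>01 by auto
qed

text \<open>If w lies inside, the loop expands to the circle of radius R; otherwise it shrinks to
  the constant loop at 0. Neither motion passes through w.\<close>

lemma contour_integral_radial_pole:
  assumes g: "valid_path g" "pathfinish g = pathstart g"
      "\<And>t. t \<in> {0..1} \<Longrightarrow> g t = of_real (\<rho> t) * unit_pt t"
    and \<rho>: "\<And>t. t \<in> {0..1} \<Longrightarrow> 0 < \<rho> t \<and> \<rho> t < R"
    and w: "w = of_real s * unit_pt t0" "0 < s" "s < R" "t0 \<in> {0..1}" "s \<noteq> \<rho> t0"
  shows "contour_integral g (\<lambda>u. 1 / (u - w)) = (if s < \<rho> t0 then 2 * of_real pi * \<i> else 0)"
proof -
  have nw: "s' = s \<and> \<rho> t = \<rho> t0" if "t \<in> {0..1}" "s' > 0" "of_real s' * unit_pt t = w" for t s'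
    using radial_loop_ray[OF g(2,3) that(1) w(4,2) that(2)] that(3) w(1) by simp
  have hol: "(\<lambda>u. 1 / (u - w)) holomorphic_on - {w}" by (auto intro!: holomorphic_intros)
  show ?thesis
  proof (cases "s < \<rho> t0")
    case True
    have "contour_integral g (\<lambda>u. 1 / (u - w)) = contour_integral (circlepath 0 R) (\<lambda>u. 1 / (u - w))"
    proof (rule contour_integral_radial[OF _ hol g])
      fix t s' assume t: "t \<in> {0..1}" and s': "s' \<in> closed_segment (\<rho> t) R"
      have "s' \<ge> \<rho> t" using s' \<rho>[OF t] by (auto simp: closed_segment_eq_real_ivl split: if_splits)
      then show "of_real s' * unit_pt t \<in> - {w}"
        using nw[OF t, of s'] \<rho>[OF t] True by auto
    qed auto
    also have "\<dots> = 2 * of_real pi * \<i>"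
    proof -
      have "norm w < R" using w by (simp add: norm_mult)
      then have "((\<lambda>u. 1 / (u - w)) has_contour_integral (2 * of_real pi * \<i> * 1)) (circlepath 0 R)"
        by (intro Cauchy_integral_circlepath_simple) (auto intro!: holomorphic_intros)
      then show ?thesis by (auto dest: contour_integral_unique)
    qed
    finally show ?thesis using True by simp
  next
    case False
    then have F: "\<rho> t0 < s" using w by auto
    have "contour_integral g (\<lambda>u. 1 / (u - w)) = contour_integral (circlepath 0 0) (\<lambda>u. 1 / (u - w))"
    proof (rule contour_integral_radial[OF _ hol g])
      fix t s' assume t: "t \<in> {0..1}" and s': "s' \<in> closed_segment (\<rho> t) 0"
      have "0 \<le> s'" "s' \<le> \<rho> t" using s' \<rho>[OF t] by (auto simp: closed_segment_eq_real_ivl split: if_splits)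
      then show "of_real s' * unit_pt t \<in> - {w}"
        using nw[OF t, of s'] \<rho>[OF t] F w by (cases "s' = 0") auto
    qed auto
    also have "\<dots> = 0"
    proof -
      have "circlepath 0 0 = linepath (0::complex) 0"
        by (rule ext) (simp add: circlepath linepath_def)
      then show ?thesis by simp
    qed
    finally show ?thesis using False by simp
  qed
qed

text \<open>F may have an essential singularity at 0, so the loop is moved to the circle of radius q
  instead of being contracted. Subtracting F w leaves a quotient that extends holomorphically across
  w and has the same integral over both loops; the subtracted part sees only on which side of g the
  point w lies.\<close>

lemma contour_integral_cross:
  assumes F: "F holomorphic_on {z. z \<noteq> 0 \<and> norm z < R}"
    and g: "valid_path g" "pathfinish g = pathstart g"
      "\<And>t. t \<in> {0..1} \<Longrightarrow> g t = of_real (\<rho> t) * unit_pt t"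
    and \<rho>: "\<And>t. t \<in> {0..1} \<Longrightarrow> q < \<rho> t \<and> \<rho> t < R"
    and w: "w = of_real s * unit_pt t0" "0 < q" "q < s" "s < R" "t0 \<in> {0..1}" "s \<noteq> \<rho> t0"
  shows "contour_integral g (\<lambda>u. F u / (u - w)) =
     contour_integral (circlepath 0 q) (\<lambda>u. F u / (u - w)) + (if s < \<rho> t0 then 2 * of_real pi * \<i> * F w else 0)"
proof -
  define S where "S = {z::complex. z \<noteq> 0 \<and> norm z < R}"
  have S: "open S"
  proof -
    have "S = ball 0 R - {0}" by (auto simp: S_def)
    then show ?thesis by auto
  qed
  define Q where "Q = (\<lambda>z. if z = w then deriv F w else (F z - F w) / (z - w))"
  have Q: "Q holomorphic_on S"
    unfolding Q_def by (rule pole_lemma_open) (use F S in \<open>auto simp: S_def\<close>)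
  have eqQ: "contour_integral g Q = contour_integral (circlepath 0 q) Q"
  proof (rule contour_integral_radial[OF S Q g])
    fix t s' assume t: "t \<in> {0..1}" and s': "s' \<in> closed_segment (\<rho> t) q"
    then have "q \<le> s'" "s' \<le> \<rho> t" using \<rho>[OF t] by (auto simp: closed_segment_eq_real_ivl split: if_splits)
    then show "of_real s' * unit_pt t \<in> S" using \<rho>[OF t] w by (auto simp: S_def norm_mult)
  qed
  have decomp: "contour_integral h (\<lambda>u. F u / (u - w)) = contour_integral h Q + F w * contour_integral h (\<lambda>u. 1 / (u
    - w))"
    if h: "valid_path h" "path_image h \<subseteq> S - {w}" for h
  proof -
    have opn: "open (S - {w})" using S by auto
    have i1: "Q contour_integrable_on h"
      by (rule contour_integrable_holomorphic_simple[OF _ opn h]) (use Q holomorphic_on_subset in blast)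
    have i2: "(\<lambda>u. 1 / (u - w)) contour_integrable_on h"
      by (rule contour_integrable_holomorphic_simple[OF _ opn h]) (auto intro!: holomorphic_intros)
    have "contour_integral h (\<lambda>u. F u / (u - w)) = contour_integral h (\<lambda>u. Q u + F w * (1 / (u - w)))"
      by (rule contour_integral_eq) (use h in \<open>auto simp: Q_def diff_divide_distrib\<close>)
    also have "\<dots> = contour_integral h Q + contour_integral h (\<lambda>u. F w * (1 / (u - w)))"
      by (rule contour_integral_add[OF i1 contour_integrable_lmul[OF i2]])
    also have "contour_integral h (\<lambda>u. F w * (1 / (u - w))) = F w * contour_integral h (\<lambda>u. 1 / (u - w))"
      by (rule contour_integral_lmul[OF i2])
    finally show ?thesis .
  qed
  have wn: "norm w = s" using w by (simp add: norm_mult)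
  have pole: "contour_integral g (\<lambda>u. 1 / (u - w)) = (if s < \<rho> t0 then 2 * of_real pi * \<i> else 0)"
    by (rule contour_integral_radial_pole[OF g, of R]) (use \<rho> w in force)+
  have gS: "path_image g \<subseteq> S - {w}"
  proof -
    have "g t \<in> S - {w}" if t: "t \<in> {0..1}" for t
    proof -
      have "g t \<noteq> w"
      proof
        assume "g t = w"
        then have "of_real (\<rho> t) * unit_pt t = of_real s * unit_pt t0" using g(3)[OF t] w(1) by simp
        moreover have "0 < s" "0 < \<rho> t" using w \<rho>[OF t] by auto
        ultimately have "\<rho> t = s \<and> \<rho> t = \<rho> t0"
          using radial_loop_ray[where \<rho> = \<rho>, OF g(2,3) t w(5)] by blast
        then show False using w(6) by simp
      qed
      then show ?thesis using \<rho>[OF t] w g(3)[OF t] by (auto simp: S_def norm_mult)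
    qed
    then show ?thesis unfolding path_image_def by blast
  qed
  have cS: "path_image (circlepath 0 q) \<subseteq> S - {w}" using w wn by (auto simp: S_def)
  have c0: "contour_integral (circlepath 0 q) (\<lambda>u. 1 / (u - w)) = 0"
  proof -
    have "((\<lambda>u. 1 / (u - w)) has_contour_integral 0) (circlepath 0 q)"
      by (rule Cauchy_theorem_disc_simple[of _ 0 s]) (use w wn in \<open>auto intro!: holomorphic_intros\<close>)
    then show ?thesis by (rule contour_integral_unique)
  qed
  show ?thesis
    unfolding decomp[OF g(1) gS] decomp[OF valid_path_circlepath cS] eqQ pole c0 by simp
qed

lemma continuous_on_contour_integral_param:
  fixes f :: "'a::topological_space \<Rightarrow> complex \<Rightarrow> complex"
  assumes "continuous_on (U \<times> path_image h) (\<lambda>(x, z). f x z)"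
    and "valid_path h" "continuous_on {0..1} (\<lambda>t. vector_derivative h (at t))"
  shows "continuous_on U (\<lambda>x. contour_integral h (f x))"
proof -
  have "continuous_on U (\<lambda>x. integral (cbox 0 1) (\<lambda>t. f x (h t) * vector_derivative h (at t)))"
  proof (rule integral_continuous_on_param)
    have h: "continuous_on {0..1} h"
      using assms(2) by (auto dest: valid_path_imp_path simp: path_def)
    have "continuous_on (U \<times> {0..1}) (\<lambda>y. (\<lambda>(x, z). f x z) (fst y, h (snd y)))"
      by (rule continuous_on_compose2[OF assms(1)])
         (auto intro!: continuous_intros continuous_on_compose2[OF h] simp: path_image_def)
    moreover have "continuous_on (U \<times> {0..1::real}) (\<lambda>y. vector_derivative h (at (snd y)))"
      by (rule continuous_on_compose2[OF assms(3)]) (auto intro!: continuous_intros)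
    ultimately show "continuous_on (U \<times> cbox 0 1) (\<lambda>(x, t). f x (h t) * vector_derivative h (at t))"
      by (auto simp: case_prod_unfold intro!: continuous_intros)
  qed
  then show ?thesis by (simp add: contour_integral_integral)
qed

section \<open>Loops of radius exp (\<delta> (cos \<theta> - b)) and their calculus\<close>

definition wloop :: "real \<Rightarrow> real \<Rightarrow> real \<Rightarrow> complex" where
  "wloop \<delta> b t = of_real (exp (\<delta> * (cos (2 * pi * t) - b))) * unit_pt t"

definition wloop' :: "real \<Rightarrow> real \<Rightarrow> real \<Rightarrow> complex" where
  "wloop' \<delta> b t = (2 * of_real pi * \<i> - of_real (2 * pi * \<delta> * sin (2 * pi * t))) * wloop \<delta> b t"

lemma wloop_exp:
  "wloop \<delta> b t = exp (of_real (\<delta> * (cos (2 * pi * t) - b)) + 2 * of_real pi * \<i> * of_real t)"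
  by (simp add: wloop_def unit_pt_def exp_add exp_of_real flip: of_real_diff of_real_mult)

lemma wloop_has_vector_derivative:
  "(wloop \<delta> b has_vector_derivative wloop' \<delta> b t) (at t within S)"
proof -
  have "((\<lambda>t. exp (of_real (\<delta> * (cos (2 * pi * t) - b)) + 2 * of_real pi * \<i> * of_real t))
     has_vector_derivative wloop' \<delta> b t) (at t within S)"
    unfolding wloop'_def wloop_exp
    by (rule derivative_eq_intros has_vector_derivative_real_field refl
        exp_scaleR_has_vector_derivative_right field_vector_diff_chain_within[unfolded o_def]
        | simp add: scaleR_conv_of_real algebra_simps)+
  then show ?thesis by (simp add: wloop_exp[abs_def])
qed

lemma continuous_on_wloop [continuous_intros]:
  fixes f :: "'a::t2_space \<Rightarrow> real"
  shows "continuous_on S f \<Longrightarrow> continuous_on S (\<lambda>x. wloop \<delta> b (f x))"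
  unfolding wloop_def by (intro continuous_intros)

lemma continuous_on_wloop' [continuous_intros]:
  fixes f :: "'a::t2_space \<Rightarrow> real"
  shows "continuous_on S f \<Longrightarrow> continuous_on S (\<lambda>x. wloop' \<delta> b (f x))"
  unfolding wloop'_def by (intro continuous_intros)

lemma valid_path_wloop [simp]: "valid_path (wloop \<delta> b)"
proof -
  have "wloop \<delta> b C1_differentiable_on {0..1}"
    unfolding C1_differentiable_on_def
    by (intro exI[of _ "wloop' \<delta> b"] conjI ballI wloop_has_vector_derivative continuous_intros)
  then show ?thesis
    by (simp add: valid_path_def C1_differentiable_imp_piecewise)
qed

lemma valid_path_scale:
  assumes "valid_path g" shows "valid_path (\<lambda>t. (a::complex) * g t)"
proof -
  have "valid_path ((\<lambda>z. a * z) \<circ> g)"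
    by (rule valid_path_compose[OF assms]) (auto intro!: derivative_intros continuous_intros field_differentiable_at_within)
  then show ?thesis by (simp add: o_def)
qed

lemma wloop_closed: "wloop \<delta> b 1 = wloop \<delta> b 0"
  by (simp add: wloop_def unit_pt_01)

lemma norm_wloop: "norm (wloop \<delta> b t) = exp (\<delta> * (cos (2 * pi * t) - b))"
  by (simp add: wloop_def norm_mult)

lemma wloop_nonzero [simp]: "wloop \<delta> b t \<noteq> 0"
  by (simp add: wloop_def)

subsection \<open>Deformation of the contours\<close>

text \<open>All three integrals are sums of residues at 0, 1 and u. Radius 3 encloses all of them
  and radius 1/2 only 0 and u, so the difference is the residue at 1, the only one inside the small
  circle.\<close>

lemma contour_integral_around_1:
  assumes h: "h holomorphic_on - {0, 1}" and u: "u \<noteq> 0" "norm u < 1/2" and e: "0 < e" "e < 1 - norm u"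
  shows "contour_integral (circlepath 1 e) (\<lambda>w. h w / (u - w)) =
     contour_integral (circlepath 0 3) (\<lambda>w. h w / (u - w)) - contour_integral (circlepath 0 (1/2)) (\<lambda>w. h w / (u - w))"
proof -
  let ?f = "\<lambda>w. h w / (u - w)"
  have u1: "u \<noteq> 1" using u by auto
  have dist1: "norm (1 - u) \<ge> 1 - norm u" using norm_triangle_ineq2[of 1 u] by simp
  have res: "contour_integral g ?f = 2 * pi * \<i> * (winding_number g 0 * residue ?f 0
       + winding_number g 1 * residue ?f 1 + winding_number g u * residue ?f u)"
    if g: "valid_path g" "pathfinish g = pathstart g" "path_image g \<subseteq> - {0, 1, u}" for g
  proof -
    have "contour_integral g ?f = 2 * pi * \<i> * (\<Sum>p\<in>{0, 1, u}. winding_number g p * residue ?f p)"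
    proof (rule Residue_theorem[of UNIV])
      show "?f holomorphic_on UNIV - {0, 1, u}"
        by (intro holomorphic_intros holomorphic_on_subset[OF h]) auto
    qed (use g in auto)
    then show ?thesis using u u1 by (simp add: algebra_simps)
  qed
  have i1: "contour_integral (circlepath 1 e) ?f = 2 * pi * \<i> * residue ?f 1"
  proof -
    have "path_image (circlepath 1 e) \<subseteq> - {0, 1, u}"
      using e u dist1 by (auto simp: dist_norm)
    moreover have "winding_number (circlepath 1 e) 0 = 0"
      proof (rule winding_number_zero_outside[of _ "cball 1 e"])
      show "(0::complex) \<notin> cball 1 e" using e norm_ge_zero[of u] by (simp add: dist_norm del: norm_ge_zero)
    qed (use e in \<open>auto simp: valid_path_imp_path\<close>)
    moreover have "winding_number (circlepath 1 e) u = 0"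
      by (rule winding_number_zero_outside[of _ "cball 1 e"]) (use e dist1 in \<open>auto simp: valid_path_imp_path dist_norm\<close>)
    moreover have "winding_number (circlepath 1 e) 1 = 1"
      using e by (intro winding_number_circlepath) auto
    ultimately show ?thesis by (simp add: res)
  qed
  have i2: "contour_integral (circlepath 0 (1/2)) ?f = 2 * pi * \<i> * (residue ?f 0 + residue ?f u)"
  proof -
    have "path_image (circlepath 0 (1/2)) \<subseteq> - {0, 1, u}"
      using u by auto
    moreover have "winding_number (circlepath 0 (1/2)) 1 = 0"
      by (rule winding_number_zero_outside[of _ "cball 0 (1/2)"]) (auto simp: valid_path_imp_path)
    moreover have "winding_number (circlepath 0 (1/2)) u = 1" "winding_number (circlepath 0 (1/2)) 0 = 1"
      using u by (auto intro!: winding_number_circlepath)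
    ultimately show ?thesis by (simp add: res)
  qed
  have i3: "contour_integral (circlepath 0 3) ?f = 2 * pi * \<i> * (residue ?f 0 + residue ?f 1 + residue ?f u)"
  proof -
    have "path_image (circlepath 0 3) \<subseteq> - {0, 1, u}"
      using u by auto
    moreover have "winding_number (circlepath 0 3) u = 1" "winding_number (circlepath 0 3) 0 = 1"
       "winding_number (circlepath 0 3) 1 = 1"
      using u by (auto intro!: winding_number_circlepath)
    ultimately show ?thesis by (simp add: res)
  qed
  show ?thesis unfolding i1 i2 i3 by (simp add: algebra_simps)
qed

text \<open>The double integrand of the kernel is \<open>weight\<close> for (n1, x1) at u divided by
  \<open>weight\<close> for (n2, 1 + x2) at w, times 1 / (u - w). The shift by 1 is supplied where
  the kernel is unfolded.\<close>

definition weight :: "real \<Rightarrow> real \<Rightarrow> nat \<Rightarrow> int \<Rightarrow> complex \<Rightarrow> complex" where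
  "weight gp gm n x u = exp (of_real gm * u + of_real gp * inverse u) * u powi x * (1 - u) ^ n"

lemma weight_nonzero: "u \<noteq> 0 \<Longrightarrow> u \<noteq> 1 \<Longrightarrow> weight gp gm n x u \<noteq> 0"
  by (simp add: weight_def)

lemma weight_holomorphic: "0 \<notin> S \<Longrightarrow> weight gp gm n x holomorphic_on S"
  unfolding weight_def by (intro holomorphic_intros) auto

lemma weight_continuous_on: "continuous_on S f \<Longrightarrow> (\<And>x. x \<in> S \<Longrightarrow> f x \<noteq> 0)
  \<Longrightarrow> continuous_on S (\<lambda>y. weight gp gm n x (f y))"
  unfolding weight_def by (intro continuous_intros) auto

lemma weight_quotient_continuous_on:
  assumes "0 \<notin> A" "0 \<notin> B" "1 \<notin> B" "A \<inter> B = {}"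
  shows "continuous_on (A \<times> B) (\<lambda>(u, w). weight gp gm n1 x1 u / weight gp gm n2 x2 w * (1 / (u - w)))"
proof -
  have "weight gp gm n2 x2 w \<noteq> 0" if "w \<in> B" for w
    by (rule weight_nonzero) (use assms that in auto)
  then show ?thesis
    unfolding case_prod_unfold using assms
    by (intro continuous_intros weight_continuous_on) auto
qed

lemma circlepath_C1:
  "continuous_on S (\<lambda>t. vector_derivative (circlepath z r) (at t))"
  by (subst vector_derivative_circlepath) (intro continuous_intros)

lemma scaled_wloop_derivative:
  "vector_derivative (\<lambda>t. of_real a * wloop \<delta> b t) (at t) = of_real a * wloop' \<delta> b t"
  by (intro vector_derivative_at has_vector_derivative_mult_right wloop_has_vector_derivative)

text \<open>The u-circle has to shrink below the scale a before the w-contour can be opened up to a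
  loop at that scale. Fubini first brings u inside, while w is still on the circle around 1; a
  second exchange then lets the w-contour be replaced for fixed u.\<close>

lemma kernel_double_integral:
  fixes gp gm :: real and n1 n2 :: nat and x1 x2 :: int
  assumes re: "0 < r" "0 < e" "e < 1 - r" and a: "0 < a" "a < 1/4" "a < 1 - e"
    and \<delta>: "\<And>t. 1/2 < exp (\<delta> * (cos (2 * pi * t) - b))" "\<And>t. exp (\<delta> * (cos (2 * pi * t) - b)) < 2"
  defines "W \<equiv> \<lambda>t. of_real a * wloop \<delta> b t"
    and "f \<equiv> \<lambda>u w. weight gp gm n1 x1 u / weight gp gm n2 x2 w * (1 / (u - w))"
  shows "contour_integral (circlepath 0 r) (\<lambda>u. contour_integral (circlepath 1 e) (f u)) =
     contour_integral (circlepath 0 (a/4)) (\<lambda>u. contour_integral (circlepath 0 3) (f u)) -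
     contour_integral W (\<lambda>w. contour_integral (circlepath 0 (a/4)) (\<lambda>u. f u w))"
proof -
  \<comment> \<open>The bounds on the radius give |w| > a / 2 on W, so this circle lies strictly
    inside W.\<close>
  let ?r = "a/4"
  note cvd = circlepath_C1
  have cf: "continuous_on (A \<times> B) (\<lambda>(u, w). f u w)"
    if "0 \<notin> A" "0 \<notin> B" "1 \<notin> B" "A \<inter> B = {}" for A B
    unfolding f_def by (rule weight_quotient_continuous_on[OF that])
  have W': "valid_path W" "continuous_on {0..1} (\<lambda>t. vector_derivative W (at t))"
    unfolding W_def scaled_wloop_derivative by (auto intro!: valid_path_scale continuous_intros)
  have imW: "a / 4 < norm w \<and> norm w < 1" if "w \<in> path_image W" for w
  proof -
    from that obtain t where t: "w = W t" unfolding path_image_def by blast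
    have "a * (1/2) < a * exp (\<delta> * (cos (2 * pi * t) - b))"
      "a * exp (\<delta> * (cos (2 * pi * t) - b)) < a * 2"
      using a \<delta>[of t] by (intro mult_strict_left_mono, simp_all)+
    then have "a / 4 < a * exp (\<delta> * (cos (2 * pi * t) - b))" "a * exp (\<delta> * (cos (2 * pi * t) - b)) < 1"
      using a by linarith+
    then show ?thesis unfolding t W_def using a(1) by (simp add: norm_mult norm_wloop del: mult_less_cancel_left_pos)
  qed
  have cW: "continuous_on (path_image (circlepath 0 ?r) \<times> path_image W) (\<lambda>(u, w). f u w)"
    by (rule cf) (use imW a in fastforce)+
  have sw: "contour_integral (circlepath 0 s) (\<lambda>u. contour_integral (circlepath 1 e) (f u))
     = contour_integral (circlepath 1 e) (\<lambda>w. contour_integral (circlepath 0 s) (\<lambda>u. f u w))"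
    if s: "0 < s" "s < 1 - e" for s
  proof (rule contour_integral_swap[OF cf])
    show "path_image (circlepath 0 s) \<inter> path_image (circlepath 1 e) = {}"
    proof -
      have "False" if "norm z = s" "dist 1 z = e" for z :: complex
        using that s norm_triangle_ineq2[of 1 z] by (simp add: dist_norm)
      moreover have "path_image (circlepath 0 s) = {z. norm z = s}" "path_image (circlepath 1 e) = {z. dist 1 z = e}"
        using s re by auto
      ultimately show ?thesis by blast
    qed
  qed (use s re cvd in auto)
  have "contour_integral (circlepath 0 r) (\<lambda>u. contour_integral (circlepath 1 e) (f u))
     = contour_integral (circlepath 1 e) (\<lambda>w. contour_integral (circlepath 0 r) (\<lambda>u. f u w))"
    using sw[of r] re by simp
  \<comment> \<open>On the circle around 1 one has |w| >= 1 - e, and both radii are smaller than 1 -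
    e, so u sweeps an annulus without the pole u = w.\<close>
  also have "\<dots> = contour_integral (circlepath 1 e) (\<lambda>w. contour_integral (circlepath 0 ?r) (\<lambda>u. f u w))"
  proof (rule contour_integral_eq)
    fix w assume "w \<in> path_image (circlepath 1 e)"
    then have w: "norm w \<ge> 1 - e" using re norm_triangle_ineq2[of 1 "1 - w"] by (auto simp: dist_norm)
    show "contour_integral (circlepath 0 r) (\<lambda>u. f u w) = contour_integral (circlepath 0 ?r) (\<lambda>u. f u w)"
    proof (rule contour_integral_radial[where \<rho> = "\<lambda>_. r" and S = "ball 0 (1 - e) - {0}"])
      show "(\<lambda>u. f u w) holomorphic_on ball 0 (1 - e) - {0}"
        unfolding f_def using w by (cases "weight gp gm n2 x2 w = 0") (auto intro!: holomorphic_intros weight_holomorphic)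
    next
      fix t s :: real assume "s \<in> closed_segment r ?r"
      then have "0 < s" "s < 1 - e" using re a by (auto simp: closed_segment_eq_real_ivl split: if_splits)
      then show "of_real s * unit_pt t \<in> ball 0 (1 - e) - {0}" by (auto simp: norm_mult)
    qed (auto simp: circlepath_unit_pt)
  qed
  also have "\<dots> = contour_integral (circlepath 0 ?r) (\<lambda>u. contour_integral (circlepath 1 e) (f u))"
    using sw[of ?r] a by simp
  also have "\<dots> = contour_integral (circlepath 0 ?r) (\<lambda>u. contour_integral (circlepath 0 3) (f u)
    - contour_integral W (f u))"
  proof (rule contour_integral_eq)
    fix u assume "u \<in> path_image (circlepath 0 ?r)"
    then have u: "norm u = ?r" "u \<noteq> 0" "u \<noteq> 1" using a by auto
    define h where "h = (\<lambda>w. weight gp gm n1 x1 u / weight gp gm n2 x2 w)"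
    have f_h: "f u = (\<lambda>w. h w / (u - w))" by (simp add: f_def h_def)
    have h: "h holomorphic_on - {0, 1}"
      unfolding h_def by (intro holomorphic_intros weight_holomorphic) (auto simp: weight_nonzero)
    \<comment> \<open>Nothing is crossed between W and radius 1/2: 0 and u lie inside W, and 1 lies
      outside both.\<close>
    have "contour_integral W (f u) = contour_integral (circlepath 0 (1/2)) (f u)"
    proof (rule contour_integral_radial[where \<rho> = "\<lambda>t. a * exp (\<delta> * (cos (2 * pi * t) - b))" and S = "- {0, 1, u}"])
      show "f u holomorphic_on - {0, 1, u}"
        unfolding f_h by (intro holomorphic_intros holomorphic_on_subset[OF h]) auto
      show "valid_path W" unfolding W_def by (intro valid_path_scale) simp
      show "pathfinish W = pathstart W" by (simp add: W_def pathfinish_def pathstart_def wloop_closed)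
      show "W t = of_real (a * exp (\<delta> * (cos (2 * pi * t) - b))) * unit_pt t" for t
        by (simp add: W_def wloop_def)
      fix t s assume s: "s \<in> closed_segment (a * exp (\<delta> * (cos (2 * pi * t) - b))) (1/2)"
      have "a * (1/2) < a * exp (\<delta> * (cos (2 * pi * t) - b))"
        "a * exp (\<delta> * (cos (2 * pi * t) - b)) < a * 2"
        using a \<delta>[of t] by (intro mult_strict_left_mono, simp_all)+
      then have "a / 2 < a * exp (\<delta> * (cos (2 * pi * t) - b))" "a * exp (\<delta> * (cos (2 * pi * t) - b)) < 1 / 2"
        using a by linarith+
      then have "a / 2 < s" "s \<le> 1/2" using s unfolding closed_segment_eq_real_ivl
        by (auto split: if_splits simp del: mult_less_cancel_left_pos)
      then have n: "a / 4 < norm (of_real s * unit_pt t)" "norm (of_real s * unit_pt t) < 1"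
        using a by (auto simp: norm_mult)
      then show "of_real s * unit_pt t \<in> - {0, 1, u}" using u a
        by (metis (no_types, lifting) Compl_iff emptyE insertE less_irrefl n norm_one norm_zero not_less_iff_gr_or_eq
          zero_less_divide_iff zero_less_numeral)
    qed (auto)
    moreover have "contour_integral (circlepath 1 e) (\<lambda>w. h w / (u - w)) =
     contour_integral (circlepath 0 3) (\<lambda>w. h w / (u - w)) - contour_integral (circlepath 0 (1/2)) (\<lambda>w. h w / (u - w))"
      using u a re by (intro contour_integral_around_1[OF h]) auto
    ultimately show "contour_integral (circlepath 1 e) (f u) = contour_integral (circlepath 0 3) (f u) - contour_integral W (f u)"
      by (simp add: f_h)
  qed
  also have "\<dots> = contour_integral (circlepath 0 ?r) (\<lambda>u. contour_integral (circlepath 0 3) (f u)) -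
      contour_integral (circlepath 0 ?r) (\<lambda>u. contour_integral W (f u))"
  proof (rule contour_integral_diff)
    have "continuous_on (path_image (circlepath 0 ?r)) (\<lambda>u. contour_integral W (f u))"
      by (rule continuous_on_contour_integral_param[OF cW W'])
    then show "(\<lambda>u. contour_integral W (f u)) contour_integrable_on circlepath 0 ?r"
      by (intro contour_integrable_continuous_circlepath)
    have "continuous_on (path_image (circlepath 0 ?r)) (\<lambda>u. contour_integral (circlepath 0 3) (f u))"
      by (rule continuous_on_contour_integral_param[OF cf]) (use a cvd in auto)
    then show "(\<lambda>u. contour_integral (circlepath 0 3) (f u)) contour_integrable_on circlepath 0 ?r"
      by (intro contour_integrable_continuous_circlepath)
  qed
  also have "contour_integral (circlepath 0 ?r) (\<lambda>u. contour_integral W (f u))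
    = contour_integral W (\<lambda>w. contour_integral (circlepath 0 ?r) (\<lambda>u. f u w))"
    by (rule contour_integral_swap[OF cW _ W'(1) cvd W'(2)]) simp
  finally show ?thesis .
qed

lemma countable_level_cos: "countable {t::real. cos (2 * pi * t) = b}"
proof (cases "\<exists>t0. cos (2 * pi * t0) = b")
  case True
  then obtain t0 where t0: "cos (2 * pi * t0) = b" by blast
  have "{t. cos (2 * pi * t) = b} \<subseteq> (\<lambda>k::int. t0 + of_int k) ` UNIV \<union> (\<lambda>k::int. - t0 + of_int k) ` UNIV"
  proof
    fix t assume "t \<in> {t. cos (2 * pi * t) = b}"
    then have "cos (2 * pi * t) = cos (2 * pi * t0)" using t0 by simp
    then obtain n where n: "n \<in> \<int>" "2 * pi * t = 2 * pi * t0 + 2 * n * pi \<or> 2 * pi * t = - (2 * pi * t0) + 2 * n * pi"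
      unfolding cos_eq by auto
    then obtain k :: int where k: "n = of_int k" by (auto elim: Ints_cases)
    have "2 * pi * t = 2 * pi * (t0 + n) \<or> 2 * pi * t = 2 * pi * (- t0 + n)"
      using n(2) by (auto simp: algebra_simps)
    then have "t = t0 + n \<or> t = - t0 + n" by simp
    then show "t \<in> (\<lambda>k::int. t0 + of_int k) ` UNIV \<union> (\<lambda>k::int. - t0 + of_int k) ` UNIV"
      using k by blast
  qed
  then show ?thesis by (rule countable_subset) auto
next
  case False
  then have "{t. cos (2 * pi * t) = b} = {}" by auto
  then show ?thesis by simp
qed

text \<open>The loops for \<delta> and -\<delta> meet over cos (2 pi t) = b. The residue identities
  below are used only off this null set.\<close>

lemma AE_cos_neq: "AE t in lborel. cos (2 * pi * t) \<noteq> b"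
proof -
  have "{t. cos (2 * pi * t) = b} \<in> null_sets lborel"
    by (rule countable_imp_null_set_lborel[OF countable_level_cos])
  then have "AE t in lborel. t \<notin> {t. cos (2 * pi * t) = b}" by (rule AE_not_in)
  then show ?thesis by simp
qed

lemma countable_zeros_sin: "countable {t::real. sin (pi * (t - c)) = 0}"
proof -
  have "{t. sin (pi * (t - c)) = 0} \<subseteq> (\<lambda>k::int. c + of_int k) ` UNIV"
  proof
    fix t assume "t \<in> {t. sin (pi * (t - c)) = 0}"
    then obtain k :: int where "pi * (t - c) = of_int k * pi" by (auto simp: sin_zero_iff_int2)
    then have "pi * (t - c) = pi * of_int k" by simp
    then have "t - c = of_int k" using mult_left_cancel[of pi "t - c" "of_int k"] by simp
    then have "t = c + of_int k" by simp
    then show "t \<in> (\<lambda>k::int. c + of_int k) ` UNIV" by blast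
  qed
  then show ?thesis by (rule countable_subset) auto
qed

text \<open>Two parameters give the same ray exactly when this sine vanishes. They must be excluded
  because \<open>0 powr p = 0\<close>, so that a bound by a negative power of the sine may fail
  there.\<close>

lemma AE_sin_neq: "AE t in lborel. sin (pi * (t - c)) \<noteq> 0"
proof -
  have "{t. sin (pi * (t - c)) = 0} \<in> null_sets lborel"
    by (rule countable_imp_null_set_lborel[OF countable_zeros_sin])
  then have "AE t in lborel. t \<notin> {t. sin (pi * (t - c)) = 0}" by (rule AE_not_in)
  then show ?thesis by simp
qed

text \<open>Contour integrals are gauge integrals; as Lebesgue integrals they admit
  \<open>ennreal\<close> bounds, null sets and dominated convergence.\<close>

lemma contour_integral_LINT:
  assumes "continuous_on {0..1} (\<lambda>t. f (g t) * vector_derivative g (at t))"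
  shows "contour_integral g f = (LINT t:{0..1}|lborel. f (g t) * vector_derivative g (at t))"
  using set_borel_integral_eq_integral(2)[OF borel_integrable_atLeastAtMost'[OF assms]]
  by (simp add: contour_integral_integral)

text \<open>For \<delta> > 0 these are the parameters at which the loop for -\<delta> runs strictly
  inside the loop for \<delta>, so that moving u outwards passes the pole u = w.\<close>

definition right_arc :: "real \<Rightarrow> real set" where
  "right_arc b = {t \<in> {0..1}. b < cos (2 * pi * t)}"

lemma right_arc_sets [measurable]: "right_arc b \<in> sets borel"
proof -
  have "right_arc b = {0..1} \<inter> {t. b < cos (2 * pi * t)}" by (auto simp: right_arc_def)
  moreover have "open {t::real. b < cos (2 * pi * t)}"
    by (intro open_Collect_less continuous_intros)
  ultimately show ?thesis by (simp add: borel_open)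
qed

lemma right_arc_subset: "right_arc b \<subseteq> {0..1}"
  by (auto simp: right_arc_def)

text \<open>For fixed w = W t off the crossing points, the integral over the small circle plus the
  residue on \<open>right_arc b\<close> equals the integral over U. Integrating this in t gives the
  bound. An \<open>ennreal\<close> integral stands on the right because the U-integral, as a
  function of t, has not been shown to be measurable or integrable.\<close>

lemma crossing_bound:
  fixes gp gm :: real and n1 n2 :: nat and x1 x2 :: int
  assumes a: "0 < a" "a < 1/4" and \<delta>: "0 < \<delta>" "\<And>t. \<bar>\<delta> * (cos (2 * pi * t) - b)\<bar> < ln 2"
  defines "W \<equiv> \<lambda>t. of_real a * wloop (- \<delta>) b t" and "U \<equiv> \<lambda>t. of_real a * wloop \<delta> b t"
    and "W' \<equiv> \<lambda>t. of_real a * wloop' (- \<delta>) b t"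
    and "f \<equiv> \<lambda>u w. weight gp gm n1 x1 u / weight gp gm n2 x2 w * (1 / (u - w))"
  shows "ennreal (norm (contour_integral W (\<lambda>w. contour_integral (circlepath 0 (a/4)) (\<lambda>u. f u w))
     + 2 * of_real pi * \<i> * (LINT t:right_arc b|lborel. weight gp gm n1 x1 (W t) / weight gp gm n2 x2 (W t) * W' t)))
   \<le> (\<integral>\<^sup>+t. ennreal (norm (contour_integral U (\<lambda>u. weight gp gm n1 x1 u / (u - W t)))
              * norm (W' t / weight gp gm n2 x2 (W t))) * indicator {0..1} t \<partial>lborel)"
proof -
  define \<kappa> where "\<kappa> = (\<lambda>t. \<delta> * (cos (2 * pi * t) - b))"
  have exp_bd: "1/2 < exp (\<kappa> t) \<and> exp (\<kappa> t) < 2" for t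
  proof -
    have "- ln 2 < \<kappa> t" "\<kappa> t < ln 2" using \<delta>(2)[of t] by (auto simp: \<kappa>_def)
    then have "exp (- ln 2) < exp (\<kappa> t)" "exp (\<kappa> t) < exp (ln 2)" by (simp_all only: exp_less_cancel_iff)
    moreover have "exp (ln 2) = (2::real)" "exp (- ln 2) = (1/2::real)" by (simp_all add: exp_minus)
    ultimately show ?thesis by (simp only: simp_thms)
  qed
  have exp_bd': "1/2 < exp (- \<kappa> t) \<and> exp (- \<kappa> t) < 2" for t
    using exp_bd[of t] by (auto simp: exp_minus field_simps)
  define wt1 where "wt1 = weight gp gm n1 x1"
  define wt2 where "wt2 = weight gp gm n2 x2"
  define G where "G = (\<lambda>w. contour_integral (circlepath 0 (a/4)) (\<lambda>u. wt1 u / (u - w)))"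
  have Wr: "W t = of_real (a * exp (- \<kappa> t)) * unit_pt t" for t
    by (simp add: W_def wloop_def \<kappa>_def)
  have Ur: "U t = of_real (a * exp (\<kappa> t)) * unit_pt t" for t
    by (simp add: U_def wloop_def \<kappa>_def)
  have sandwich: "a / 4 < a * y \<and> a * y < 1" if "1/2 < y \<and> y < 2" for y
  proof -
    have "a * (1/2) < a * y" "a * y < a * 2"
      using a that by (simp_all only: mult_less_cancel_left_pos)
    then show ?thesis using a by linarith
  qed
  have normW: "a / 4 < norm (W t) \<and> norm (W t) < 1" for t
  proof -
    have "norm (W t) = a * exp (- \<kappa> t)" using a by (simp add: Wr norm_mult)
    then show ?thesis using sandwich[OF exp_bd'] by simp
  qed
  have normU: "a / 4 < a * exp (\<kappa> t) \<and> a * exp (\<kappa> t) < 1" for t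
    by (rule sandwich[OF exp_bd])
  have W0: "W t \<noteq> 0" "W t \<noteq> 1" for t using normW[of t] a by auto
  have holU: "wt1 holomorphic_on {z. z \<noteq> 0 \<and> norm z < 1}" unfolding wt1_def by (intro weight_holomorphic) auto
  have vU: "valid_path U" unfolding U_def by (intro valid_path_scale) simp
  have loopU: "pathfinish U = pathstart U" by (simp add: U_def pathfinish_def pathstart_def wloop_closed)
  have wt2: "wt2 (W t) \<noteq> 0" for t unfolding wt2_def by (intro weight_nonzero W0)
  have vW: "valid_path W" unfolding W_def by (intro valid_path_scale) simp
  have vdW: "vector_derivative W (at t) = W' t" for t
    unfolding W_def W'_def by (rule scaled_wloop_derivative)
  have cW: "continuous_on S W" "continuous_on S W'" for S
    unfolding W_def W'_def by (intro continuous_intros)+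
  have cwt: "continuous_on S (\<lambda>t. wt1 (W t))" "continuous_on S (\<lambda>t. wt2 (W t))" for S
    unfolding wt1_def wt2_def by (intro weight_continuous_on cW W0)+
  have imW: "a / 4 < norm w" if "w \<in> path_image W" for w
    using that normW unfolding path_image_def by auto
  have cG: "continuous_on (path_image W) G"
    unfolding G_def
  proof (rule continuous_on_contour_integral_param[OF _ valid_path_circlepath circlepath_C1])
    show "continuous_on (path_image W \<times> path_image (circlepath 0 (a/4))) (\<lambda>(w, u). wt1 u / (u - w))"
      unfolding case_prod_unfold wt1_def using a
      by (intro continuous_intros weight_continuous_on ballI) (auto dest!: imW)
  qed
  have cGW: "continuous_on {0..1} (\<lambda>t. G (W t))"
    by (rule continuous_on_compose2[OF cG cW(1)]) (auto simp: path_image_def)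
  have inner: "contour_integral (circlepath 0 (a/4)) (\<lambda>u. f u w) = G w / wt2 w"
    if w: "w \<in> path_image W" for w
  proof -
    have "continuous_on (path_image (circlepath 0 (a/4))) (\<lambda>u. wt1 u / (u - w))"
      unfolding wt1_def using a w
      by (intro continuous_intros weight_continuous_on ballI) (auto dest!: imW)
    then have int: "(\<lambda>u. wt1 u / (u - w)) contour_integrable_on circlepath 0 (a/4)"
      by (rule contour_integrable_continuous_circlepath)
    have "contour_integral (circlepath 0 (a/4)) (\<lambda>u. f u w) =
        contour_integral (circlepath 0 (a/4)) (\<lambda>u. (wt1 u / (u - w)) / wt2 w)"
      by (rule contour_integral_eq) (simp add: f_def wt1_def wt2_def)
    also have "\<dots> = G w / wt2 w" unfolding G_def by (rule contour_integral_div[OF int])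
    finally show ?thesis .
  qed
  define g1 where "g1 = (\<lambda>t. G (W t) / wt2 (W t) * W' t)"
  define g2 where "g2 = (\<lambda>t. wt1 (W t) / wt2 (W t) * W' t)"
  have cg1: "continuous_on {0..1} g1" unfolding g1_def by (intro continuous_intros cGW cwt cW ballI wt2)
  have cg2: "continuous_on {0..1} g2" unfolding g2_def by (intro continuous_intros cwt cW ballI wt2)
  have "contour_integral W (\<lambda>w. contour_integral (circlepath 0 (a/4)) (\<lambda>u. f u w)) = contour_integral W (\<lambda>w. G w
    / wt2 w)"
    by (rule contour_integral_eq) (rule inner)
  also have "\<dots> = (LINT t:{0..1}|lborel. g1 t)"
    using cg1 by (subst contour_integral_LINT) (simp_all add: g1_def vdW)
  finally have e1: "contour_integral W (\<lambda>w. contour_integral (circlepath 0 (a/4)) (\<lambda>u. f u w))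
    = (LINT t:{0..1}|lborel. g1 t)" .
  have i1: "set_integrable lborel {0..1} g1" by (rule borel_integrable_atLeastAtMost'[OF cg1])
  have i2: "set_integrable lborel (right_arc b) (\<lambda>t. 2 * of_real pi * \<i> * g2 t)"
    by (intro set_integrable_mult_right set_integrable_subset[OF borel_integrable_atLeastAtMost'[OF cg2]] right_arc_subset)
       simp
  have sum: "(LINT t:{0..1}|lborel. g1 t) + 2 * of_real pi * \<i> * (LINT t:right_arc b|lborel. g2 t)
    = (LINT t|lborel. indicator {0..1} t *\<^sub>R g1 t + indicator (right_arc b) t *\<^sub>R (2 * of_real pi * \<i> * g2 t))"
    (is "_ = (LINT t|lborel. ?h t)")
    using i1 i2 unfolding set_lebesgue_integral_def set_integrable_def
    by (subst Bochner_Integration.integral_add) (simp_all flip: integral_mult_right_zero add: scaleR_conv_of_real mult_ac)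
  have le1: "ennreal (norm (LINT t|lborel. ?h t)) \<le> (\<integral>\<^sup>+t. norm (?h t) \<partial>lborel)"
    by (rule integral_norm_bound_ennreal) (use i1 i2 in \<open>auto simp: set_integrable_def\<close>)
  have pt: "ennreal (norm (?h t)) \<le> ennreal (norm (contour_integral U (\<lambda>u. wt1 u / (u - W t)))
      * norm (W' t / wt2 (W t))) * indicator {0..1} t" if t: "cos (2 * pi * t) \<noteq> b" for t
  proof (cases "t \<in> {0..1}")
    case True
    have "\<kappa> t \<noteq> 0" using t \<delta> by (simp add: \<kappa>_def)
    then have ne: "a * exp (- \<kappa> t) \<noteq> a * exp (\<kappa> t)" using a by simp
    have "contour_integral U (\<lambda>u. wt1 u / (u - W t)) =
       contour_integral (circlepath 0 (a/4)) (\<lambda>u. wt1 u / (u - W t)) + (if a * exp (- \<kappa> t) < a * exp (\<kappa> t) then 2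
         * of_real pi * \<i> * wt1 (W t) else 0)"
      by (rule contour_integral_cross[where R = 1 and \<rho> = "\<lambda>t. a * exp (\<kappa> t)" and ?t0.0 = t
            and s = "a * exp (- \<kappa> t)", OF holU vU loopU Ur normU Wr _ _ _ True ne])
         (use a sandwich[OF exp_bd'] in auto)
    also have "(a * exp (- \<kappa> t) < a * exp (\<kappa> t)) = (t \<in> right_arc b)"
      using a True \<delta>(1) by (simp add: \<kappa>_def right_arc_def zero_less_mult_iff)
    finally have Y: "contour_integral U (\<lambda>u. wt1 u / (u - W t)) = G (W t) + (if t \<in> right_arc b then 2 * of_real pi * \<i>
      * wt1 (W t) else 0)"
      by (simp add: G_def)
    have "?h t = contour_integral U (\<lambda>u. wt1 u / (u - W t)) * (W' t / wt2 (W t))"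
      unfolding Y g1_def g2_def using True by (auto simp: indicator_def algebra_simps)
    then show ?thesis using True by (simp flip: norm_mult)
  next
    case False
    then have "t \<notin> right_arc b" using right_arc_subset by blast
    then show ?thesis using False by simp
  qed
  have le2: "(\<integral>\<^sup>+t. norm (?h t) \<partial>lborel)
    \<le> (\<integral>\<^sup>+t. ennreal (norm (contour_integral U (\<lambda>u. wt1 u / (u - W t)))
              * norm (W' t / wt2 (W t))) * indicator {0..1} t \<partial>lborel)"
    by (intro nn_integral_mono_AE eventually_mono[OF AE_cos_neq[of b]]) (rule pt)
  show ?thesis
    using order.trans[OF le1 le2]
    unfolding e1 wt1_def[symmetric] wt2_def[symmetric] using sum by (simp add: g2_def)
qed

subsection \<open>Estimates on the loops\<close>

lemma exp_less_two: "x < ln 2 \<Longrightarrow> exp (x::real) < 2"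
  by (metis exp_less_cancel_iff exp_ln zero_less_numeral)

lemma half_less_exp: "- ln 2 < x \<Longrightarrow> 1/2 < exp (x::real)"
  using exp_less_two[of "- x"] by (simp add: exp_minus field_simps)

text \<open>A cubic Taylor remainder together with |pi x| <= 2 is enough, since any positive
  constant will do.\<close>

lemma abs_sin_pi_ge:
  assumes "\<bar>x\<bar> \<le> (1/2::real)" shows "\<bar>x\<bar> / 2 \<le> \<bar>sin (pi * x)\<bar>"
proof -
  define y where "y = pi * x"
  have "\<bar>sin y - (\<Sum>m<3. sin_coeff m * y ^ m)\<bar> \<le> inverse (fact 3) * \<bar>y\<bar> ^ 3"
    by (rule Maclaurin_sin_bound)
  then have 1: "\<bar>sin y - y\<bar> \<le> \<bar>y\<bar> ^ 3 / 6"
    by (simp add: numeral_3_eq_3 sin_coeff_def fact_numeral)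
  have y: "\<bar>y\<bar> \<le> 2"
  proof -
    have "\<bar>y\<bar> = pi * \<bar>x\<bar>" by (simp add: y_def abs_mult)
    also have "\<dots> \<le> 4 * (1/2)" using assms pi_less_4 by (intro mult_mono) auto
    finally show ?thesis by simp
  qed
  have "\<bar>y\<bar> ^ 3 = \<bar>y\<bar> ^ 2 * \<bar>y\<bar>" by (simp add: power3_eq_cube power2_eq_square)
  also have "\<dots> \<le> 2 ^ 2 * \<bar>y\<bar>" using y by (intro mult_right_mono power_mono) auto
  finally have "\<bar>y\<bar> ^ 3 / 6 \<le> 2 / 3 * \<bar>y\<bar>" by simp
  then have "\<bar>y\<bar> / 3 \<le> \<bar>sin y\<bar>" using 1 by linarith
  moreover have "2 * \<bar>x\<bar> \<le> \<bar>y\<bar>" unfolding y_def abs_mult using pi_ge_two by (intro mult_right_mono) auto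
  ultimately show ?thesis unfolding y_def[symmetric] by linarith
qed

lemma nn_integral_powr_02:
  "(\<integral>\<^sup>+y. ennreal (y powr (-3/4)) * indicator {0..2} y \<partial>lborel) < \<infinity>"
proof -
  have "((\<lambda>x. x powr (-3/4)) has_integral ((2::real) powr (-3/4+1) / (-3/4+1))) {0..2}"
    by (rule has_integral_powr_from_0) auto
  then have "((\<lambda>x. if x \<in> {0..2} then x powr (-3/4) else 0) has_integral ((2::real) powr (-3/4+1) / (-3/4+1))) UNIV"
    by (subst has_integral_restrict_UNIV)
  then have "integral\<^sup>N lborel (\<lambda>x::real. ennreal (if x \<in> {0..2} then x powr (-3/4) else 0)) = ennreal (2 powr (-3/4+1)
    / (-3/4+1))"
    by (intro nn_integral_has_integral_lborel) auto
  moreover have "(\<lambda>x::real. ennreal (if x \<in> {0..2} then x powr (-3/4) else 0)) = (\<lambda>y. ennreal (y powr (-3/4))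
    * indicator {0..2} y)"
    by (auto simp: indicator_def)
  ultimately show ?thesis by simp
qed

text \<open>The bound must not depend on c. Periodicity moves c into [0, 1); then t - c is within
  1/2 of 0, 1 or -1, and the integrand is dominated by translates and reflections of one fixed
  integrable power.\<close>

lemma nn_integral_sin_powr_bounded:
  obtains K where "K \<ge> 0" "\<And>c. (\<integral>\<^sup>+t. ennreal (\<bar>sin (pi * (t - c))\<bar> powr (-3/4))
    * indicator {0..1} t \<partial>lborel) \<le> ennreal K"
proof -
  define g where "g = (\<lambda>y::real. ennreal (y powr (-3/4)) * indicator {0..2} y)"
  have g[measurable]: "g \<in> borel_measurable borel" unfolding g_def by measurable
  define J where "J = integral\<^sup>N lborel g"
  have J: "J < \<infinity>" unfolding J_def g_def by (rule nn_integral_powr_02)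
  have sh: "(\<integral>\<^sup>+t. g (t - c) \<partial>lborel) = J" "(\<integral>\<^sup>+t. g (c - t) \<partial>lborel) = J" for c
    using nn_integral_real_affine[OF g, of 1 "-c"] nn_integral_real_affine[OF g, of "-1" "c"]
    by (simp_all add: J_def)
  \<comment> \<open>Each pair J + J is the two-sided singularity at one of the points c, c + 1, c -
    1; all six integrals agree by translation and reflection.\<close>
  define C where "C = ennreal (2 powr (3/4)) * ((J + J) + (J + J) + (J + J))"
  have per: "\<bar>sin (pi * (t - of_int k - c))\<bar> = \<bar>sin (pi * (t - c))\<bar>" for t c :: real and k :: int
  proof -
    have "pi * (t - of_int k - c) = pi * (t - c) - pi * of_int k" by (simp add: algebra_simps)
    then have "sin (pi * (t - of_int k - c)) = sin (pi * (t - c)) * cos (pi * of_int k) - cos (pi * (t - c)) * sin (pi * of_int k)"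
      by (simp only: sin_diff)
    also have "sin (pi * of_int k) = 0" by (rule sin_npi_int)
    also have "\<bar>sin (pi * (t - c)) * cos (pi * of_int k) - cos (pi * (t - c)) * 0\<bar> = \<bar>sin (pi * (t - c))\<bar>"
      using sin_zero_abs_cos_one[OF sin_npi_int[of k]] by (simp add: abs_mult del: cos_npi_int)
    finally show ?thesis .
  qed
  have pw: "ennreal (\<bar>sin (pi * (t - c))\<bar> powr (-3/4)) \<le>
      ennreal (2 powr (3/4)) * ((g (t - c) + g (c - t)) + (g (t - (c + 1)) + g ((c + 1) - t)) + (g (t - (c - 1)) + g ((c - 1) - t)))"
    if t: "t \<in> {0..1}" and c: "0 \<le> c" "c < 1" for t c
  proof (cases "sin (pi * (t - c)) = 0")
    case False
    obtain k :: int where k: "k = 0 \<or> k = 1 \<or> k = -1" "\<bar>t - c - of_int k\<bar> \<le> 1/2"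
    proof -
      consider "\<bar>t - c\<bar> \<le> 1/2" | "t - c > 1/2" | "t - c < -1/2" by linarith
      then show ?thesis
      proof cases
        case 1 then show ?thesis using that[of 0] by simp
      next
        case 2 then show ?thesis using that[of 1] t c by simp
      next
        case 3 then show ?thesis using that[of "-1"] t c by simp
      qed
    qed
    define x where "x = t - of_int k - c"
    have sx: "\<bar>sin (pi * (t - c))\<bar> = \<bar>sin (pi * x)\<bar>" using per[of t k c] by (simp add: x_def)
    have "x = t - c - of_int k" by (simp add: x_def)
    then have x: "\<bar>x\<bar> \<le> 1/2" "x \<noteq> 0" using k False sx by auto
    have "\<bar>sin (pi * x)\<bar> powr (-3/4) \<le> (\<bar>x\<bar> / 2) powr (-3/4)"
      using x abs_sin_pi_ge[of x] by (intro powr_mono2') auto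
    also have "\<dots> = 2 powr (3/4) * \<bar>x\<bar> powr (-3/4)"
      by (simp add: powr_divide powr_minus field_simps)
    finally have "ennreal (\<bar>sin (pi * (t - c))\<bar> powr (-3/4)) \<le> ennreal (2 powr (3/4)) * ennreal (\<bar>x\<bar> powr (-3/4))"
      unfolding sx by (simp add: ennreal_leI flip: ennreal_mult)
    also have "ennreal (\<bar>x\<bar> powr (-3/4)) \<le> g x + g (- x)"
      using x by (cases "x \<ge> 0") (auto simp: g_def)
    also have "g x + g (- x) \<le> (g (t - c) + g (c - t)) + (g (t - (c + 1)) + g ((c + 1) - t)) + (g (t - (c - 1)) + g ((c - 1) - t))"
    proof -
      have le: "A \<le> A + B + C" "B \<le> A + B + C" "C \<le> A + B + C" for A B C :: ennreal
        by (auto intro!: add_increasing add_increasing2)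
      have "x = t - c \<and> - x = c - t \<or> x = t - (c + 1) \<and> - x = (c + 1) - t \<or> x = t - (c - 1) \<and> - x = (c - 1) - t"
        using k by (auto simp: x_def)
      then show ?thesis by (elim disjE conjE) (simp_all only: le)
    qed
    finally show ?thesis by (simp add: mult_left_mono)
  qed simp
  have main: "(\<integral>\<^sup>+t. ennreal (\<bar>sin (pi * (t - c))\<bar> powr (-3/4)) * indicator {0..1} t \<partial>lborel) \<le> C"
    for c
  proof -
    define c' where "c' = frac c"
    have c': "0 \<le> c'" "c' < 1" by (auto simp: c'_def frac_lt_1)
    have "\<bar>sin (pi * (t - c))\<bar> = \<bar>sin (pi * (t - c'))\<bar>" for t
    proof -
      have "t - of_int \<lfloor>c\<rfloor> - c' = t - c" by (simp add: c'_def frac_def)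
      then show ?thesis using per[of t "\<lfloor>c\<rfloor>" c'] by (simp only:)
    qed
    then have "(\<integral>\<^sup>+t. ennreal (\<bar>sin (pi * (t - c))\<bar> powr (-3/4)) * indicator {0..1} t \<partial>lborel)
       = (\<integral>\<^sup>+t. ennreal (\<bar>sin (pi * (t - c'))\<bar> powr (-3/4)) * indicator {0..1} t \<partial>lborel)" by simp
    also have "\<dots> \<le> (\<integral>\<^sup>+t. ennreal (2 powr (3/4)) * ((g (t - c') + g (c' - t)) + (g (t - (c' + 1)) + g ((c' + 1)
      - t)) + (g (t - (c' - 1)) + g ((c' - 1) - t))) \<partial>lborel)"
      by (intro nn_integral_mono) (use pw[OF _ c'] in \<open>auto simp: indicator_def\<close>)
    also have "\<dots> = C"
      by (simp add: nn_integral_cmult nn_integral_add sh C_def)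
    finally show ?thesis .
  qed
  have "C < \<infinity>" using J by (auto simp: C_def ennreal_mult_less_top)
  then have "C = ennreal (enn2real C)" by simp
  then show ?thesis using main that[of "enn2real C"] by (metis enn2real_nonneg)
qed

text \<open>Clamping b to [-1, 1] only brings it closer to the values of the cosine, and the
  difference from the clamped level factors into two sines. The square of the smaller sine bounds
  the product, so the exponent -3/8 doubles to -3/4, which is integrable even when the two zeros
  coincide.\<close>

lemma cos_level_powr_bound:
  obtains \<beta> b' where "\<And>t. cos (2 * pi * t) \<noteq> b \<Longrightarrow> cos (2 * pi * t) \<noteq> b' \<Longrightarrow>
     \<bar>cos (2 * pi * t) - b\<bar> powr (-3/8) \<le> \<bar>sin (pi * (t - \<beta>))\<bar> powr (-3/4) + \<bar>sin (pi * (t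
       + \<beta>))\<bar> powr (-3/4)"
proof -
  define b' where "b' = max (-1) (min 1 b)"
  define \<beta> where "\<beta> = arccos b' / (2 * pi)"
  have b': "-1 \<le> b'" "b' \<le> 1" by (auto simp: b'_def)
  have cb: "cos (2 * pi * \<beta>) = b'" using b' by (simp add: \<beta>_def)
  \<comment> \<open>For b outside [-1, 1] the level b' is still attained, and there both sines
    vanish and the right-hand side is 0. Hence b' is excluded as well as b.\<close>
  have "\<bar>cos (2 * pi * t) - b\<bar> powr (-3/8) \<le> \<bar>sin (pi * (t - \<beta>))\<bar> powr (-3/4) + \<bar>sin (pi * (t
    + \<beta>))\<bar> powr (-3/4)"
    if t: "cos (2 * pi * t) \<noteq> b" "cos (2 * pi * t) \<noteq> b'" for t
  proof -
    define p where "p = \<bar>sin (pi * (t - \<beta>))\<bar>"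
    define q where "q = \<bar>sin (pi * (t + \<beta>))\<bar>"
    have "cos (2 * pi * t) - b' = 2 * sin ((2 * pi * t + 2 * pi * \<beta>) / 2) * sin ((2 * pi * \<beta> - 2 * pi * t) / 2)"
      unfolding cb[symmetric] by (rule cos_diff_cos)
    also have "(2 * pi * t + 2 * pi * \<beta>) / 2 = pi * (t + \<beta>)" by (simp add: algebra_simps)
    also have "(2 * pi * \<beta> - 2 * pi * t) / 2 = - (pi * (t - \<beta>))" by (simp add: field_simps)
    finally have eq: "\<bar>cos (2 * pi * t) - b'\<bar> = 2 * q * p"
      by (simp add: p_def q_def abs_mult)
    have pq: "p > 0" "q > 0" using t eq by (auto simp: p_def q_def)
    define m where "m = min p q"
    have m: "m > 0" "m \<le> p" "m \<le> q" using pq by (auto simp: m_def)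
    have "m * m \<le> q * p" using m by (intro mult_mono) auto
    moreover have "0 < q * p" using pq by simp
    ultimately have "m ^ 2 \<le> 2 * q * p" by (simp add: power2_eq_square)
    also have "\<dots> \<le> \<bar>cos (2 * pi * t) - b\<bar>"
    proof -
      have "\<bar>y - b'\<bar> \<le> \<bar>y - b\<bar>" if "-1 \<le> y" "y \<le> 1" for y
        using that unfolding b'_def by (auto simp: max_def min_def)
      then show ?thesis unfolding eq[symmetric] by simp
    qed
    finally have "\<bar>cos (2 * pi * t) - b\<bar> powr (-3/8) \<le> (m ^ 2) powr (-3/8)"
      using m by (intro powr_mono2') auto
    also have "(m ^ 2) powr (-3/8) = m powr (-3/4)"
    proof -
      have "m ^ 2 = m powr 2" using m by simp
      then show ?thesis by (simp add: powr_powr)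
    qed
    also have "\<dots> \<le> p powr (-3/4) + q powr (-3/4)" by (auto simp: m_def min_def)
    finally show ?thesis by (simp add: p_def q_def)
  qed
  then show ?thesis by (rule that)
qed

lemma abs_exp_minus_linear:
  assumes "\<bar>x::real\<bar> \<le> 1" shows "\<bar>exp x - 1 - x\<bar> \<le> x\<^sup>2"
proof -
  have ge: "exp x \<ge> 1 + x" by (rule exp_ge_add_one_self)
  have "exp x \<le> 1 + x + x\<^sup>2"
  proof (cases "x \<ge> 0")
    case True
    then show ?thesis using exp_bound[of x] assms by simp
  next
    case False
    have "exp (-x) \<ge> 1 - x" using exp_ge_add_one_self[of "-x"] by simp
    have "(1 + x + x\<^sup>2) * (1 - x) = 1 - x ^ 3" by (simp add: algebra_simps power2_eq_square power3_eq_cube)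
    also have "\<dots> \<ge> 1" using False by (simp add: power3_eq_cube mult_nonneg_nonpos2 zero_le_mult_iff mult_le_0_iff)
    finally have "1 \<le> (1 + x + x\<^sup>2) * (1 - x)" .
    also have "\<dots> \<le> (1 + x + x\<^sup>2) * exp (-x)"
    proof (rule mult_left_mono)
      have "1 + x + x\<^sup>2 = (1/2 + x)\<^sup>2 + 3/4" by (simp add: power2_eq_square algebra_simps)
      then show "0 \<le> 1 + x + x\<^sup>2" by (metis add_nonneg_nonneg zero_le_power2 divide_nonneg_nonneg zero_le_numeral)
    qed fact
    finally show ?thesis by (simp add: exp_minus field_simps)
  qed
  then show ?thesis using ge zero_le_power2[of x] by linarith
qed

lemma unit_pt_cis: "unit_pt t = cis (2 * pi * t)"
  by (simp add: unit_pt_def cis_conv_exp mult_ac)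

lemma norm_Ln_one_minus_add_le:
  assumes "norm z \<le> 1/2"
  shows "norm (Ln (1 - z) + z) \<le> 2 * (norm z)\<^sup>2"
proof -
  have "norm (Ln (1 + (- z)) - (- z)) \<le> norm (- z) ^ 2 / (1 - norm (- z))"
    by (rule Ln_approx_linear) (use assms in auto)
  also have "\<dots> \<le> norm (-z) ^ 2 / (1/2)" using assms by (intro divide_left_mono) auto
  finally show ?thesis by simp
qed

text \<open>To first order |1 - z|^n is exp (- n Re z). The error n |z|^2 stays bounded in the
  application, where |z| is of order a and n of order gp / a^2.\<close>

lemma norm_one_minus_power:
  assumes "norm z \<le> 1/2"
  obtains y where "norm (1 - z) ^ n = exp (- real n * Re z + y)" "\<bar>y\<bar> \<le> 2 * real n * (norm z)\<^sup>2"
proof -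
  have nz: "1 - z \<noteq> 0" using assms by auto
  define L where "L = Re (Ln (1 - z))"
  have "norm (1 - z) = exp L" using nz by (metis L_def exp_Ln norm_exp_eq_Re)
  then have e: "norm (1 - z) ^ n = exp (real n * L)" by (simp add: exp_of_nat_mult)
  have "norm (Ln (1 - z) + z) \<le> 2 * (norm z)\<^sup>2" using assms by (rule norm_Ln_one_minus_add_le)
  then have "\<bar>Re (Ln (1 - z) + z)\<bar> \<le> 2 * (norm z)\<^sup>2" using abs_Re_le_cmod order_trans by blast
  then have "\<bar>real n * (L + Re z)\<bar> \<le> real n * (2 * (norm z)\<^sup>2)"
    unfolding abs_mult L_def by (intro mult_mono) auto
  then show ?thesis using e by (intro that[of "real n * (L + Re z)"]) (auto simp: algebra_simps)
qed

text \<open>The parts of log |weight| on a loop that stay bounded: the factor with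
  \<open>gm\<close>, the deviation of b from the critical level x a / (2 gp), the deviation of n a
  from gp / a, and the quadratic term of log (1 - u). The factors 2 and 8 come from |u| <= 2
  a.\<close>

definition weight_error :: "real \<Rightarrow> real \<Rightarrow> real \<Rightarrow> real \<Rightarrow> nat \<Rightarrow> int \<Rightarrow> real" where
  "weight_error gp gm a b n x =
     2 * gm * a + \<bar>of_int x - 2 * (gp / a) * b\<bar> + 2 * \<bar>real n * a - gp / a\<bar> + 8 * real n * a\<^sup>2"

text \<open>The leading exponent \<open>-2 (gp/a) \<delta> \<kappa>\<^sup>2\<close> changes sign with \<open>\<delta>\<close>;
  everything else is bounded by half of it or by the constant \<open>C\<close>.\<close>

lemma weight_wloop_estimate:
  fixes \<delta> b t :: real
  defines "\<kappa> \<equiv> cos (2 * pi * t) - b"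
  assumes a: "0 < a" "a \<le> 1/8" and \<delta>: "\<bar>\<delta>\<bar> \<le> 1/2" "\<bar>\<delta> * \<kappa>\<bar> < ln 2"
    and gp: "gp > 0" "gm > 0"
    and C: "weight_error gp gm a b n x \<le> C"
  obtains E where "norm (weight gp gm n x (of_real a * wloop \<delta> b t)) = a powi x * exp E"
    "\<bar>E + 2 * (gp / a) * \<delta> * \<kappa>\<^sup>2\<bar> \<le> C + gp / a * \<bar>\<delta>\<bar> * \<kappa>\<^sup>2"
proof -
  define \<rho> where "\<rho> = \<delta> * \<kappa>"
  define \<theta> where "\<theta> = 2 * pi * t"
  define M where "M = gp / a"
  have M: "M > 0" using a gp by (simp add: M_def)
  define v where "v = of_real a * wloop \<delta> b t"
  have v: "v = of_real (a * exp \<rho>) * cis \<theta>"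
    by (simp add: v_def wloop_def unit_pt_cis \<rho>_def \<kappa>_def \<theta>_def)
  have ex: "exp \<rho> < 2" using \<delta> by (intro exp_less_two) (simp add: \<rho>_def abs_less_iff)
  have nv: "norm v = a * exp \<rho>" using a by (simp add: v norm_mult)
  have nv2: "norm v \<le> 2 * a" using ex a by (simp add: nv)
  have ln2: "ln 2 < (1::real)" using ln_less_self[of 2] ln_2_less_1 by simp
  have \<rho>1: "\<bar>\<rho>\<bar> \<le> 1" using \<delta>(2) ln2 by (simp add: \<rho>_def)
  obtain y where y: "norm (1 - v) ^ n = exp (- real n * Re v + y)" "\<bar>y\<bar> \<le> 2 * real n * (norm v)\<^sup>2"
    by (rule norm_one_minus_power[of v n]) (use nv2 a in auto)
  have y2: "\<bar>y\<bar> \<le> 8 * real n * a\<^sup>2"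
  proof -
    have "(norm v)\<^sup>2 \<le> (2 * a)\<^sup>2" using nv2 by (intro power_mono) auto
    then have "2 * real n * (norm v)\<^sup>2 \<le> 2 * real n * (2 * a)\<^sup>2" by (intro mult_left_mono) auto
    also have "2 * real n * (2 * a)\<^sup>2 = 8 * real n * a\<^sup>2" by (simp add: power_mult_distrib)
    finally show ?thesis using y(2) by linarith
  qed
  have inv: "inverse v = of_real (exp (- \<rho>) / a) * cis (- \<theta>)"
    using a by (simp add: v field_simps exp_minus flip: cis_inverse)
  have Rev: "Re v = a * exp \<rho> * cos \<theta>" by (simp add: v)
  have Reinv: "Re (inverse v) = exp (- \<rho>) / a * cos \<theta>" by (simp only: inv) simp
  define E where "E = gm * Re v + gp * Re (inverse v) + of_int x * \<rho> + (- real n * Re v + y)"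
  have px: "norm v powi x = a powi x * exp (of_int x * \<rho>)"
  proof -
    have "exp \<rho> powi x = exp (of_int x * \<rho>)"
      by (simp add: exp_power_int mult.commute)
    then show ?thesis by (simp add: nv power_int_mult_distrib)
  qed
  have "norm (weight gp gm n x v) = exp (gm * Re v + gp * Re (inverse v)) * norm v powi x * norm (1 - v) ^ n"
    by (simp add: weight_def norm_mult norm_power norm_power_int norm_exp_eq_Re)
  also have "\<dots> = a powi x * exp E"
    unfolding px y(1) E_def exp_add by (simp only: mult_ac)
  finally have 1: "norm (weight gp gm n x v) = a powi x * exp E" .
  \<comment> \<open>Linearising in \<rho>, the term M cos \<theta> (exp (-\<rho>) - exp \<rho>)
    becomes -2 M \<rho> cos \<theta>, and x contributes about 2 M b \<rho>. With \<rho> = \<delta>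
    \<kappa> and \<kappa> = cos \<theta> - b the sum is -2 M \<delta> \<kappa>^2.\<close>
  have "E = - 2 * M * \<delta> * \<kappa>\<^sup>2 + (M * cos \<theta> * (exp (- \<rho>) - exp \<rho> + 2 * \<rho>))
     + (gm * Re v + (of_int x - 2 * M * b) * \<rho> - (real n * a - M) * (exp \<rho> * cos \<theta>) + y)"
  proof -
    have "gp * Re (inverse v) = M * exp (- \<rho>) * cos \<theta>" by (simp only: Reinv M_def) simp
    moreover have "\<delta> * \<kappa>\<^sup>2 = \<rho> * (cos \<theta> - b)"
      by (simp add: \<rho>_def power2_eq_square \<theta>_def \<kappa>_def)
    then have "- 2 * M * \<delta> * \<kappa>\<^sup>2 = - 2 * M * (\<rho> * (cos \<theta> - b))" by (simp add: mult.assoc)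
    moreover have "real n * Re v = real n * a * (exp \<rho> * cos \<theta>)" by (simp add: Rev)
    ultimately show ?thesis unfolding E_def by (auto simp: algebra_simps)
  qed
  then have E_dec: "E + 2 * M * \<delta> * \<kappa>\<^sup>2 = (M * cos \<theta> * (exp (- \<rho>) - exp \<rho> + 2 * \<rho>))
     + (gm * Re v + (of_int x - 2 * M * b) * \<rho> - (real n * a - M) * (exp \<rho> * cos \<theta>) + y)"
    by simp
  have t1: "\<bar>M * cos \<theta> * (exp (- \<rho>) - exp \<rho> + 2 * \<rho>)\<bar> \<le> M * \<bar>\<delta>\<bar> * \<kappa>\<^sup>2"
  proof -
    have "\<bar>exp \<rho> - 1 - \<rho>\<bar> \<le> \<rho>\<^sup>2" "\<bar>exp (-\<rho>) - 1 - (-\<rho>)\<bar> \<le> (-\<rho>)\<^sup>2"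
      using \<rho>1 by (intro abs_exp_minus_linear; simp)+
    \<comment> \<open>A quadratic remainder suffices: |\<delta>| <= 1/2 makes it at most half of the
      main term.\<close>
    then have "\<bar>exp (- \<rho>) - exp \<rho> + 2 * \<rho>\<bar> \<le> 2 * \<rho>\<^sup>2" by simp
    also have "2 * \<rho>\<^sup>2 = 2 * \<bar>\<delta>\<bar> * (\<bar>\<delta>\<bar> * \<kappa>\<^sup>2)"
      by (simp add: \<rho>_def power2_eq_square)
    also have "\<dots> \<le> 1 * (\<bar>\<delta>\<bar> * \<kappa>\<^sup>2)" using \<delta> by (intro mult_right_mono) auto
    finally have "\<bar>exp (- \<rho>) - exp \<rho> + 2 * \<rho>\<bar> \<le> \<bar>\<delta>\<bar> * \<kappa>\<^sup>2" by simp
    then have "M * \<bar>cos \<theta>\<bar> * \<bar>exp (- \<rho>) - exp \<rho> + 2 * \<rho>\<bar> \<le> M * 1 * (\<bar>\<delta>\<bar>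
      * \<kappa>\<^sup>2)"
      using M by (intro mult_mono) auto
    then show ?thesis using M by (simp add: abs_mult)
  qed
  have t2: "\<bar>gm * Re v\<bar> \<le> 2 * gm * a"
    using abs_Re_le_cmod[of v] nv2 gp by (simp add: abs_mult)
  have t3: "\<bar>(of_int x - 2 * M * b) * \<rho>\<bar> \<le> \<bar>of_int x - 2 * M * b\<bar>"
    using \<rho>1 by (simp add: abs_mult mult_left_le)
  have t4: "\<bar>(real n * a - M) * (exp \<rho> * cos \<theta>)\<bar> \<le> 2 * \<bar>real n * a - M\<bar>"
  proof -
    have "\<bar>exp \<rho> * cos \<theta>\<bar> \<le> 2 * 1" unfolding abs_mult using ex by (intro mult_mono) auto
    then have "\<bar>real n * a - M\<bar> * \<bar>exp \<rho> * cos \<theta>\<bar> \<le> \<bar>real n * a - M\<bar> * 2"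
      by (intro mult_left_mono) auto
    then show ?thesis unfolding abs_mult[of "real n * a - M"] by simp
  qed
  have "\<bar>E + 2 * M * \<delta> * \<kappa>\<^sup>2\<bar> \<le> C + M * \<bar>\<delta>\<bar> * \<kappa>\<^sup>2"
    unfolding E_dec using t1 t2 t3 t4 y2 C[unfolded weight_error_def, folded M_def] by linarith
  with 1 show ?thesis using that[of E] by (simp add: v_def M_def)
qed

text \<open>The law of cosines, arranged so that for positive radii the radial and the angular
  square each bound the distance from below.\<close>

lemma norm_diff_polar_sq:
  "(norm (of_real r * unit_pt s - of_real q * unit_pt t))\<^sup>2 = (r - q)\<^sup>2 + 4 * r * q * (sin (pi * (s - t)))\<^sup>2"
proof -
  define A where "A = 2 * pi * s" define B where "B = 2 * pi * t"
  have "(norm (of_real r * unit_pt s - of_real q * unit_pt t))\<^sup>2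
     = (r * cos A - q * cos B)\<^sup>2 + (r * sin A - q * sin B)\<^sup>2"
    by (simp add: cmod_power2 unit_pt_cis A_def B_def)
  also have "\<dots> = r\<^sup>2 * ((cos A)\<^sup>2 + (sin A)\<^sup>2) + q\<^sup>2 * ((cos B)\<^sup>2 + (sin B)\<^sup>2) - 2 * r * q
    * cos (A - B)"
    unfolding cos_diff by (simp add: power2_eq_square algebra_simps del: sin_cos_squared_add sin_cos_squared_add2 sin_cos_squared_add3)
  also have "\<dots> = r\<^sup>2 + q\<^sup>2 - 2 * r * q * cos (A - B)" by (simp add: add.commute)
  also have "cos (A - B) = 1 - 2 * (sin (pi * (s - t)))\<^sup>2"
    using cos_double_sin[of "pi * (s - t)"] by (simp add: A_def B_def algebra_simps)
  finally show ?thesis by (simp add: power2_eq_square algebra_simps)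
qed

lemma abs_exp_diff_ge:
  fixes x y :: real
  assumes "m \<le> exp x" "m \<le> exp y" "m \<ge> 0"
  shows "m * \<bar>x - y\<bar> \<le> \<bar>exp x - exp y\<bar>"
proof -
  have *: "m * (u - v) \<le> exp u - exp v" if "v \<le> u" "m \<le> exp v" for u v
  proof -
    have "m * (u - v) \<le> exp v * (u - v)" using that by (intro mult_right_mono) auto
    also have "\<dots> \<le> exp v * (exp (u - v) - 1)"
      using exp_ge_add_one_self[of "u - v"] by (intro mult_left_mono) (linarith, simp)
    also have "\<dots> = exp u - exp v" by (simp add: algebra_simps flip: exp_add)
    finally show ?thesis .
  qed
  show ?thesis
  proof (cases "y \<le> x")
    case True
    then show ?thesis using *[of y x] assms by (simp add: abs_if)
  next
    case False
    then show ?thesis using *[of x y] assms by (simp add: abs_if)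
  qed
qed

text \<open>The product of the radii is at least 1/4, so the angular part gives the first bound. For
  the second, put k = cos - b. The radial gap controls |k s + k t|, which dominates |k t| if the two
  have the same sign; otherwise the cosines at s and t differ by at least |k t|, which forces an
  angular gap.\<close>

lemma wloop_separation:
  assumes \<delta>: "0 < \<delta>" "\<delta> \<le> 1/2" "\<And>t. \<bar>\<delta> * (cos (2 * pi * t) - b)\<bar> < ln 2"
  shows "\<bar>sin (pi * (s - t))\<bar> \<le> norm (wloop \<delta> b s - wloop (- \<delta>) b t)"
    and "\<delta> / 2 * \<bar>cos (2 * pi * t) - b\<bar> \<le> norm (wloop \<delta> b s - wloop (- \<delta>) b t)"
proof -
  define k where "k = (\<lambda>t. cos (2 * pi * t) - b)"
  define D where "D = norm (wloop \<delta> b s - wloop (- \<delta>) b t)"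
  define r where "r = exp (\<delta> * k s)" define q where "q = exp (- \<delta> * k t)"
  have rq: "1/2 \<le> r" "1/2 \<le> q" unfolding r_def q_def k_def
    using \<delta>(3)[of s] \<delta>(3)[of t] by (intro less_imp_le half_less_exp; simp add: abs_less_iff)+
  have D2: "D\<^sup>2 = (r - q)\<^sup>2 + 4 * r * q * (sin (pi * (s - t)))\<^sup>2"
    unfolding D_def wloop_def using norm_diff_polar_sq[of r s q t] by (simp add: r_def q_def k_def)
  have "1 \<le> 4 * r * q" using mult_mono[of "1/2" r "1/2" q] rq by simp
  then have s1: "1 * (sin (pi * (s - t)))\<^sup>2 \<le> 4 * r * q * (sin (pi * (s - t)))\<^sup>2" by (intro mult_right_mono) auto
  have D0: "D \<ge> 0" by (simp add: D_def)
  have "\<bar>sin (pi * (s - t))\<bar>\<^sup>2 \<le> D\<^sup>2" unfolding D2 using s1 zero_le_power2[of "r - q"] unfolding power2_abs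
    by linarith
  then have sD: "\<bar>sin (pi * (s - t))\<bar> \<le> D" using D0 by (rule power2_le_imp_le)
  then show "\<bar>sin (pi * (s - t))\<bar> \<le> norm (wloop \<delta> b s - wloop (- \<delta>) b t)" by (simp add: D_def)
  have "\<bar>r - q\<bar>\<^sup>2 \<le> D\<^sup>2" unfolding D2 power2_abs using s1 zero_le_power2[of "sin (pi * (s - t))"] by linarith
  then have rD: "\<bar>r - q\<bar> \<le> D" using D0 by (rule power2_le_imp_le)
  have "1/2 * \<bar>\<delta> * k s - (- \<delta> * k t)\<bar> \<le> \<bar>r - q\<bar>"
    unfolding r_def q_def by (rule abs_exp_diff_ge) (use rq in \<open>auto simp: r_def q_def\<close>)
  then have kD: "\<delta> / 2 * \<bar>k s + k t\<bar> \<le> D"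
  proof -
    have "\<delta> * k s - (- \<delta> * k t) = \<delta> * (k s + k t)" by (simp add: algebra_simps)
    then have "\<bar>\<delta> * k s - (- \<delta> * k t)\<bar> = \<delta> * \<bar>k s + k t\<bar>" using \<delta> by (simp add: abs_mult)
    then show ?thesis using \<open>1/2 * \<bar>\<delta> * k s - (- \<delta> * k t)\<bar> \<le> \<bar>r - q\<bar>\<close> rD by simp
  qed
  have "\<delta> / 2 * \<bar>k t\<bar> \<le> D"
  proof (cases "k s * k t \<ge> 0")
    case True
    then have "\<bar>k t\<bar> \<le> \<bar>k s + k t\<bar>" by (auto simp: zero_le_mult_iff)
    then have "\<delta> / 2 * \<bar>k t\<bar> \<le> \<delta> / 2 * \<bar>k s + k t\<bar>" using \<delta> by (intro mult_left_mono) auto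
    then show ?thesis using kD by linarith
  next
    case False
    then have "\<bar>k t\<bar> \<le> \<bar>k t - k s\<bar>" by (auto simp: zero_le_mult_iff)
    also have "k t - k s = cos (2 * pi * t) - cos (2 * pi * s)" by (simp add: k_def)
    also have "\<dots> = 2 * sin ((2 * pi * t + 2 * pi * s) / 2) * sin ((2 * pi * s - 2 * pi * t) / 2)"
      by (rule cos_diff_cos)
    also have "(2 * pi * s - 2 * pi * t) / 2 = pi * (s - t)" by (simp add: field_simps)
    also have "\<bar>2 * sin ((2 * pi * t + 2 * pi * s) / 2) * sin (pi * (s - t))\<bar>
        = 2 * \<bar>sin ((2 * pi * t + 2 * pi * s) / 2)\<bar> * \<bar>sin (pi * (s - t))\<bar>" by (simp add: abs_mult)
    also have "\<dots> \<le> 2 * 1 * \<bar>sin (pi * (s - t))\<bar>"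
      by (intro mult_right_mono mult_left_mono abs_sin_le_one) auto
    finally have "\<bar>k t\<bar> \<le> 2 * D" using sD by simp
    moreover have "\<delta> / 2 * \<bar>k t\<bar> \<le> 1/2 * \<bar>k t\<bar>" using \<delta> by (intro mult_right_mono) auto
    ultimately show ?thesis by linarith
  qed
  then show "\<delta> / 2 * \<bar>cos (2 * pi * t) - b\<bar> \<le> norm (wloop \<delta> b s - wloop (- \<delta>) b t)"
    by (simp add: D_def k_def)
qed

text \<open>The exponent \<open>-1/4\<close> of \<open>B\<close>, which will be \<open>\<bar>cos - b\<bar>\<close>, is small because this function has a double
  zero when \<open>b = 1\<close> or \<open>b = -1\<close>, and its power must stay integrable uniformly in \<open>b\<close>.\<close>

lemma inverse_le_powr_split:
  fixes D A B :: real
  assumes "0 < A" "A \<le> D" "0 < B" "B \<le> D"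
  shows "1 / D \<le> A powr (-3/4) * B powr (-1/4)"
proof -
  have D: "D > 0" using assms by linarith
  have "1 / D = D powr (-3/4) * D powr (-1/4)"
    using D by (simp add: powr_minus_divide flip: powr_add)
  also have "\<dots> \<le> A powr (-3/4) * B powr (-1/4)"
    using assms D by (intro mult_mono powr_mono2') auto
  finally show ?thesis .
qed

text \<open>A small power of y is traded against the exponential for a negative power of A. This
  produces the decay in the estimate for the crossing loops.\<close>

lemma powr_exp_decay:
  assumes "0 < p" "p \<le> 1" "0 < A" "0 < (y::real)"
  shows "y powr p * exp (- A * y) \<le> A powr (- p)"
proof -
  have "(A * y) powr p \<le> exp (A * y)"
  proof (cases "A * y \<le> 1")
    case True
    then have "(A * y) powr p \<le> 1 powr p" using assms by (intro powr_mono2) auto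
    also have "\<dots> \<le> exp (A * y)" using assms by simp
    finally show ?thesis .
  next
    case False
    then have "(A * y) powr p \<le> (A * y) powr 1" using assms by (intro powr_mono) auto
    also have "\<dots> \<le> exp (A * y)"
    proof -
      have "(A * y) powr 1 = A * y" using assms by simp
      then show ?thesis using exp_ge_add_one_self[of "A * y"] by linarith
    qed
    finally show ?thesis .
  qed
  then have "A powr p * y powr p \<le> exp (A * y)" using assms by (simp add: powr_mult)
  then show ?thesis using assms by (simp add: exp_minus powr_minus field_simps)
qed

lemma norm_wloop'_le:
  assumes "\<bar>\<delta>\<bar> \<le> 1/2" "\<bar>\<delta> * (cos (2 * pi * t) - b)\<bar> < ln 2"
  shows "norm (wloop' \<delta> b t) \<le> 24"
proof -
  have 1: "norm (wloop \<delta> b t) \<le> 2"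
    unfolding norm_wloop using assms(2) by (intro less_imp_le exp_less_two) (simp add: abs_less_iff)
  have "norm (2 * of_real pi * \<i> - of_real (2 * pi * \<delta> * sin (2 * pi * t))) \<le> 2 * pi + \<bar>2 * pi * \<delta> * sin (2 * pi
    * t)\<bar>"
    by (rule order_trans[OF norm_triangle_ineq4]) (simp add: norm_mult)
  also have "\<bar>2 * pi * \<delta> * sin (2 * pi * t)\<bar> = 2 * pi * (\<bar>\<delta>\<bar> * \<bar>sin (2 * pi * t)\<bar>)"
    by (simp add: abs_mult)
  also have "\<dots> \<le> 2 * pi * (1/2 * 1)"
    using assms by (intro mult_left_mono mult_mono) auto
  finally have "norm (2 * of_real pi * \<i> - of_real (2 * pi * \<delta> * sin (2 * pi * t))) \<le> 3 * pi" by simp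
  then have "norm (wloop' \<delta> b t) \<le> (3 * pi) * 2"
    unfolding wloop'_def norm_mult using 1 by (intro mult_mono) auto
  also have "\<dots> \<le> 24" using pi_less_4 by simp
  finally show ?thesis .
qed

text \<open>This stands for the double integral over the two crossing loops. It is written as the
  nested integral over disjoint contours plus the residue term, so that convergence at the crossing
  points does not enter the definition.\<close>

definition crossing_remainder ::
    "real \<Rightarrow> real \<Rightarrow> nat \<Rightarrow> int \<Rightarrow> nat \<Rightarrow> int \<Rightarrow> real \<Rightarrow>
      real \<Rightarrow> real \<Rightarrow> complex" where
  "crossing_remainder gp gm n1 x1 n2 x2 a \<delta> b =
     contour_integral (\<lambda>t. of_real a * wloop (- \<delta>) b t) (\<lambda>w. contour_integral (circlepath 0 (a/4))
       (\<lambda>u. weight gp gm n1 x1 u / weight gp gm n2 x2 w * (1 / (u - w))))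
     + 2 * of_real pi * \<i> * (LINT t:right_arc b|lborel. weight gp gm n1 x1 (of_real a * wloop (- \<delta>) b t)
         / weight gp gm n2 x2 (of_real a * wloop (- \<delta>) b t) * (of_real a * wloop' (- \<delta>) b t))"

text \<open>K depends on \<delta> only, because a and b vary with N where the bound is applied. The
  powers of a are the scaling weight that the conjugation of the matrix removes.\<close>

lemma crossing_error:
  assumes \<delta>: "0 < \<delta>" "\<delta> \<le> 1/2"
  obtains K where "K \<ge> 0"
    "\<And>gp gm n1 n2 x1 x2 a b C. gp > 0 \<Longrightarrow> gm > 0 \<Longrightarrow> 0 < a \<Longrightarrow> a
      \<le> 1/8 \<Longrightarrow>
    (\<And>t. \<bar>\<delta> * (cos (2 * pi * t) - b)\<bar> < ln 2) \<Longrightarrow>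
    weight_error gp gm a b n1 x1 \<le> C \<Longrightarrow> weight_error gp gm a b n2 x2 \<le> C \<Longrightarrow>
    norm (crossing_remainder gp gm n1 x1 n2 x2 a \<delta> b)
     \<le> K * exp (2 * C) * (a powi x1 * a / a powi x2) * (gp / a) powr (- (1/16))"
proof -
  obtain K0 where K0: "K0 \<ge> 0"
    "\<And>c. (\<integral>\<^sup>+t. ennreal (\<bar>sin (pi * (t - c))\<bar> powr (-3/4)) * indicator {0..1} t \<partial>lborel)
      \<le> ennreal K0"
    using nn_integral_sin_powr_bounded by blast
  \<comment> \<open>Each 24 bounds |wloop'|. The first K0 integrates the angular singularity in u,
    and 2 * K0 the two singularities left in t. The powers of \<delta> come from the separation
    bound and from the Gaussian.\<close>
  define K where "K = 24 * 24 * K0 * (\<delta>/2) powr (-1/4) * \<delta> powr (- (1/16)) * (2 * K0)"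
  have K: "K \<ge> 0" using K0 by (simp add: K_def)
  show ?thesis
  proof (rule that[OF K])
    fix gp gm n1 n2 x1 x2 a b C
    assume gp: "gp > 0" "gm > 0" and a: "0 < a" "a \<le> 1/8" and ln: "\<And>t. \<bar>\<delta> * (cos (2 * pi * t) - b)\<bar> < ln 2"
      and C1: "weight_error gp gm a b n1 x1 \<le> C" and C2: "weight_error gp gm a b n2 x2 \<le> C"
    define M where "M = gp / a"
    have M: "M > 0" using gp a by (simp add: M_def)
    define \<kappa> where "\<kappa> = (\<lambda>t. cos (2 * pi * t) - b)"
    define W where "W = (\<lambda>t. of_real a * wloop (- \<delta>) b t)"
    define U where "U = (\<lambda>t. of_real a * wloop \<delta> b t)"
    define W' where "W' = (\<lambda>t. of_real a * wloop' (- \<delta>) b t)"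
    define U' where "U' = (\<lambda>t. of_real a * wloop' \<delta> b t)"
    define wt1 where "wt1 = weight gp gm n1 x1"
    define wt2 where "wt2 = weight gp gm n2 x2"
    have vdU: "vector_derivative U (at t) = U' t" for t
      unfolding U_def U'_def by (rule scaled_wloop_derivative)
    have nU': "norm (U' t) \<le> a * 24" for t
      unfolding U'_def norm_mult using a norm_wloop'_le[of \<delta> t b] \<delta> ln[of t] by (simp add: mult_left_mono)
    have nW': "norm (W' t) \<le> a * 24" for t
      unfolding W'_def norm_mult using a norm_wloop'_le[of "- \<delta>" t b] \<delta> ln[of t] by (simp add: mult_left_mono)
    \<comment> \<open>The Gaussian decay of the u-integrand is discarded; that of the w-integrand is
      enough.\<close>
    have wt1: "norm (wt1 (U t)) \<le> a powi x1 * exp C" for t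
    proof -
      obtain E where E: "norm (weight gp gm n1 x1 (of_real a * wloop \<delta> b t)) = a powi x1 * exp E"
         "\<bar>E + 2 * (gp / a) * \<delta> * (cos (2 * pi * t) - b)\<^sup>2\<bar> \<le> C + gp / a * \<bar>\<delta>\<bar> * (cos (2 * pi
           * t) - b)\<^sup>2"
        by (rule weight_wloop_estimate[OF a _ ln gp C1]) (use \<delta> in auto)
      have "0 \<le> M * (\<delta> * (cos (2 * pi * t) - b)\<^sup>2)" using M \<delta> by simp
      moreover have "\<bar>E + 2 * (M * (\<delta> * (cos (2 * pi * t) - b)\<^sup>2))\<bar> \<le> C + M * (\<delta> * (cos (2 * pi * t)
        - b)\<^sup>2)"
        using E(2) \<delta> by (simp add: M_def mult.assoc)
      ultimately have "E \<le> C" by linarith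
      then show ?thesis unfolding wt1_def U_def E(1) using a by (intro mult_left_mono) auto
    qed
    have wt2: "norm (W' t / wt2 (W t)) \<le> a * 24 * (exp C * exp (- (M * \<delta>) * (\<kappa> t)\<^sup>2) / a powi x2)" for t
    proof -
      have ln': "\<bar>- \<delta> * (cos (2 * pi * t) - b)\<bar> < ln 2" for t using ln[of t] by simp
      obtain E where E: "norm (weight gp gm n2 x2 (of_real a * wloop (- \<delta>) b t)) = a powi x2 * exp E"
         "\<bar>E + 2 * (gp / a) * (- \<delta>) * (cos (2 * pi * t) - b)\<^sup>2\<bar> \<le> C + gp / a * \<bar>- \<delta>\<bar> * (cos (2
           * pi * t) - b)\<^sup>2"
        by (rule weight_wloop_estimate[OF a _ ln' gp C2]) (use \<delta> in auto)
      have "\<bar>E - 2 * (M * (\<delta> * (\<kappa> t)\<^sup>2))\<bar> \<le> C + M * (\<delta> * (\<kappa> t)\<^sup>2)"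
        using E(2) \<delta> by (simp add: M_def \<kappa>_def mult.assoc)
      then have "- E \<le> C + - (M * \<delta>) * (\<kappa> t)\<^sup>2" by (simp add: mult.assoc)
      then have "exp (- E) \<le> exp C * exp (- (M * \<delta>) * (\<kappa> t)\<^sup>2)" by (simp flip: exp_add)
      then have "exp (- E) / a powi x2 \<le> exp C * exp (- (M * \<delta>) * (\<kappa> t)\<^sup>2) / a powi x2"
        using a by (intro divide_right_mono) auto
      moreover have "norm (W' t / wt2 (W t)) = norm (W' t) * (exp (- E) / a powi x2)"
        unfolding norm_divide wt2_def W_def E(1) by (simp add: exp_minus field_simps)
      ultimately show ?thesis using a nW'[of t] by (simp only:) (intro mult_mono, auto)
    qed
    have sep: "a * \<bar>sin (pi * (s - t))\<bar> \<le> norm (U s - W t)" "a * (\<delta> / 2 * \<bar>\<kappa> t\<bar>) \<le> norm (U s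
      - W t)" for s t
    proof -
      have "norm (U s - W t) = a * norm (wloop \<delta> b s - wloop (- \<delta>) b t)"
        using a by (simp add: U_def W_def norm_mult flip: right_diff_distrib)
      then show "a * \<bar>sin (pi * (s - t))\<bar> \<le> norm (U s - W t)" "a * (\<delta> / 2 * \<bar>\<kappa> t\<bar>) \<le> norm (U s
        - W t)"
        using wloop_separation[OF \<delta> ln, where s = s and t = t] a unfolding \<kappa>_def
          by (simp_all only: mult_left_mono less_imp_le)
    qed
    have inner: "norm (contour_integral U (\<lambda>u. wt1 u / (u - W t)))
        \<le> a powi x1 * exp C * 24 * (\<delta> / 2 * \<bar>\<kappa> t\<bar>) powr (-1/4) * K0" if t: "\<kappa> t \<noteq> 0" for t
    proof -
      define B where "B = \<delta> / 2 * \<bar>\<kappa> t\<bar>"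
      have B: "B > 0" using \<delta> t by (simp add: B_def)
      have ne: "U s \<noteq> W t" for s
      proof -
        have "0 < a * B" using a B by simp
        then have "norm (U s - W t) > 0" using sep(2)[of t s] unfolding B_def by linarith
        then show ?thesis by auto
      qed
      have U0: "U s \<noteq> 0" for s using a by (simp add: U_def)
      define F where "F = (\<lambda>s. wt1 (U s) / (U s - W t) * U' s)"
      have cU: "continuous_on {0..1} U" "continuous_on {0..1} U'"
        unfolding U_def U'_def by (intro continuous_intros)+
      have cF: "continuous_on {0..1} F"
        unfolding F_def wt1_def by (intro continuous_intros cU weight_continuous_on U0) (use ne in auto)
      have "contour_integral U (\<lambda>u. wt1 u / (u - W t)) = (LINT s:{0..1}|lborel. F s)"
        using cF by (subst contour_integral_LINT) (simp_all add: F_def vdU)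
      also have "\<dots> = (LINT s|lborel. indicator {0..1} s *\<^sub>R F s)" by (simp add: set_lebesgue_integral_def)
      finally have eq: "contour_integral U (\<lambda>u. wt1 u / (u - W t)) = (LINT s|lborel. indicator {0..1} s *\<^sub>R F s)" .
      define c1 where "c1 = a powi x1 * exp C * 24 * B powr (-1/4)"
      have c1: "c1 \<ge> 0" using a by (simp add: c1_def)
      have pt: "norm (F s) \<le> c1 * \<bar>sin (pi * (s - t))\<bar> powr (-3/4)" if s: "sin (pi * (s - t)) \<noteq> 0" for s
      proof -
        define D where "D = norm (U s - W t) / a"
        have D: "\<bar>sin (pi * (s - t))\<bar> \<le> D" "B \<le> D"
          using sep[where s=s and t=t] a by (simp_all add: D_def B_def field_simps)
        have nF: "norm (F s) = norm (wt1 (U s)) * (norm (U' s) / norm (U s - W t))"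
          by (simp add: F_def norm_mult norm_divide)
        also have "\<dots> \<le> (a powi x1 * exp C) * (a * 24 / norm (U s - W t))"
          by (intro mult_mono wt1 divide_right_mono nU') (use a in auto)
        also have "\<dots> = a powi x1 * exp C * 24 * (1 / D)" using a by (simp add: D_def)
        also have "\<dots> \<le> a powi x1 * exp C * 24 * (\<bar>sin (pi * (s - t))\<bar> powr (-3/4) * B powr (-1/4))"
          by (intro mult_left_mono inverse_le_powr_split D B) (use s a in auto)
        finally show ?thesis by (simp add: c1_def mult_ac)
      qed
      have "ennreal (norm (contour_integral U (\<lambda>u. wt1 u / (u - W t))))
        \<le> (\<integral>\<^sup>+s. norm (indicator {0..1} s *\<^sub>R F s) \<partial>lborel)"
        unfolding eq by (rule integral_norm_bound_ennreal)
           (use borel_integrable_atLeastAtMost'[OF cF] in \<open>simp add: set_integrable_def\<close>)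
      also have "\<dots> \<le> (\<integral>\<^sup>+s. ennreal c1 * (ennreal (\<bar>sin (pi * (s - t))\<bar> powr (-3/4))
        * indicator {0..1} s) \<partial>lborel)"
      proof (intro nn_integral_mono_AE eventually_mono[OF AE_sin_neq[of t]])
        fix s assume "sin (pi * (s - t)) \<noteq> 0"
        from pt[OF this] show "ennreal (norm (indicat_real {0..1} s *\<^sub>R F s))
           \<le> ennreal c1 * (ennreal (\<bar>sin (pi * (s - t))\<bar> powr (-3/4)) * indicator {0..1} s)"
          using c1 by (auto simp: indicator_def ennreal_leI simp flip: ennreal_mult)
      qed
      also have "\<dots> = ennreal c1 * (\<integral>\<^sup>+s. ennreal (\<bar>sin (pi * (s - t))\<bar> powr (-3/4))
        * indicator {0..1} s \<partial>lborel)"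
        by (rule nn_integral_cmult) measurable
      also have "\<dots> \<le> ennreal c1 * ennreal K0" by (intro mult_left_mono K0) auto
      also have "\<dots> = ennreal (c1 * K0)" using c1 K0 by (simp add: ennreal_mult)
      finally show ?thesis using c1 K0 by (simp add: c1_def B_def)
    qed
    obtain \<beta> b' where \<beta>: "\<And>t. cos (2 * pi * t) \<noteq> b \<Longrightarrow> cos (2 * pi
      * t) \<noteq> b' \<Longrightarrow>
        \<bar>cos (2 * pi * t) - b\<bar> powr (-3/8) \<le> \<bar>sin (pi * (t - \<beta>))\<bar> powr (-3/4) + \<bar>sin (pi * (t
          + \<beta>))\<bar> powr (-3/4)"
      using cos_level_powr_bound[of b] by blast
    define A where "A = a powi x1 * a / a powi x2"
    have A: "A > 0" using a by (simp add: A_def)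
    define c2 where "c2 = 24 * 24 * K0 * exp (2 * C) * A * ((\<delta> / 2) powr (-1/4) * (M * \<delta>) powr (- (1/16)))"
    have c2: "c2 \<ge> 0" using K0 A by (simp add: c2_def)
    have outer: "norm (contour_integral U (\<lambda>u. wt1 u / (u - W t))) * norm (W' t / wt2 (W t))
       \<le> c2 * (\<bar>sin (pi * (t - \<beta>))\<bar> powr (-3/4) + \<bar>sin (pi * (t - (- \<beta>)))\<bar> powr (-3/4))"
      if t: "cos (2 * pi * t) \<noteq> b" "cos (2 * pi * t) \<noteq> b'" for t
    proof -
      have k: "\<kappa> t \<noteq> 0" using t by (simp add: \<kappa>_def)
      \<comment> \<open>Split -1/4 = -3/8 + 1/8. The first part is integrable in t uniformly in b;
        the second is the power 1/16 of \<kappa>^2 and is absorbed by the Gaussian.\<close>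
      have k2: "\<bar>\<kappa> t\<bar> powr (-1/4) * exp (- (M * \<delta>) * (\<kappa> t)\<^sup>2) \<le>
         (\<bar>sin (pi * (t - \<beta>))\<bar> powr (-3/4) + \<bar>sin (pi * (t - (- \<beta>)))\<bar> powr (-3/4)) * (M
           * \<delta>) powr (- (1/16))"
      proof -
        have "\<bar>\<kappa> t\<bar> powr (-1/4) = \<bar>\<kappa> t\<bar> powr (-3/8) * \<bar>\<kappa> t\<bar> powr (1/8)"
          by (simp flip: powr_add)
        also have "\<bar>\<kappa> t\<bar> powr (1/8) = ((\<kappa> t)\<^sup>2) powr (1/16)"
        proof -
          have "(\<kappa> t)\<^sup>2 = \<bar>\<kappa> t\<bar> powr 2" using k by simp
          then show ?thesis by (simp only: powr_powr) simp
        qed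
        finally have "\<bar>\<kappa> t\<bar> powr (-1/4) * exp (- (M * \<delta>) * (\<kappa> t)\<^sup>2) =
            \<bar>\<kappa> t\<bar> powr (-3/8) * (((\<kappa> t)\<^sup>2) powr (1/16) * exp (- (M * \<delta>) * (\<kappa> t)\<^sup>2))"
              by simp
        also have "\<dots> \<le> (\<bar>sin (pi * (t - \<beta>))\<bar> powr (-3/4) + \<bar>sin (pi * (t - (- \<beta>)))\<bar> powr (-3/4))
          * (M * \<delta>) powr (- (1/16))"
        proof (intro mult_mono)
          show "\<bar>\<kappa> t\<bar> powr (-3/8) \<le> \<bar>sin (pi * (t - \<beta>))\<bar> powr (-3/4) + \<bar>sin (pi * (t
            - (- \<beta>)))\<bar> powr (-3/4)"
            using \<beta>[OF t] by (simp add: \<kappa>_def)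
          show "((\<kappa> t)\<^sup>2) powr (1/16) * exp (- (M * \<delta>) * (\<kappa> t)\<^sup>2) \<le> (M * \<delta>) powr (- (1/16))"
            by (rule powr_exp_decay) (use M \<delta> k in auto)
        qed auto
        finally show ?thesis .
      qed
      have "norm (contour_integral U (\<lambda>u. wt1 u / (u - W t))) * norm (W' t / wt2 (W t))
        \<le> (a powi x1 * exp C * 24 * (\<delta> / 2 * \<bar>\<kappa> t\<bar>) powr (-1/4) * K0) * (a * 24 * (exp C * exp (- (M
          * \<delta>) * (\<kappa> t)\<^sup>2) / a powi x2))"
        by (intro mult_mono inner k wt2) (use a K0 in auto)
      also have "\<dots> = 24 * 24 * K0 * (exp C * exp C) * A * (\<delta> / 2) powr (-1/4) * (\<bar>\<kappa> t\<bar> powr (-1/4)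
        * exp (- (M * \<delta>) * (\<kappa> t)\<^sup>2))"
        using \<delta> by (subst powr_mult) (auto simp: A_def)
      also have "exp C * exp C = exp (2 * C)" by (simp flip: exp_add)
      also have "24 * 24 * K0 * exp (2 * C) * A * (\<delta> / 2) powr (-1/4) * (\<bar>\<kappa> t\<bar> powr (-1/4) * exp (- (M * \<delta>)
        * (\<kappa> t)\<^sup>2))
         \<le> 24 * 24 * K0 * exp (2 * C) * A * (\<delta> / 2) powr (-1/4) * ((\<bar>sin (pi * (t - \<beta>))\<bar> powr (-3/4)
           + \<bar>sin (pi * (t - (- \<beta>)))\<bar> powr (-3/4)) * (M * \<delta>) powr (- (1/16)))"
        by (intro mult_left_mono k2) (use K0 A in auto)
      finally show ?thesis by (simp add: c2_def mult_ac)
    qed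
    let ?X = "contour_integral W (\<lambda>w. contour_integral (circlepath 0 (a/4)) (\<lambda>u. wt1 u / wt2 w * (1 / (u - w))))
       + 2 * of_real pi * \<i> * (LINT t:right_arc b|lborel. wt1 (W t) / wt2 (W t) * W' t)"
    have "ennreal (norm ?X) \<le> (\<integral>\<^sup>+t. ennreal (norm (contour_integral U (\<lambda>u. wt1 u / (u - W t)))
              * norm (W' t / wt2 (W t))) * indicator {0..1} t \<partial>lborel)"
      unfolding wt1_def wt2_def W_def U_def W'_def
      by (rule crossing_bound) (use a \<delta> ln in auto)
    also have "\<dots> \<le> (\<integral>\<^sup>+t. ennreal c2 * (ennreal (\<bar>sin (pi * (t - \<beta>))\<bar> powr (-3/4))
      * indicator {0..1} t
           + ennreal (\<bar>sin (pi * (t - (- \<beta>)))\<bar> powr (-3/4)) * indicator {0..1} t) \<partial>lborel)"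
    proof (rule nn_integral_mono_AE)
      show "AE t in lborel. ennreal (norm (contour_integral U (\<lambda>u. wt1 u / (u - W t)))
              * norm (W' t / wt2 (W t))) * indicator {0..1} t
         \<le> ennreal c2 * (ennreal (\<bar>sin (pi * (t - \<beta>))\<bar> powr (-3/4)) * indicator {0..1} t
           + ennreal (\<bar>sin (pi * (t - (- \<beta>)))\<bar> powr (-3/4)) * indicator {0..1} t)"
        using AE_cos_neq[of b] AE_cos_neq[of b']
      proof eventually_elim
        case (elim t)
        from outer[OF elim] show ?case
          using c2 by (auto simp: indicator_def ennreal_leI simp flip: ennreal_mult ennreal_plus)
      qed
    qed
    also have "\<dots> = ennreal c2 * ((\<integral>\<^sup>+t. ennreal (\<bar>sin (pi * (t - \<beta>))\<bar> powr (-3/4))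
      * indicator {0..1} t \<partial>lborel)
           + (\<integral>\<^sup>+t. ennreal (\<bar>sin (pi * (t - (- \<beta>)))\<bar> powr (-3/4))
             * indicator {0..1} t \<partial>lborel))"
      by (subst nn_integral_cmult, measurable, subst nn_integral_add) simp_all
    also have "\<dots> \<le> ennreal c2 * (ennreal K0 + ennreal K0)"
      by (intro mult_left_mono add_mono K0) auto
    also have "\<dots> = ennreal (c2 * (2 * K0))"
      using c2 K0 by (simp add: ennreal_mult flip: ennreal_plus)
    finally have "norm ?X \<le> c2 * (2 * K0)" using c2 K0 by simp
    also have "\<dots> = K * exp (2 * C) * A * M powr (- (1/16))"
      using M \<delta> unfolding c2_def K_def by (subst powr_mult) auto
    finally show "norm (crossing_remainder gp gm n1 x1 n2 x2 a \<delta> b)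
        \<le> K * exp (2 * C) * (a powi x1 * a / a powi x2) * (gp / a) powr (- (1/16))"
      by (simp only: crossing_remainder_def A_def M_def W_def W'_def wt1_def wt2_def)
  qed
qed

subsection \<open>Limits of the kernel entries\<close>

text \<open>The integrand of the residue term in the rescaled variable, with its power of a removed;
  the exponential factors of the two weights have cancelled. It stays a quotient of powers because
  n1 - n2 may have either sign.\<close>

definition arc_integrand :: "real \<Rightarrow> nat \<Rightarrow> nat \<Rightarrow> int \<Rightarrow> complex \<Rightarrow> complex" where
  "arc_integrand a n1 n2 d w = w powi (d - 1) * ((1 - of_real a * w) ^ n1 / (1 - of_real a * w) ^ n2)"

lemma quotient_power_eq_exp:
  assumes "norm z < 1"
  shows "(1 - z) ^ n1 / (1 - z) ^ n2 = exp (of_real (real n1 - real n2) * Ln (1 - z))"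
proof -
  have "1 - z \<noteq> 0" using assms by auto
  then have "(1 - z) ^ n = exp (of_real (real n) * Ln (1 - z))" for n
    by (simp add: exp_of_nat_mult)
  then show ?thesis by (simp add: left_diff_distrib exp_diff)
qed

lemma norm_wloop_bounds:
  assumes "\<bar>\<delta> * (cos (2 * pi * t) - b)\<bar> < ln 2"
  shows "1/2 < norm (wloop \<delta> b t)" "norm (wloop \<delta> b t) < 2"
  unfolding norm_wloop using assms by (intro half_less_exp exp_less_two; simp add: abs_less_iff)+

text \<open>Dominated convergence: (n1 - n2) log (1 - a w) is (n1 - n2) a times log (1 - a w) / a
  and tends to - \<sigma> w. The arcs may move with N, as long as almost every parameter is
  eventually in both the moving and the limiting arc or in neither.\<close>

lemma arc_integral_tendsto:
  fixes a bb :: "nat \<Rightarrow> real" and n1 n2 :: "nat \<Rightarrow> nat"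
  assumes a: "\<And>N. 0 < a N" "\<And>N. a N \<le> 1/8" "a \<longlonglongrightarrow> 0"
    and \<delta>: "\<bar>\<delta>\<bar> \<le> 1/2" "\<And>N t. \<bar>\<delta> * (cos (2 * pi * t) - bb N)\<bar> < ln 2"
    and b: "bb \<longlonglongrightarrow> b" and \<sigma>: "(\<lambda>N. (real (n1 N) - real (n2 N)) * a N)
      \<longlonglongrightarrow> \<sigma>"
    and A: "\<And>N. A N \<in> sets borel" "\<And>N. A N \<subseteq> {0..1}" "A' \<in> sets borel"
      "AE t in lborel. eventually (\<lambda>N. t \<in> A N \<longleftrightarrow> t \<in> A') sequentially"
  shows "(\<lambda>N. LINT t:A N|lborel. arc_integrand (a N) (n1 N) (n2 N) d (wloop \<delta> (bb N) t) * wloop' \<delta> (bb N) t)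
     \<longlonglongrightarrow> (LINT t:A'|lborel. wloop \<delta> b t powi (d - 1) * exp (- of_real \<sigma> * wloop \<delta> b t)
       * wloop' \<delta> b t)"
proof -
  define m where "m = (\<lambda>N. real (n1 N) - real (n2 N))"
  define q where "q = (\<lambda>N t. arc_integrand (a N) (n1 N) (n2 N) d (wloop \<delta> (bb N) t) * wloop' \<delta> (bb N) t)"
  define q' where "q' = (\<lambda>t. wloop \<delta> b t powi (d - 1) * exp (- of_real \<sigma> * wloop \<delta> b t)
    * wloop' \<delta> b t)"
  have nz: "norm (of_real (a N) * wloop \<delta> (bb N) t) \<le> 2 * a N" for N t
    using norm_wloop_bounds(2)[OF \<delta>(2)[of t N]] a(1)[of N] by (simp add: norm_mult)
  have nz4: "norm (of_real (a N) * wloop \<delta> (bb N) t) \<le> 1/4" for N t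
    using nz[of N t] a(2)[of N] by linarith
  have ne: "of_real (a N) * wloop \<delta> (bb N) t \<noteq> 1" for N t
    using nz4[of N t] by (metis norm_one not_le divide_less_eq_1 one_less_numeral_iff semiring_norm(76) zero_less_numeral)
  have q_eq: "q N t = wloop \<delta> (bb N) t powi (d - 1) * exp (of_real (m N) * Ln (1 - of_real (a N) * wloop \<delta> (bb N) t))
    * wloop' \<delta> (bb N) t" for N t
    unfolding q_def arc_integrand_def m_def by (subst quotient_power_eq_exp) (use nz4[of N t] in linarith, simp)
  have cq: "continuous_on UNIV (q N)" for N
    unfolding q_def arc_integrand_def using ne[of N] by (intro continuous_intros) auto
  have cq': "continuous_on UNIV q'" unfolding q'_def by (intro continuous_intros) auto
  have [measurable]: "q N \<in> borel_measurable borel" "q' \<in> borel_measurable borel" for N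
    by (intro borel_measurable_continuous_onI cq cq')+
  have [measurable]: "A N \<in> sets borel" "A' \<in> sets borel" for N using A by auto
  obtain S where S: "\<And>N. \<bar>m N * a N\<bar> \<le> S"
    using convergent_imp_Bseq[OF convergentI[OF \<sigma>]] unfolding Bseq_def m_def by auto
  \<comment> \<open>The three factors bound |w^(d - 1)| for 1/2 < |w| < 2, then |exp (m log (1 - a
    w))| through |log (1 - z)| <= 2 |z| and |z| <= 2 a, and finally |wloop'|.\<close>
  define Q where "Q = 2 powr \<bar>of_int (d - 1)\<bar> * exp (4 * S) * 24"
  have bound: "norm (q N t) \<le> Q" for N t
  proof -
    let ?w = "wloop \<delta> (bb N) t"
    have w: "1/2 \<le> norm ?w" "norm ?w \<le> 2" using norm_wloop_bounds[OF \<delta>(2)[of t N]] by auto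
    have 1: "norm (?w powi (d - 1)) \<le> 2 powr \<bar>of_int (d - 1)\<bar>"
    proof -
      have w0: "norm ?w > 0" by simp
      have "norm (?w powi (d - 1)) = norm ?w powr of_int (d - 1)"
        using w0 by (simp add: norm_power_int powr_real_of_int' flip: powr_real_of_int')
      also have "\<dots> = exp (of_int (d - 1) * ln (norm ?w))" using w0 by (simp add: powr_def)
      also have "\<dots> \<le> exp (\<bar>of_int (d - 1)\<bar> * ln 2)"
      proof -
        have "ln (norm ?w) \<le> ln 2" using w w0 by (subst ln_le_cancel_iff) auto
        moreover have "ln (1/2) \<le> ln (norm ?w)" using w w0 by (subst ln_le_cancel_iff) auto
        moreover have "ln (1/2) = - ln (2::real)" by (simp add: ln_div)
        ultimately have "\<bar>ln (norm ?w)\<bar> \<le> ln 2" by linarith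
        then have "\<bar>of_int (d - 1)\<bar> * \<bar>ln (norm ?w)\<bar> \<le> \<bar>of_int (d - 1)\<bar> * ln 2"
          by (intro mult_left_mono) auto
        then show ?thesis by (simp flip: abs_mult)
      qed
      finally show ?thesis by (simp add: powr_def)
    qed
    have 2: "norm (exp (of_real (m N) * Ln (1 - of_real (a N) * ?w))) \<le> exp (4 * S)"
    proof -
      have "norm (Ln (1 + (- (of_real (a N) * ?w)))) \<le> 2 * norm (- (of_real (a N) * ?w))"
        by (rule norm_Ln_le) (use nz4[of N t] in auto)
      also have "\<dots> \<le> 4 * a N" using nz[of N t] by simp
      finally have "\<bar>m N\<bar> * norm (Ln (1 - of_real (a N) * ?w)) \<le> \<bar>m N\<bar> * (4 * a N)"
        by (intro mult_left_mono) auto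
      also have "\<dots> = 4 * \<bar>m N * a N\<bar>" using a(1)[of N] by (simp add: abs_mult)
      also have "\<dots> \<le> 4 * S" using S[of N] by simp
      finally have "norm (of_real (m N) * Ln (1 - of_real (a N) * ?w)) \<le> 4 * S" by (simp add: norm_mult)
      then have "Re (of_real (m N) * Ln (1 - of_real (a N) * ?w)) \<le> 4 * S"
        using complex_Re_le_cmod order_trans by blast
      then show ?thesis by (simp only: norm_exp_eq_Re exp_le_cancel_iff)
    qed
    have 3: "norm (wloop' \<delta> (bb N) t) \<le> 24" by (rule norm_wloop'_le) (use \<delta> in auto)
    show ?thesis unfolding q_eq norm_mult Q_def by (intro mult_mono 1 2 3) auto
  qed
  have conv: "(\<lambda>N. q N t) \<longlonglongrightarrow> q' t" for t
  proof -
    have w: "(\<lambda>N. wloop \<delta> (bb N) t) \<longlonglongrightarrow> wloop \<delta> b t"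
      unfolding wloop_def by (intro tendsto_intros b)
    have w': "(\<lambda>N. wloop' \<delta> (bb N) t) \<longlonglongrightarrow> wloop' \<delta> b t"
      unfolding wloop'_def by (intro tendsto_intros w)
    have L: "(\<lambda>N. Ln (1 - of_real (a N) * wloop \<delta> (bb N) t) / of_real (a N) + wloop \<delta> (bb N) t)
      \<longlonglongrightarrow> 0"
    proof (rule Lim_null_comparison)
      show "(\<lambda>N. 8 * a N) \<longlonglongrightarrow> 0" using tendsto_mult_right_zero[OF a(3), of 8] by simp
      show "\<forall>\<^sub>F N in sequentially. norm (Ln (1 - of_real (a N) * wloop \<delta> (bb N) t) / of_real (a N)
        + wloop \<delta> (bb N) t) \<le> 8 * a N"
      proof (intro always_eventually allI)
        fix N
        let ?z = "of_real (a N) * wloop \<delta> (bb N) t"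
        have "norm (Ln (1 - ?z) + ?z) \<le> 2 * (norm ?z)\<^sup>2"
          by (rule norm_Ln_one_minus_add_le) (use nz4[of N t] in linarith)
        also have "\<dots> \<le> 2 * (2 * a N)\<^sup>2" using nz[of N t] by (intro mult_left_mono power_mono) auto
        finally have "norm (Ln (1 - ?z) + ?z) \<le> 8 * a N * a N" by (simp add: power2_eq_square)
        moreover have "Ln (1 - ?z) / of_real (a N) + wloop \<delta> (bb N) t = (Ln (1 - ?z) + ?z) / of_real (a N)"
          using a(1)[of N] by (simp add: field_simps)
        ultimately show "norm (Ln (1 - ?z) / of_real (a N) + wloop \<delta> (bb N) t) \<le> 8 * a N"
          using a(1)[of N] by (simp add: norm_divide field_simps)
      qed
    qed
    have L': "(\<lambda>N. Ln (1 - of_real (a N) * wloop \<delta> (bb N) t) / of_real (a N)) \<longlonglongrightarrow>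
      - wloop \<delta> b t"
      using tendsto_diff[OF L w] by simp
    have "(\<lambda>N. of_real (m N * a N) * (Ln (1 - of_real (a N) * wloop \<delta> (bb N) t) / of_real (a N)))
      \<longlonglongrightarrow> of_real \<sigma> * (- wloop \<delta> b t)"
      by (intro tendsto_intros L') (use \<sigma> in \<open>simp add: m_def\<close>)
    moreover have "of_real (m N * a N) * (Ln (1 - of_real (a N) * wloop \<delta> (bb N) t) / of_real (a N)) = of_real (m N) * Ln (1
      - of_real (a N) * wloop \<delta> (bb N) t)" for N
      using a(1)[of N] by simp
    ultimately have "(\<lambda>N. of_real (m N) * Ln (1 - of_real (a N) * wloop \<delta> (bb N) t))
      \<longlonglongrightarrow> of_real \<sigma> * (- wloop \<delta> b t)"
      by simp
    note tendsto_exp[OF this]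
    then have "(\<lambda>N. q N t) \<longlonglongrightarrow> wloop \<delta> b t powi (d - 1) * exp (of_real \<sigma>
      * (- wloop \<delta> b t)) * wloop' \<delta> b t"
      unfolding q_eq by (intro tendsto_mult tendsto_power_int w w') auto
    then show ?thesis by (simp add: q'_def)
  qed
  have "(\<lambda>N. LINT t|lborel. indicator (A N) t *\<^sub>R q N t)
    \<longlonglongrightarrow> (LINT t|lborel. indicator A' t *\<^sub>R q' t)"
  proof (rule integral_dominated_convergence)
    show "integrable lborel (\<lambda>t. indicator {0..1::real} t * Q)" by simp
    show "AE t in lborel. (\<lambda>N. indicat_real (A N) t *\<^sub>R q N t) \<longlonglongrightarrow> indicat_real A' t *\<^sub>R q' t"
      using A(4)
    proof eventually_elim
      case (elim t)
      have "(\<lambda>N. indicat_real (A N) t) \<longlonglongrightarrow> indicat_real A' t"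
        by (rule tendsto_eventually) (use elim in \<open>eventually_elim, auto simp: indicator_def\<close>)
      then show ?case by (intro tendsto_intros conv)
    qed
    show "AE t in lborel. norm (indicat_real (A N) t *\<^sub>R q N t) \<le> indicator {0..1} t * Q" for N
    proof (intro always_eventually allI)
      fix t
      have "0 \<le> Q" using bound[of N t] norm_ge_zero order_trans by blast
      then show "norm (indicat_real (A N) t *\<^sub>R q N t) \<le> indicator {0..1} t * Q"
        using A(2)[of N] bound[of N t] by (auto simp: indicator_def)
    qed
  qed measurable
  then show ?thesis by (simp add: set_lebesgue_integral_def q_def q'_def)
qed

section \<open>The contribution of the outer circle |w| = 3\<close>

lemma power_int_le_exp:
  assumes "0 < (y::real)" shows "y powi x \<le> exp (\<bar>of_int x\<bar> * \<bar>ln y\<bar>)"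
proof -
  have "y powi x = y powr of_int x" using assms by (simp add: powr_real_of_int')
  also have "\<dots> = exp (of_int x * ln y)" using assms by (simp add: powr_def)
  also have "\<dots> \<le> exp (\<bar>of_int x\<bar> * \<bar>ln y\<bar>)" by (simp flip: abs_mult)
  finally show ?thesis .
qed

text \<open>The gain is |1 - w| >= 2 on |w| = 3, hence the factor 2^(- n2). The constant 48 bounds
  the product 3 pi^2 a of the circumferences, using pi < 4 and a <= 1.\<close>

lemma outer_circle_bound:
  fixes gp gm a :: real and n1 n2 :: nat and x1 x2 :: int
  assumes gp: "gp > 0" "gm > 0" and a: "0 < a" "a \<le> 1/8"
  shows "norm (contour_integral (circlepath 0 (a/4)) (\<lambda>u. contour_integral (circlepath 0 3)
      (\<lambda>w. weight gp gm n1 x1 u / weight gp gm n2 x2 w * (1 / (u - w)))))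
    \<le> 48 * exp (4 * gm + gp) * (exp (4 * (gp / a) + real n1 * a) * (a/4) powi x1 * (3 powi (- x2) / 2 ^ n2))"
proof -
  define f where "f = (\<lambda>u w. weight gp gm n1 x1 u / weight gp gm n2 x2 w * (1 / (u - w)))"
  define B1 where "B1 = exp (gm + 4 * (gp / a)) * (a/4) powi x1 * exp (real n1 * a)"
  define B2 where "B2 = exp (3 * gm + gp) * (3 powi (- x2) / 2 ^ n2)"
  have B: "B1 \<ge> 0" "B2 \<ge> 0" using a by (auto simp: B1_def B2_def)
  have cf: "continuous_on (path_image (circlepath 0 (a/4)) \<times> path_image (circlepath 0 3)) (\<lambda>(u, w). f u w)"
    unfolding f_def by (rule weight_quotient_continuous_on) (use a in auto)
  have Re_bd: "\<bar>gm * Re u + gp * Re (inverse u)\<bar> \<le> gm * norm u + gp / norm u" for u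
  proof -
    have "\<bar>gm * Re u\<bar> \<le> gm * norm u" using gp abs_Re_le_cmod[of u] by (simp add: abs_mult)
    moreover have "\<bar>gp * Re (inverse u)\<bar> \<le> gp * norm (inverse u)"
      using gp abs_Re_le_cmod[of "inverse u"] by (simp only: abs_mult) (intro mult_mono, auto)
    moreover have "gp * norm (inverse u) = gp / norm u" by (simp add: norm_inverse divide_inverse)
    ultimately show ?thesis by linarith
  qed
  have nw: "norm (weight gp gm n x u) = exp (gm * Re u + gp * Re (inverse u)) * norm u powi x * norm (1 - u) ^ n" for n x u
    by (simp add: weight_def norm_mult norm_power norm_power_int norm_exp_eq_Re)
  have b1: "norm (weight gp gm n1 x1 u) \<le> B1" if u: "norm u = a/4" for u
  proof -
    have "gm * Re u + gp * Re (inverse u) \<le> gm * (a/4) + gp / (a/4)" using Re_bd[of u] u by simp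
    also have "\<dots> \<le> gm + 4 * (gp / a)"
    proof -
      have "gm * (a / 4) \<le> gm * 1" using a gp by (intro mult_left_mono) auto
      moreover have "gp / (a / 4) = 4 * (gp / a)" by simp
      ultimately show ?thesis unfolding mult_1_right by (simp only: add_right_mono)
    qed
    finally have 1: "exp (gm * Re u + gp * Re (inverse u)) \<le> exp (gm + 4 * (gp / a))" by simp
    have "norm (1 - u) \<le> 1 + a / 4" using norm_triangle_ineq4[of 1 u] u by simp
    also have "\<dots> \<le> exp a" using a exp_ge_add_one_self[of a] by linarith
    finally have "norm (1 - u) ^ n1 \<le> exp a ^ n1" by (intro power_mono) auto
    also have "\<dots> = exp (real n1 * a)" by (simp add: exp_of_nat_mult)
    finally show ?thesis unfolding nw B1_def using 1 a u by (intro mult_mono) auto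
  qed
  have b2: "1 / norm (weight gp gm n2 x2 w) \<le> B2" if w: "norm w = 3" for w
  proof -
    have "\<bar>gm * Re w + gp * Re (inverse w)\<bar> \<le> 3 * gm + gp" using Re_bd[of w] w gp by simp
    then have 1: "exp (- (3 * gm + gp)) \<le> exp (gm * Re w + gp * Re (inverse w))"
      by (simp only: exp_le_cancel_iff)
    have "2 \<le> norm (1 - w)" using norm_triangle_ineq2[of w 1] w by (simp add: norm_minus_commute)
    then have 2: "2 ^ n2 \<le> norm (1 - w) ^ n2" by (intro power_mono) auto
    have "exp (- (3 * gm + gp)) * 3 powi x2 * 2 ^ n2 \<le> norm (weight gp gm n2 x2 w)"
      unfolding nw using 1 2 w by (intro mult_mono) auto
    then have "1 / norm (weight gp gm n2 x2 w) \<le> 1 / (exp (- (3 * gm + gp)) * 3 powi x2 * 2 ^ n2)"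
      by (intro frac_le mult_pos_pos) auto
    also have "\<dots> = B2" by (simp only: B2_def exp_minus power_int_minus) (simp add: divide_inverse)
    finally show ?thesis .
  qed
  have pt: "norm (f u w) \<le> B1 * B2" if u: "norm u = a/4" and w: "norm w = 3" for u w
  proof -
    have "1 \<le> norm (u - w)" using norm_triangle_ineq2[of w u] u w a by (simp add: norm_minus_commute)
    then have "1 / norm (u - w) \<le> 1" using frac_le[of 1 1 1 "norm (u - w)"] by simp
    then have "norm (weight gp gm n1 x1 u) * (1 / norm (weight gp gm n2 x2 w)) * (1 / norm (u - w)) \<le> B1 * B2 * 1"
      using b1[OF u] b2[OF w] B by (intro mult_mono) auto
    then show ?thesis by (simp add: f_def norm_mult norm_divide)
  qed
  have inner: "norm (contour_integral (circlepath 0 3) (f u)) \<le> B1 * B2 * (2 * pi * 3)" if u: "norm u = a/4" for u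
  proof (rule has_contour_integral_bound_circlepath[OF has_contour_integral_integral])
    have "continuous_on (path_image (circlepath 0 3)) (\<lambda>w. (\<lambda>(u, w). f u w) (u, w))"
      by (rule continuous_on_compose2[OF cf]) (use a u in \<open>auto intro!: continuous_intros\<close>)
    then show "f u contour_integrable_on circlepath 0 3"
      by (intro contour_integrable_continuous_circlepath) simp
  qed (use B pt u in auto)
  have "norm (contour_integral (circlepath 0 (a/4)) (\<lambda>u. contour_integral (circlepath 0 3) (f u))) \<le> B1 * B2 * (2 * pi * 3)
    * (2 * pi * (a/4))"
  proof (rule has_contour_integral_bound_circlepath[OF has_contour_integral_integral])
    show "(\<lambda>u. contour_integral (circlepath 0 3) (f u)) contour_integrable_on circlepath 0 (a/4)"
      by (intro contour_integrable_continuous_circlepath continuous_on_contour_integral_param[OF cf]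
            circlepath_C1) simp
  qed (use B inner a in auto)
  also have "\<dots> = B1 * B2 * (3 * a * (pi * pi))" by simp
  also have "\<dots> \<le> B1 * B2 * (3 * 1 * (4 * 4))"
    using B a pi_less_4 by (intro mult_left_mono mult_mono) auto
  also have "\<dots> = 48 * exp (4 * gm + gp) * (exp (4 * (gp / a) + real n1 * a) * (a/4) powi x1 * (3 powi (- x2) / 2 ^ n2))"
    by (simp add: B1_def B2_def exp_add mult_ac) (simp flip: exp_add)
  finally show ?thesis by (simp only: f_def)
qed

text \<open>The growing terms are of order 1 / a or (1 / a) log (1 / a), whereas n2 is of order gp /
  a^2; so the factor 2^(- n2) wins.\<close>

lemma outer_bound_tendsto:
  assumes "gp > 0" "D > 0"
  shows "((\<lambda>a::real. exp (4 * (gp / a) + (gp / a + D) + D * (gp / a) * (- ln a) + 4 * D * (gp / a) + 2 - ln 2 * ((gp / a - D)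
    / a))) \<longlongrightarrow> 0) (at_right 0)"
  using assms by real_asymp

lemma outer_circle_tendsto:
  fixes a :: "nat \<Rightarrow> real" and n1 n2 :: "nat \<Rightarrow> nat" and x1 x2 :: "nat \<Rightarrow> int"
  assumes gp: "gp > 0" "gm > 0" and a: "\<And>N. 0 < a N" "\<And>N. a N \<le> 1/8" "a \<longlonglongrightarrow> 0"
    and D: "D > 0" "\<And>N. \<bar>real (n1 N) * a N - gp / a N\<bar> \<le> D" "\<And>N. \<bar>real (n2 N) * a N - gp / a N\<bar> \<le> D"
      "\<And>N. \<bar>of_int (x1 N)\<bar> \<le> D * (gp / a N)" "\<And>N. \<bar>of_int (x2 N)\<bar> \<le> D * (gp / a N)"
    and d: "\<And>N. x1 N - x2 N = d"
  shows "(\<lambda>N. contour_integral (circlepath 0 (a N/4)) (\<lambda>u. contour_integral (circlepath 0 3)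
      (\<lambda>w. weight gp gm (n1 N) (x1 N) u / weight gp gm (n2 N) (1 + x2 N) w * (1 / (u - w)))) / of_real (a N powi d))
        \<longlonglongrightarrow> 0"
    (is "(\<lambda>N. ?X N / _) \<longlonglongrightarrow> 0")
proof (rule Lim_null_comparison)
  define g where "g = (\<lambda>a::real. exp (4 * (gp / a) + (gp / a + D) + D * (gp / a) * (- ln a) + 4 * D * (gp / a) + 2 - ln 2 * ((gp
    / a - D) / a)))"
  have "a N \<noteq> 0" for N using a(1)[of N] by simp
  then have "filterlim a (at_right 0) sequentially"
    using a(1,3) by (auto simp: filterlim_at intro!: always_eventually)
  then have "(\<lambda>N. g (a N)) \<longlonglongrightarrow> 0"
    using outer_bound_tendsto[OF gp(1) D(1)] unfolding g_def by (rule filterlim_compose[rotated])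
  then show "(\<lambda>N. 48 * exp (4 * gm + gp) * g (a N)) \<longlonglongrightarrow> 0"
    by (rule tendsto_mult_right_zero)
  show "\<forall>\<^sub>F N in sequentially. norm (?X N / of_real (a N powi d))
      \<le> 48 * exp (4 * gm + gp) * g (a N)"
  proof (intro always_eventually allI)
    fix N
    define M where "M = gp / a N"
    define y where "y = a N"
    have y: "0 < y" "y \<le> 1/8" using a by (auto simp: y_def)
    have M: "M > 0" using a gp by (simp add: M_def)
    have apos: "y powi d > 0" using y by simp
    have "x1 N = x2 N + d" using d[of N] by simp
    then have yx1: "y powi x1 N = y powi x2 N * y powi d" using y by (simp add: power_int_add)
    \<comment> \<open>Dividing by a^d leaves the power a^x2, whose logarithm is at most of order (1
      / a) log (1 / a).\<close>
    have "(y/4) powi x1 N / y powi d = y powi x2 N * 4 powi (- x1 N)"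
      unfolding power_int_divide_distrib yx1 power_int_minus using less_imp_neq[OF apos] by (simp add: divide_inverse)
    also have "\<dots> \<le> exp (\<bar>of_int (x2 N)\<bar> * \<bar>ln y\<bar>) * exp (\<bar>of_int (- x1 N)\<bar> * \<bar>ln 4\<bar>)"
      using y by (intro mult_mono power_int_le_exp) auto
    finally have e1: "(y/4) powi x1 N / y powi d \<le> exp (\<bar>of_int (x2 N)\<bar> * \<bar>ln y\<bar>) * exp (\<bar>of_int (x1 N)\<bar>
      * \<bar>ln 4\<bar>)" by simp
    have e2: "(3::real) powi (- (1 + x2 N)) \<le> exp (\<bar>of_int (- (1 + x2 N))\<bar> * \<bar>ln (3::real)\<bar>)"
      by (rule power_int_le_exp) simp
    have l4: "ln 4 \<le> (2::real)"
    proof -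
      have "ln 4 = 2 * ln (2::real)" using ln_realpow[of 2 2] by simp
      then show ?thesis using ln_2_less_1 by simp
    qed
    have l3: "ln 3 \<le> (2::real)" using l4 ln_le_cancel_iff[of 3 "4::real"] by linarith
    have l34: "0 \<le> ln (3::real)" "0 \<le> ln (4::real)" by auto
    have lny: "\<bar>ln y\<bar> = - ln y" using y by simp
    have t1: "real (n1 N) * y \<le> M + D" using D(2)[of N] by (simp add: M_def y_def)
    have t2: "\<bar>of_int (x2 N)\<bar> * \<bar>ln y\<bar> \<le> D * M * (- ln y)"
      unfolding lny using D(5)[of N] y by (intro mult_right_mono) (auto simp: M_def)
    have t3: "\<bar>of_int (x1 N)\<bar> * \<bar>ln (4::real)\<bar> \<le> D * M * 2"
      using D(4)[of N] l4 l34 M D(1) by (intro mult_mono) (auto simp: M_def)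
    have t4: "\<bar>of_int (- (1 + x2 N))\<bar> * \<bar>ln (3::real)\<bar> \<le> (1 + D * M) * 2"
      using D(5)[of N] l3 l34 M D(1) by (intro mult_mono) (auto simp: M_def)
    have t5: "ln 2 * ((M - D) / y) \<le> real (n2 N) * ln 2"
    proof -
      have "(M - D) / y \<le> real (n2 N)" using D(3)[of N] y by (simp add: M_def y_def field_simps abs_le_iff)
      then have "ln 2 * ((M - D) / y) \<le> ln 2 * real (n2 N)" by (intro mult_left_mono) auto
      then show ?thesis by (simp add: mult.commute)
    qed
    have p2: "1 / 2 ^ n2 N = exp (- (real (n2 N) * ln 2))"
      by (simp add: exp_minus exp_of_nat_mult divide_inverse)
    have "norm (?X N / of_real (a N powi d))
      \<le> 48 * exp (4 * gm + gp) * (exp (4 * M + real (n1 N) * y) * (y/4) powi x1 N * (3 powi (- (1 + x2 N)) / 2 ^ n2 N)) / y powi d"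
      unfolding norm_divide norm_of_real abs_of_pos[OF apos[unfolded y_def]] y_def M_def
      by (rule divide_right_mono[OF outer_circle_bound[OF gp y[unfolded y_def]] less_imp_le[OF apos[unfolded y_def]]])
    also have "\<dots> = 48 * exp (4 * gm + gp) * (exp (4 * M + real (n1 N) * y) * ((y/4) powi x1 N / y powi d) * (3 powi (- (1 + x2 N))
      * (1 / 2 ^ n2 N)))"
      by simp
    also have "\<dots> \<le> 48 * exp (4 * gm + gp) * (exp (4 * M + real (n1 N) * y) * (exp (\<bar>of_int (x2 N)\<bar> * \<bar>ln y\<bar>)
      * exp (\<bar>of_int (x1 N)\<bar> * \<bar>ln 4\<bar>))
        * (exp (\<bar>of_int (- (1 + x2 N))\<bar> * \<bar>ln 3\<bar>) * (1 / 2 ^ n2 N)))"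
      using y by (intro mult_left_mono mult_mono e1 e2 mult_right_mono) auto
    also have "\<dots> = 48 * exp (4 * gm + gp) * exp (4 * M + real (n1 N) * y + (\<bar>of_int (x2 N)\<bar> * \<bar>ln y\<bar>
      + \<bar>of_int (x1 N)\<bar> * \<bar>ln 4\<bar>)
        + (\<bar>of_int (- (1 + x2 N))\<bar> * \<bar>ln 3\<bar> + - (real (n2 N) * ln 2)))"
      unfolding p2 by (simp only: exp_add)
    also have "\<dots> \<le> 48 * exp (4 * gm + gp) * g y"
    proof -
      have "4 * M + real (n1 N) * y + (\<bar>of_int (x2 N)\<bar> * \<bar>ln y\<bar> + \<bar>of_int (x1 N)\<bar> * \<bar>ln 4\<bar>)
        + (\<bar>of_int (- (1 + x2 N))\<bar> * \<bar>ln 3\<bar> + - (real (n2 N) * ln 2))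
        \<le> 4 * M + (M + D) + D * M * (- ln y) + 4 * D * M + 2 - ln 2 * ((M - D) / y)"
        using t1 t2 t3 t4 t5 by (simp add: algebra_simps)
      then show ?thesis unfolding g_def M_def y_def by simp
    qed
    finally show "norm (?X N / of_real (a N powi d))
      \<le> 48 * exp (4 * gm + gp) * g (a N)" by (simp only: y_def)
  qed
qed

section \<open>Reduction of a kernel entry to arc integrals\<close>

lemma weight_quotient:
  assumes "z \<noteq> 0"
  shows "weight gp gm n1 x1 z / weight gp gm n2 (1 + x2) z = z powi (x1 - x2 - 1) * ((1 - z) ^ n1 / (1 - z) ^ n2)"
proof -
  have "z powi x1 / z powi (1 + x2) = z powi (x1 - x2 - 1)"
    using assms power_int_diff[of z x1 "1 + x2"] by (simp add: algebra_simps)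
  then show ?thesis unfolding weight_def by (simp add: mult.assoc flip: times_divide_times_eq)
qed

lemma weight_quotient_scaled:
  assumes "a > 0" "w \<noteq> 0" "x1 - x2 = d"
  shows "weight gp gm n1 x1 (of_real a * w) / weight gp gm n2 (1 + x2) (of_real a * w) * (of_real a * w')
     = of_real (a powi d) * (arc_integrand a n1 n2 d w * w')"
proof -
  have "of_real a * w \<noteq> 0" using assms by simp
  note q = weight_quotient[OF this]
  have "(of_real a :: complex) powi (d - 1) * of_real a = of_real (a powi d)"
    using assms(1) power_int_add_1[of "of_real a :: complex" "d - 1"] by simp
  then show ?thesis
    unfolding q assms(3) arc_integrand_def by (simp add: power_int_mult_distrib mult_ac)
qed

text \<open>The outer circle is negligible, and the loop W contributes the residue integral over the
  right arc up to the crossing error; the single integral has the same integrand over the full loop.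
  The level b is tied exactly to x2, so the loops move with N, and the bounds are required for all N
  so that one constant serves.\<close>

lemma kernel_asymptotics:
  fixes a bb :: "nat \<Rightarrow> real" and n1 n2 :: "nat \<Rightarrow> nat" and x1 x2 :: "nat \<Rightarrow> int"
  assumes gp: "gp > 0" "gm > 0" and re: "0 < r" "0 < e" "e < 1 - r"
    and a: "\<And>N. 0 < a N" "\<And>N. a N \<le> 1/8" "\<And>N. a N < 1 - e" "a \<longlonglongrightarrow> 0"
    and \<delta>: "0 < \<delta>" "\<delta> \<le> 1/2" "\<And>N t. \<bar>\<delta> * (cos (2 * pi * t) - bb N)\<bar> < ln 2"
    and b: "\<And>N. of_int (x2 N) = 2 * (gp / a N) * bb N"
    and D: "D > 0" "\<And>N. \<bar>real (n1 N) * a N - gp / a N\<bar> \<le> D" "\<And>N. \<bar>real (n2 N) * a N - gp / a N\<bar> \<le> D"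
      "\<And>N. \<bar>of_int (x1 N)\<bar> \<le> D * (gp / a N)" "\<And>N. \<bar>of_int (x2 N)\<bar> \<le> D * (gp / a N)"
    and d: "\<And>N. x1 N - x2 N = d"
  defines "q \<equiv> \<lambda>N t. arc_integrand (a N) (n1 N) (n2 N) d (wloop (- \<delta>) (bb N) t) * wloop' (- \<delta>) (bb N) t"
  shows "(\<lambda>N. plancherel_kernel gp gm r e (n1 N) (x1 N) (n2 N) (x2 N) / of_real (a N powi d)
     - 1 / (2 * of_real pi * \<i>) * ((LINT t:right_arc (bb N)|lborel. q N t) - (if n1 N < n2 N then (LINT t:{0..1}|lborel. q N t)
       else 0)))
     \<longlonglongrightarrow> 0"
proof -
  define c :: complex where "c = 1 / (2 * of_real pi * \<i>)"
  define W where "W = (\<lambda>N t. of_real (a N) * wloop (- \<delta>) (bb N) t)"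
  define f where "f = (\<lambda>N u w. weight gp gm (n1 N) (x1 N) u / weight gp gm (n2 N) (1 + x2 N) w * (1 / (u - w)))"
  define big where "big = (\<lambda>N. contour_integral (circlepath 0 (a N/4)) (\<lambda>u. contour_integral (circlepath 0 3) (f N u)))"
  define cross where "cross = (\<lambda>N. contour_integral (W N) (\<lambda>w. contour_integral (circlepath 0 (a N/4)) (\<lambda>u. f N u
    w)))"
  define R where "R = (\<lambda>N. LINT t:right_arc (bb N)|lborel. q N t)"
  define Fl where "Fl = (\<lambda>N. LINT t:{0..1}|lborel. q N t)"
  have \<delta>': "\<bar>- \<delta> * (cos (2 * pi * t) - bb N)\<bar> < ln 2" for N t using \<delta>(3)[of t N] by simp
  have apos: "a N powi d > 0" for N using a(1)[of N] by simp
  have ex: "1/2 < exp (- \<delta> * (cos (2 * pi * t) - bb N))" "exp (- \<delta> * (cos (2 * pi * t) - bb N)) < 2" for N t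
    by (rule half_less_exp exp_less_two, use \<delta>'[of t N] in linarith)+
  have double: "contour_integral (circlepath 0 r) (\<lambda>u. contour_integral (circlepath 1 e) (f N u)) = big N - cross N" for N
    unfolding big_def cross_def f_def W_def
    by (rule kernel_double_integral[OF re a(1) _ a(3) ex]) (use a(2)[of N] in simp)
  have conv: "(LINT t:right_arc (bb N)|lborel. weight gp gm (n1 N) (x1 N) (of_real (a N) * wloop (- \<delta>) (bb N) t)
        / weight gp gm (n2 N) (1 + x2 N) (of_real (a N) * wloop (- \<delta>) (bb N) t) * (of_real (a N) * wloop' (- \<delta>) (bb N) t))
      = of_real (a N powi d) * R N" for N
    unfolding R_def q_def by (subst weight_quotient_scaled[OF a(1) wloop_nonzero d]) simp
  \<comment> \<open>As b is matched to x2, the exponents x1 and 1 + x2 miss the critical value by d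
    and by 1. The last term bounds 8 n a^2, because n a^2 <= gp + D.\<close>
  define C where "C = 2 * gm + (\<bar>of_int d\<bar> + 1) + 2 * D + 8 * (gp + D)"
  have nC: "8 * real n * (a N)\<^sup>2 \<le> 8 * (gp + D)" if "\<bar>real n * a N - gp / a N\<bar> \<le> D" for n N
  proof -
    have "real n * a N \<le> gp / a N + D" using that by linarith
    then have "real n * a N * a N \<le> (gp / a N + D) * a N" using a(1)[of N] by (intro mult_right_mono) auto
    also have "\<dots> = gp + D * a N" using a(1)[of N] by (simp add: field_simps)
    also have "\<dots> \<le> gp + D * 1" using a(2)[of N] D(1) by (intro add_left_mono mult_left_mono) auto
    finally show ?thesis by (simp add: power2_eq_square)
  qed
  have gmC: "2 * gm * a N \<le> 2 * gm" for N using gp a(1)[of N] a(2)[of N] by simp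
  have C1: "weight_error gp gm (a N) (bb N) (n1 N) (x1 N) \<le> C" for N
  proof -
    have "of_int (x1 N) - 2 * (gp / a N) * bb N = of_int d" unfolding b[symmetric] using d[of N] by (simp flip: of_int_diff)
    then have "\<bar>of_int (x1 N) - 2 * (gp / a N) * bb N\<bar> \<le> \<bar>of_int d\<bar> + 1" by simp
    then show ?thesis using gmC[of N] D(2)[of N] nC[OF D(2)[of N]] unfolding C_def weight_error_def by (intro add_mono) auto
  qed
  have C2: "weight_error gp gm (a N) (bb N) (n2 N) (1 + x2 N) \<le> C" for N
  proof -
    have "of_int (1 + x2 N) - 2 * (gp / a N) * bb N = 1" unfolding b[symmetric] by simp
    then have "\<bar>of_int (1 + x2 N) - 2 * (gp / a N) * bb N\<bar> \<le> \<bar>of_int d\<bar> + 1" by simp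
    then show ?thesis using gmC[of N] D(3)[of N] nC[OF D(3)[of N]] unfolding C_def weight_error_def by (intro add_mono) auto
  qed
  obtain K where K: "K \<ge> 0"
    "\<And>gp gm n1 n2 x1 x2 a b C. gp > 0 \<Longrightarrow> gm > 0 \<Longrightarrow> 0 < a \<Longrightarrow> a
      \<le> 1/8 \<Longrightarrow>
    (\<And>t. \<bar>\<delta> * (cos (2 * pi * t) - b)\<bar> < ln 2) \<Longrightarrow>
    weight_error gp gm a b n1 x1 \<le> C \<Longrightarrow> weight_error gp gm a b n2 x2 \<le> C \<Longrightarrow>
    norm (crossing_remainder gp gm n1 x1 n2 x2 a \<delta> b)
     \<le> K * exp (2 * C) * (a powi x1 * a / a powi x2) * (gp / a) powr (- (1/16))"
    using crossing_error[OF \<delta>(1,2)] by blast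
  have err: "norm ((cross N + 2 * of_real pi * \<i> * (of_real (a N powi d) * R N)) / of_real (a N powi d))
      \<le> K * exp (2 * C) * (gp / a N) powr (- (1/16))" for N
  proof -
    have "a N powi x1 N * a N / a N powi (1 + x2 N) = a N powi d"
    proof -
      have "x1 N = d + x2 N" using d[of N] by simp
      then show ?thesis using a(1)[of N] by (simp add: power_int_add)
    qed
    then have "norm (cross N + 2 * of_real pi * \<i> * (of_real (a N powi d) * R N)) \<le> K * exp (2 * C) * a N powi d * (gp
      / a N) powr (- (1/16))"
      using K(2)[OF gp a(1) a(2) \<delta>(3) C1 C2, of N] unfolding crossing_remainder_def conv cross_def f_def W_def by simp
    then show ?thesis
      unfolding norm_divide norm_of_real using apos[of N] by (simp add: field_simps)
  qed
  have "(\<lambda>N. (gp / a N) powr (- (1/16))) \<longlonglongrightarrow> 0"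
  proof (rule tendsto_neg_powr)
    have "a N \<noteq> 0" for N using a(1)[of N] by simp
    then have "filterlim a (at_right 0) sequentially"
      using a(1,4) by (auto simp: filterlim_at intro!: always_eventually)
    moreover have "LIM y at_right 0. gp / y :> at_top" using gp by real_asymp
    ultimately show "LIM N sequentially. gp / a N :> at_top" by (rule filterlim_compose[rotated])
  qed auto
  then have "(\<lambda>N. K * exp (2 * C) * (gp / a N) powr (- (1/16))) \<longlonglongrightarrow> 0"
    by (rule tendsto_mult_right_zero)
  then have lim1: "(\<lambda>N. (cross N + 2 * of_real pi * \<i> * (of_real (a N powi d) * R N)) / of_real (a N powi d))
    \<longlonglongrightarrow> 0"
    by (rule Lim_null_comparison[rotated]) (intro always_eventually allI err)
  have lim2: "(\<lambda>N. big N / of_real (a N powi d)) \<longlonglongrightarrow> 0"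
    unfolding big_def f_def by (rule outer_circle_tendsto[OF gp a(1,2,4) D d])
  \<comment> \<open>For n1 < n2 the single integrand is the quotient of the two weights, that is,
    the residue integrand. It is holomorphic in the punctured unit disc, so its circle can be
    deformed to W.\<close>
  have pole: "contour_integral (circlepath 0 r) (\<lambda>z. z powi (x1 N - x2 N - 1) / (1 - z) ^ (n2 N - n1 N)) = of_real (a N powi d)
    * Fl N"
    if lt: "n1 N < n2 N" for N
  proof -
    define g where "g = (\<lambda>z::complex. z powi (x1 N - x2 N - 1) / (1 - z) ^ (n2 N - n1 N))"
    have nW: "norm (W N t) < 1" "W N t \<noteq> 0" for t
    proof -
      have "a N * norm (wloop (- \<delta>) (bb N) t) \<le> 1/8 * 2"
        using norm_wloop_bounds(2)[OF \<delta>'[of t N]] a(1)[of N] a(2)[of N] by (intro mult_mono) auto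
      then show "norm (W N t) < 1" using a(1)[of N] by (simp add: W_def norm_mult)
      show "W N t \<noteq> 0" using a(1)[of N] by (simp add: W_def)
    qed
    have nW1: "W N t \<noteq> 1" for t using nW(1)[of t] by auto
    have "contour_integral (W N) g = contour_integral (circlepath 0 r) g"
    proof (rule contour_integral_radial[where S = "ball 0 1 - {0}"
      and \<rho> = "\<lambda>t. a N * exp (- \<delta> * (cos (2 * pi * t) - bb N))"])
      show "g holomorphic_on ball 0 1 - {0}" unfolding g_def by (intro holomorphic_intros) auto
      show "valid_path (W N)" unfolding W_def by (intro valid_path_scale) simp
      show "pathfinish (W N) = pathstart (W N)" by (simp add: W_def pathfinish_def pathstart_def wloop_closed)
      show "W N t = of_real (a N * exp (- \<delta> * (cos (2 * pi * t) - bb N))) * unit_pt t" for t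
        by (simp add: W_def wloop_def)
      fix t s assume s: "s \<in> closed_segment (a N * exp (- \<delta> * (cos (2 * pi * t) - bb N))) r"
      define y where "y = a N * exp (- \<delta> * (cos (2 * pi * t) - bb N))"
      have "norm (W N t) = y" using a(1)[of N] by (simp add: W_def norm_mult norm_wloop y_def)
      then have "0 < y" "y < 1" using nW[of t] a(1)[of N] by (auto simp: y_def)
      moreover have "r < 1" using re by simp
      ultimately have "0 < s" "s < 1" using s[folded y_def] re by (auto simp: closed_segment_eq_real_ivl split: if_splits)
      then show "of_real s * unit_pt t \<in> ball 0 1 - {0}" by (auto simp: norm_mult)
    qed auto
    moreover have "contour_integral (W N) g = (LINT t:{0..1}|lborel. g (W N t) * (of_real (a N) * wloop' (- \<delta>) (bb N) t))"
    proof -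
      have "continuous_on {0..1} (\<lambda>t. g (W N t) * (of_real (a N) * wloop' (- \<delta>) (bb N) t))"
        unfolding g_def using nW(2) nW1 unfolding W_def by (intro continuous_intros) auto
      then show ?thesis
        by (subst contour_integral_LINT) (simp_all add: W_def scaled_wloop_derivative)
    qed
    moreover have "g (W N t) * (of_real (a N) * wloop' (- \<delta>) (bb N) t) = of_real (a N powi d) * q N t" for t
    proof -
      have "1 - W N t \<noteq> 0" using nW(1)[of t] by auto
      then have "(1 - W N t) ^ n1 N / (1 - W N t) ^ n2 N = 1 / (1 - W N t) ^ (n2 N - n1 N)"
        using lt by (simp add: power_diff)
      then have "g (W N t) = weight gp gm (n1 N) (x1 N) (W N t) / weight gp gm (n2 N) (1 + x2 N) (W N t)"
        unfolding g_def weight_quotient[OF nW(2)] by simp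
      moreover have "weight gp gm (n1 N) (x1 N) (W N t) / weight gp gm (n2 N) (1 + x2 N) (W N t) * (of_real (a N)
        * wloop' (- \<delta>) (bb N) t)
          = of_real (a N powi d) * q N t"
        unfolding W_def q_def by (rule weight_quotient_scaled[OF a(1) wloop_nonzero d])
      ultimately show ?thesis by (simp only:)
    qed
    ultimately show ?thesis by (simp add: g_def Fl_def)
  qed
  have c2: "c * (2 * of_real pi * \<i>) = 1" by (simp add: c_def)
  have eq: "plancherel_kernel gp gm r e (n1 N) (x1 N) (n2 N) (x2 N) / of_real (a N powi d)
     - c * (R N - (if n1 N < n2 N then Fl N else 0))
     = c\<^sup>2 * (big N / of_real (a N powi d)) - c\<^sup>2 * ((cross N + 2 * of_real pi * \<i> * (of_real (a N powi d) * R N))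
       / of_real (a N powi d))" for N
  proof -
    define A :: complex where "A = of_real (a N powi d)"
    have A: "A \<noteq> 0" using apos[of N] unfolding A_def of_real_eq_0_iff by linarith
    have fN: "(\<lambda>w. (exp (of_real gm * u + of_real gp * inverse u) * u powi x1 N * (1 - u) ^ n1 N) /
           (exp (of_real gm * w + of_real gp * inverse w) * w powi (1 + x2 N) * (1 - w) ^ n2 N) * (1 / (u - w))) = f N u" for u
      by (rule ext) (simp only: f_def weight_def)
    have K1: "plancherel_kernel gp gm r e (n1 N) (x1 N) (n2 N) (x2 N)
        = - (c * (A * (if n1 N < n2 N then Fl N else 0))) + c\<^sup>2 * (big N - cross N)"
      unfolding plancherel_kernel_def fN double c_def[symmetric] A_def using pole[of N] by simp
    have K2: "c\<^sup>2 * (2 * of_real pi * \<i> * (A * R N)) = A * (c * R N)"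
    proof -
      have "c\<^sup>2 * (2 * of_real pi * \<i> * (A * R N)) = c * (c * (2 * of_real pi * \<i>)) * (A * R N)"
        by (simp add: power2_eq_square mult.assoc)
      then show ?thesis unfolding c2 by (simp add: mult_ac)
    qed
    have alg: "k / A - c * (\<rho> - \<phi>) = s * (B / A) - s * ((X + Y) / A)"
      if "k = - (c * (A * \<phi>)) + s * (B - X)" "s * Y = A * (c * \<rho>)" for k \<rho> \<phi> s B X Y :: complex
    proof -
      have "s * ((X + Y) / A) = s * (X / A) + s * Y / A" by (simp add: add_divide_distrib distrib_left)
      also have "s * Y / A = c * \<rho>" unfolding that(2) using A by simp
      finally show ?thesis unfolding that(1) using A by (simp add: field_simps)
    qed
    show ?thesis
      unfolding A_def[symmetric] by (rule alg[OF K1 K2])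
  qed
  have "(\<lambda>N. c\<^sup>2 * (big N / of_real (a N powi d)) - c\<^sup>2 * ((cross N + 2 * of_real pi * \<i> * (of_real (a N powi d)
    * R N)) / of_real (a N powi d))) \<longlonglongrightarrow> c\<^sup>2 * 0 - c\<^sup>2 * 0"
    by (intro tendsto_diff tendsto_mult_left lim1 lim2)
  then show ?thesis unfolding eq[symmetric] unfolding c_def R_def Fl_def by simp
qed

text \<open>Up to the factor (sqrt gp)^d this is the integrand of S under u = sqrt gp * v, pulled
  back to the loop in v; accordingly \<sigma> will be (t1 - t2) sqrt gp.\<close>

definition lim_integrand :: "real \<Rightarrow> real \<Rightarrow> int \<Rightarrow> real \<Rightarrow> real \<Rightarrow> complex"
  where
  "lim_integrand \<delta> b d \<sigma> t = wloop \<delta> b t powi (d - 1) * exp (- of_real \<sigma> * wloop \<delta> b t)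
    * wloop' \<delta> b t"

lemma continuous_on_lim_integrand [continuous_intros]: "continuous_on S (lim_integrand \<delta> b d \<sigma>)"
  unfolding lim_integrand_def by (intro continuous_intros) auto

lemma set_integrable_lim_integrand:
  assumes "A \<in> sets borel" "A \<subseteq> {0..1}"
  shows "set_integrable lborel A (lim_integrand \<delta> b d \<sigma>)"
  by (rule set_integrable_subset[OF borel_integrable_atLeastAtMost'[OF continuous_on_lim_integrand[of "{0..1}"]]])
     (use assms in auto)

lemma half_le_ln_2: "1/2 \<le> ln (2::real)"
proof -
  have "ln (exp (1/2)) \<le> ln (2::real)" by (subst ln_le_cancel_iff) (use exp_half_le2 in auto)
  then show ?thesis by simp
qed

text \<open>Two sequences are produced because the sign of n1 - n2, which selects the arc, may
  change with N. The limiting arcs matter only up to null sets, so that the empty set, the whole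
  interval or closed arcs can be supplied.\<close>

lemma kernel_entry_limit:
  fixes n1 n2 :: "nat \<Rightarrow> nat" and x1 x2 :: "nat \<Rightarrow> int"
  assumes gp: "gp > 0" "gm > 0" and re: "0 < r" "0 < e" "e < 1 - r"
    and d: "\<And>N. x1 N - x2 N = d"
    and n1: "(\<lambda>N. (real (n1 N) - real N) / sqrt (real N)) \<longlonglongrightarrow> t1"
    and n2: "(\<lambda>N. (real (n2 N) - real N) / sqrt (real N)) \<longlonglongrightarrow> t2"
    and x2: "(\<lambda>N. real_of_int (x2 N) / sqrt (real N)) \<longlonglongrightarrow> c"
  defines "b \<equiv> c / (2 * sqrt gp)" and "\<sigma> \<equiv> (t1 - t2) * sqrt gp"
  obtains R L :: "nat \<Rightarrow> complex" and \<delta> :: real where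
    "(\<lambda>N. plancherel_kernel gp gm r e (n1 N) (x1 N) (n2 N) (x2 N) / of_real (sqrt (gp / real N) powi d)
       - 1 / (2 * of_real pi * \<i>) * (if n1 N < n2 N then - L N else R N)) \<longlonglongrightarrow> 0"
    "\<And>A. A \<in> sets borel \<Longrightarrow> (AE t in lborel. t \<in> A \<longleftrightarrow> t \<in> {0..1} \<and> b < cos (2 * pi
      * t)) \<Longrightarrow>
        R \<longlonglongrightarrow> (LINT t:A|lborel. lim_integrand \<delta> b d \<sigma> t)"
    "\<And>A. A \<in> sets borel \<Longrightarrow> (AE t in lborel. t \<in> A \<longleftrightarrow> t \<in> {0..1} \<and> cos (2 * pi
      * t) < b) \<Longrightarrow>
        L \<longlonglongrightarrow> (LINT t:A|lborel. lim_integrand \<delta> b d \<sigma> t)"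
proof -
  define a where "a = (\<lambda>N. sqrt (gp / real N))"
  define bb where "bb = (\<lambda>N. real_of_int (x2 N) / sqrt (real N) / (2 * sqrt gp))"
  have sg: "sqrt gp > 0" using gp by simp
  have bb: "bb \<longlonglongrightarrow> b" unfolding bb_def b_def by (intro tendsto_intros x2) (use sg in auto)
  obtain B where B: "\<And>N. \<bar>bb N\<bar> \<le> B"
    using convergent_imp_Bseq[OF convergentI[OF bb]] unfolding Bseq_def by auto
  have B0: "B \<ge> 0" using B[of 0] by simp
  \<comment> \<open>Since |cos - b| <= 1 + B, the logarithm of the radius is at most 1/4 < ln 2 in
    absolute value, with one \<delta> for all N.\<close>
  define \<delta> where "\<delta> = 1 / (4 * (1 + B))"
  have \<delta>: "0 < \<delta>" "\<delta> \<le> 1/2" using B0 by (auto simp: \<delta>_def field_simps)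
  have \<delta>b: "\<bar>\<delta> * (cos (2 * pi * t) - bb N)\<bar> < ln 2" for N t
  proof -
    have "\<bar>cos (2 * pi * t) - bb N\<bar> \<le> 1 + B"
      using abs_cos_le_one[of "2 * pi * t"] B[of N] by linarith
    then have "\<delta> * \<bar>cos (2 * pi * t) - bb N\<bar> \<le> \<delta> * (1 + B)" using \<delta> by (intro mult_left_mono) auto
    also have "\<dots> = 1/4" using B0 by (simp add: \<delta>_def)
    also have "\<dots> < ln 2" using half_le_ln_2 by simp
    finally show ?thesis using \<delta> by (simp add: abs_mult)
  qed
  have a_lim: "a \<longlonglongrightarrow> 0" unfolding a_def using gp by real_asymp
  have "eventually (\<lambda>N. a N < 1/8) sequentially" "eventually (\<lambda>N. a N < 1 - e) sequentially"
    by (rule order_tendstoD(2)[OF a_lim]; use re in simp)+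
  \<comment> \<open>At N = 0 division by zero gives a = 0. The lemmas above want their hypotheses
    for every N, so they are applied to the sequences shifted by N0.\<close>
  then have "eventually (\<lambda>N. N \<ge> 1 \<and> a N < 1/8 \<and> a N < 1 - e) sequentially"
    using eventually_ge_at_top[of 1] by eventually_elim auto
  then obtain N0 where N0: "\<And>N. N \<ge> N0 \<Longrightarrow> N \<ge> 1 \<and> a N < 1/8 \<and> a N < 1 - e"
    by (auto simp: eventually_sequentially)
  have gpa: "gp / a N = sqrt gp * sqrt (real N)" for N
  proof -
    have "gp / a N = gp / sqrt gp * sqrt (real N)" by (simp add: a_def real_sqrt_divide)
    then show ?thesis by (simp only: real_div_sqrt[OF less_imp_le[OF gp(1)]])
  qed
  have apos: "a N > 0" if "N \<ge> N0" for N using N0[OF that] gp by (simp add: a_def)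
  have na: "real n * a N - gp / a N = (real n - real N) / sqrt (real N) * sqrt gp" if "N \<ge> N0" for n N
  proof -
    have sN: "sqrt (real N) > 0" using N0[OF that] by simp
    have "sqrt gp * sqrt (real N) = real N / sqrt (real N) * sqrt gp" using sN by (simp add: real_div_sqrt)
    then show ?thesis unfolding gpa by (simp add: a_def real_sqrt_divide field_simps diff_divide_distrib)
  qed
  have x1: "(\<lambda>N. real_of_int (x1 N) / sqrt (real N)) \<longlonglongrightarrow> c"
  proof -
    have "(\<lambda>N. real_of_int d / sqrt (real N)) \<longlonglongrightarrow> 0" by real_asymp
    then have "(\<lambda>N. real_of_int (x2 N) / sqrt (real N) + real_of_int d / sqrt (real N)) \<longlonglongrightarrow> c + 0"
      by (intro tendsto_intros x2)
    moreover have "x1 N = x2 N + d" for N using d[of N] by simp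
    ultimately show ?thesis by (simp add: add_divide_distrib)
  qed
  obtain D1 where D1: "\<And>N. \<bar>(real (n1 N) - real N) / sqrt (real N)\<bar> \<le> D1"
    using convergent_imp_Bseq[OF convergentI[OF n1]] unfolding Bseq_def by auto
  obtain D2 where D2: "\<And>N. \<bar>(real (n2 N) - real N) / sqrt (real N)\<bar> \<le> D2"
    using convergent_imp_Bseq[OF convergentI[OF n2]] unfolding Bseq_def by auto
  obtain D3 where D3: "\<And>N. \<bar>real_of_int (x1 N) / sqrt (real N)\<bar> \<le> D3"
    using convergent_imp_Bseq[OF convergentI[OF x1]] unfolding Bseq_def by auto
  obtain D4 where D4: "\<And>N. \<bar>real_of_int (x2 N) / sqrt (real N)\<bar> \<le> D4"
    using convergent_imp_Bseq[OF convergentI[OF x2]] unfolding Bseq_def by auto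
  define D where "D = 1 + D1 * sqrt gp + D2 * sqrt gp + D3 / sqrt gp + D4 / sqrt gp"
  have Dnn: "D1 \<ge> 0" "D2 \<ge> 0" "D3 \<ge> 0" "D4 \<ge> 0"
    using D1[of 0] D2[of 0] D3[of 0] D4[of 0] by auto
  then have Dpos: "D1 * sqrt gp \<ge> 0" "D2 * sqrt gp \<ge> 0" "D3 / sqrt gp \<ge> 0" "D4 / sqrt gp \<ge> 0" using sg by auto
  then have D: "D > 0" unfolding D_def by linarith
  have Dn: "\<bar>real (n1 N) * a N - gp / a N\<bar> \<le> D" "\<bar>real (n2 N) * a N - gp / a N\<bar> \<le> D" if "N \<ge> N0" for N
  proof -
    have "\<bar>(real (n1 N) - real N) / sqrt (real N)\<bar> * sqrt gp \<le> D1 * sqrt gp"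
      "\<bar>(real (n2 N) - real N) / sqrt (real N)\<bar> * sqrt gp \<le> D2 * sqrt gp"
      using D1 D2 sg by (intro mult_right_mono; simp)+
    then show "\<bar>real (n1 N) * a N - gp / a N\<bar> \<le> D" "\<bar>real (n2 N) * a N - gp / a N\<bar> \<le> D"
      unfolding na[OF that] abs_mult[of _ "sqrt gp"] using sg Dpos by (simp_all add: D_def)
  qed
  have Dx: "\<bar>of_int x\<bar> \<le> D * (gp / a N)"
    if "N \<ge> N0" "\<bar>of_int x / sqrt (real N)\<bar> \<le> D'" "D' / sqrt gp \<le> D" for x D' N
  proof -
    have sN: "sqrt (real N) > 0" using N0[OF that(1)] by simp
    have "\<bar>of_int x\<bar> \<le> D' * sqrt (real N)" using that(2) sN by (simp add: field_simps)
    also have "D' \<le> D * sqrt gp" using that(3) sg by (simp add: field_simps)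
    then have "D' * sqrt (real N) \<le> D * sqrt gp * sqrt (real N)" using sN by (intro mult_right_mono) auto
    finally show ?thesis unfolding gpa by (simp add: mult.assoc)
  qed
  have Dx1: "\<bar>of_int (x1 N)\<bar> \<le> D * (gp / a N)" if "N \<ge> N0" for N
    by (rule Dx[OF that D3]) (use Dpos in \<open>simp add: D_def\<close>)
  have Dx2: "\<bar>of_int (x2 N)\<bar> \<le> D * (gp / a N)" if "N \<ge> N0" for N
    by (rule Dx[OF that D4]) (use Dpos in \<open>simp add: D_def\<close>)
  have xb: "of_int (x2 N) = 2 * (gp / a N) * bb N" if "N \<ge> N0" for N
    unfolding gpa bb_def using N0[OF that] sg by simp
  have \<sigma>: "(\<lambda>N. (real (n1 N) - real (n2 N)) * a N) \<longlonglongrightarrow> \<sigma>"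
  proof -
    have "(\<lambda>N. ((real (n1 N) - real N) / sqrt (real N) - (real (n2 N) - real N) / sqrt (real N)) * sqrt gp)
      \<longlonglongrightarrow> \<sigma>"
      unfolding \<sigma>_def by (intro tendsto_intros n1 n2)
    moreover have "((real (n1 N) - real N) / sqrt (real N) - (real (n2 N) - real N) / sqrt (real N)) * sqrt gp = (real (n1 N)
      - real (n2 N)) * a N" for N
      by (simp add: a_def real_sqrt_divide flip: diff_divide_distrib)
    ultimately show ?thesis by simp
  qed
  define q where "q = (\<lambda>N t. arc_integrand (a N) (n1 N) (n2 N) d (wloop (- \<delta>) (bb N) t) * wloop' (- \<delta>) (bb N) t)"
  define R where "R = (\<lambda>N. LINT t:right_arc (bb N)|lborel. q N t)"
  define L where "L = (\<lambda>N. LINT t:{0..1} - right_arc (bb N)|lborel. q N t)"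
  have sh: "N + N0 \<ge> N0" for N by simp
  have sh_lim: "(\<lambda>N. f (N + N0)) \<longlonglongrightarrow> l" if "f \<longlonglongrightarrow> l" for f and l :: real
    using that by (rule LIMSEQ_ignore_initial_segment)
  have a8: "a (N + N0) \<le> 1/8" "a (N + N0) < 1 - e" for N using N0[OF sh[of N]] by auto
  have q_cont: "continuous_on {0..1} (q N)" if N: "N \<ge> N0" for N
  proof -
    have "of_real (a N) * wloop (- \<delta>) (bb N) t \<noteq> 1" for t
    proof -
      have "\<bar>- \<delta> * (cos (2 * pi * t) - bb N)\<bar> < ln 2" using \<delta>b[of t N] by simp
      then have "a N * norm (wloop (- \<delta>) (bb N) t) \<le> 1/8 * 2"
        using N0[OF N] apos[OF N] norm_wloop_bounds(2)[of "- \<delta>" t "bb N"] by (intro mult_mono) auto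
      then have "norm (of_real (a N) * wloop (- \<delta>) (bb N) t) < 1" using apos[OF N] by (simp add: norm_mult)
      then show ?thesis by auto
    qed
    then show ?thesis unfolding q_def arc_integrand_def by (intro continuous_intros) auto
  qed
  have split: "(LINT t:{0..1}|lborel. q N t) = R N + L N" if N: "N \<ge> N0" for N
  proof -
    have int: "set_integrable lborel A (q N)" if "A \<in> sets borel" "A \<subseteq> {0..1}" for A
      by (rule set_integrable_subset[OF borel_integrable_atLeastAtMost'[OF q_cont[OF N]]]) (use that in auto)
    have "right_arc (bb N) \<union> ({0..1} - right_arc (bb N)) = {0..1}" using right_arc_subset by blast
    then show ?thesis
      using set_integral_Un[of "right_arc (bb N)" "{0..1} - right_arc (bb N)" lborel "q N"] int
        right_arc_subset[of "bb N"] right_arc_sets[of "bb N"] by (simp add: R_def L_def)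
  qed
  have main: "(\<lambda>N. plancherel_kernel gp gm r e (n1 N) (x1 N) (n2 N) (x2 N) / of_real (sqrt (gp / real N) powi d)
       - 1 / (2 * of_real pi * \<i>) * (if n1 N < n2 N then - L N else R N)) \<longlonglongrightarrow> 0" (is "?f
         \<longlonglongrightarrow> 0")
  proof (rule LIMSEQ_offset)
    have "(\<lambda>N. plancherel_kernel gp gm r e (n1 (N + N0)) (x1 (N + N0)) (n2 (N + N0)) (x2 (N + N0)) / of_real (a (N + N0) powi d)
     - 1 / (2 * of_real pi * \<i>) * ((LINT t:right_arc (bb (N + N0))|lborel. q (N + N0) t)
         - (if n1 (N + N0) < n2 (N + N0) then (LINT t:{0..1}|lborel. q (N + N0) t) else 0))) \<longlonglongrightarrow> 0"
      unfolding q_def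
      by (rule kernel_asymptotics[where bb = "\<lambda>N. bb (N + N0)" and a = "\<lambda>N. a (N + N0)"
           and ?n1.0 = "\<lambda>N. n1 (N + N0)" and ?n2.0 = "\<lambda>N. n2 (N + N0)" and ?x1.0 = "\<lambda>N. x1 (N + N0)"
             and ?x2.0 = "\<lambda>N. x2 (N + N0)",
           OF gp re apos[OF sh] a8 sh_lim[OF a_lim] \<delta> \<delta>b xb[OF sh] D Dn(1)[OF sh] Dn(2)[OF sh] Dx1[OF sh] Dx2[OF sh] d])
    moreover have "(LINT t:right_arc (bb (N + N0))|lborel. q (N + N0) t)
         - (if n1 (N + N0) < n2 (N + N0) then (LINT t:{0..1}|lborel. q (N + N0) t) else 0) =
         (if n1 (N + N0) < n2 (N + N0) then - L (N + N0) else R (N + N0))" for N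
      unfolding split[OF sh] by (simp add: R_def)
    ultimately show "(\<lambda>N. ?f (N + N0)) \<longlonglongrightarrow> 0" by (simp add: a_def)
  qed
  have \<delta>b': "\<bar>- \<delta> * (cos (2 * pi * t) - bb (N + N0))\<bar> < ln 2" for N t using \<delta>b[of t "N + N0"] by simp
  have arc: "(\<lambda>N. LINT t:S (bb N)|lborel. q N t) \<longlonglongrightarrow> (LINT t:A|lborel. lim_integrand (- \<delta>) b d
    \<sigma> t)"
    if S: "\<And>y. S y \<in> sets borel" "\<And>y. S y \<subseteq> {0..1}" and A: "A \<in> sets borel"
      and ev: "AE t in lborel. eventually (\<lambda>N. t \<in> S (bb (N + N0)) \<longleftrightarrow> t \<in> A) sequentially" for S A
  proof (rule LIMSEQ_offset)
    show "(\<lambda>N. LINT t:S (bb (N + N0))|lborel. q (N + N0) t)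
      \<longlonglongrightarrow> (LINT t:A|lborel. lim_integrand (- \<delta>) b d \<sigma> t)"
      unfolding q_def lim_integrand_def
      by (rule arc_integral_tendsto[where a = "\<lambda>N. a (N + N0)" and bb = "\<lambda>N. bb (N + N0)"
        and A = "\<lambda>N. S (bb (N + N0))"
            and ?n1.0 = "\<lambda>N. n1 (N + N0)" and ?n2.0 = "\<lambda>N. n2 (N + N0)",
            OF apos[OF sh] a8(1) sh_lim[OF a_lim] _ \<delta>b' sh_lim[OF bb] sh_lim[OF \<sigma>] S A ev]) (use \<delta> in auto)
  qed
  have bN: "(\<lambda>N. bb (N + N0)) \<longlonglongrightarrow> b" by (rule sh_lim[OF bb])
  have evb: "\<forall>\<^sub>F N in sequentially. bb (N + N0) < cos (2 * pi * t) \<longleftrightarrow> b < cos (2 * pi * t)"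
    if "cos (2 * pi * t) \<noteq> b" for t
  proof (cases "b < cos (2 * pi * t)")
    case True
    from order_tendstoD(2)[OF bN this] show ?thesis by eventually_elim (use True in simp)
  next
    case False
    then have "cos (2 * pi * t) < b" using that by simp
    from order_tendstoD(1)[OF bN this] show ?thesis by eventually_elim (use False in simp)
  qed
  show ?thesis
  \<comment> \<open>The \<delta> handed over is the negative of the local one, because the arcs lie
    on the w-loop.\<close>
  proof (rule that[OF main])
    fix A :: "real set" assume A: "A \<in> sets borel"
      and AE: "AE t in lborel. t \<in> A \<longleftrightarrow> t \<in> {0..1} \<and> b < cos (2 * pi * t)"
    show "R \<longlonglongrightarrow> (LINT t:A|lborel. lim_integrand (- \<delta>) b d \<sigma> t)"
      unfolding R_def
    proof (rule arc[OF right_arc_sets right_arc_subset A])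
      show "AE t in lborel. eventually (\<lambda>N. t \<in> right_arc (bb (N + N0)) \<longleftrightarrow> t \<in> A) sequentially"
        using AE AE_cos_neq[of b]
      proof eventually_elim
        case (elim t)
        from evb[OF elim(2)] show ?case by eventually_elim (use elim in \<open>auto simp: right_arc_def\<close>)
      qed
    qed
  next
    fix A :: "real set" assume A: "A \<in> sets borel"
      and AE: "AE t in lborel. t \<in> A \<longleftrightarrow> t \<in> {0..1} \<and> cos (2 * pi * t) < b"
    show "L \<longlonglongrightarrow> (LINT t:A|lborel. lim_integrand (- \<delta>) b d \<sigma> t)"
      unfolding L_def
    proof (rule arc[OF _ _ A])
      show "{0..1} - right_arc y \<in> sets borel" "{0..1} - right_arc y \<subseteq> {0..1}" for y by auto
      show "AE t in lborel. eventually (\<lambda>N. t \<in> {0..1} - right_arc (bb (N + N0))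
        \<longleftrightarrow> t \<in> A) sequentially"
        using AE AE_cos_neq[of b]
      proof eventually_elim
        case (elim t)
        from evb[OF elim(2)] show ?case by eventually_elim (use elim in \<open>auto simp: right_arc_def\<close>)
      qed
    qed
  qed
qed

section \<open>Evaluation of the limiting arc integrals\<close>

lemma wloop_FTC:
  assumes "x \<le> y" and P: "\<And>t. t \<in> {x..y} \<Longrightarrow> (P has_field_derivative F (k * wloop \<delta> b t)) (at (k
    * wloop \<delta> b t))"
    and F: "continuous_on {x..y} (\<lambda>t. F (k * wloop \<delta> b t))"
  shows "(LINT t:{x..y}|lborel. F (k * wloop \<delta> b t) * (k * wloop' \<delta> b t)) = P (k * wloop \<delta> b y) - P (k
    * wloop \<delta> b x)"
proof -
  have hi: "((\<lambda>t. F (k * wloop \<delta> b t) * (k * wloop' \<delta> b t)) has_integral (P (k * wloop \<delta> b y) - P (k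
    * wloop \<delta> b x))) {x..y}"
  proof (rule fundamental_theorem_of_calculus[OF assms(1)])
    fix t assume t: "t \<in> {x..y}"
    have "((\<lambda>t. k * wloop \<delta> b t) has_vector_derivative k * wloop' \<delta> b t) (at t within {x..y})"
      by (intro has_vector_derivative_mult_right wloop_has_vector_derivative)
    from field_vector_diff_chain_within[OF this has_field_derivative_at_within[OF P[OF t]]]
    show "((\<lambda>t. P (k * wloop \<delta> b t)) has_vector_derivative F (k * wloop \<delta> b t) * (k
      * wloop' \<delta> b t)) (at t within {x..y})"
      by (simp add: o_def mult.commute)
  qed
  have cont: "continuous_on {x..y} (\<lambda>t. F (k * wloop \<delta> b t) * (k * wloop' \<delta> b t))"
    by (intro continuous_intros F)
  show ?thesis
    using set_borel_integral_eq_integral(2)[OF borel_integrable_atLeastAtMost'[OF cont]] integral_unique[OF hi] by simp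
qed

text \<open>For \<sigma> = 0 the form is u^(d - 1) du, which is exact on the closed loop unless d =
  0. So complementary arcs have opposite integrals for nonzero d, and for d = 0 they add up to a
  full residue.\<close>

lemma limit_integral_full:
  "(LINT t:{0..1}|lborel. lim_integrand \<delta> b d 0 t) = (if d = 0 then 2 * of_real pi * \<i> else 0)"
proof (cases "d = 0")
  case True
  have eqf: "lim_integrand \<delta> b d 0 = (\<lambda>t. 2 * of_real pi * \<i> - of_real (2 * pi * \<delta> * sin (2 * pi * t)))"
    using True by (auto simp: lim_integrand_def wloop'_def power_int_minus)
  have "((\<lambda>t. 2 * of_real pi * \<i> - of_real (2 * pi * \<delta> * sin (2 * pi * t))) has_integral
      ((2 * of_real pi * \<i> * of_real 1 + of_real (\<delta> * cos (2 * pi * 1))) - (2 * of_real pi * \<i> * of_real 0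
        + of_real (\<delta> * cos (2 * pi * 0))))) {0..1}"
  proof (rule fundamental_theorem_of_calculus)
    fix t :: real
    show "((\<lambda>t. 2 * of_real pi * \<i> * of_real t + of_real (\<delta> * cos (2 * pi * t))) has_vector_derivative
        2 * of_real pi * \<i> - of_real (2 * pi * \<delta> * sin (2 * pi * t))) (at t within {0..1})"
      by (auto intro!: derivative_eq_intros has_vector_derivative_of_real simp: algebra_simps)
  qed simp
  then have "(lim_integrand \<delta> b d 0 has_integral 2 * of_real pi * \<i>) {0..1}"
    unfolding eqf by simp
  then show ?thesis
    using set_borel_integral_eq_integral(2)[OF borel_integrable_atLeastAtMost'[OF continuous_on_lim_integrand]] True
    by (simp add: integral_unique)
next
  case False
  have eq: "lim_integrand \<delta> b d 0 t = (1 * wloop \<delta> b t) powi (d - 1) * (1 * wloop' \<delta> b t)" for t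
    by (simp add: lim_integrand_def)
  have "(LINT t:{0..1}|lborel. (1 * wloop \<delta> b t) powi (d - 1) * (1 * wloop' \<delta> b t))
      = (1 * wloop \<delta> b 1) powi d / of_int d - (1 * wloop \<delta> b 0) powi d / of_int d"
  proof (rule wloop_FTC)
    fix t
    show "((\<lambda>w. w powi d / of_int d) has_field_derivative (1 * wloop \<delta> b t) powi (d - 1)) (at (1 * wloop \<delta> b t))"
      using False by (auto intro!: derivative_eq_intros)
  qed (auto intro!: continuous_intros)
  then show ?thesis using False by (simp add: eq wloop_closed)
qed

text \<open>Either slit plane is starlike, hence has primitives. A contour admissible for S avoids
  the origin and one open half-line, so it lies in a slit plane and its integral depends on the
  endpoints alone.\<close>

lemma has_primitive_on_slit:
  assumes "S = - complex_of_real ` {..0} \<or> S = - complex_of_real ` {0..}"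
  obtains P where "\<And>u. u \<in> S \<Longrightarrow> (P has_field_derivative u powi m * exp (- of_real s * u)) (at u)"
proof -
  have S0: "0 \<notin> S" using assms by force
  have open_S: "open S" using assms closed_slot_left closed_slot_right by (auto simp: open_Compl)
  have "starlike S" using assms starlike_slotted_complex_plane_left starlike_slotted_complex_plane_right by auto
  moreover have hol: "(\<lambda>u. u powi m * exp (- of_real s * u)) holomorphic_on S"
    using S0 by (intro holomorphic_intros) auto
  ultimately have "\<exists>g. \<forall>u\<in>S. (g has_field_derivative u powi m * exp (- of_real s * u)) (at u)"
    using open_S
    by (intro holomorphic_starlike_primitive[where k = "{}"])
       (auto intro: holomorphic_on_imp_continuous_on holomorphic_on_imp_differentiable_at)
  then show ?thesis using that by blast
qed

lemma contour_integral_slit: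
  assumes P: "\<And>u. u \<in> S \<Longrightarrow> (P has_field_derivative f u) (at u)"
    and "valid_path g" "path_image g \<subseteq> S"
  shows "contour_integral g f = P (pathfinish g) - P (pathstart g)"
  by (rule contour_integral_unique, rule contour_integral_primitive)
     (use assms in \<open>auto intro: has_field_derivative_at_within\<close>)

lemma scaled_lim_integrand:
  assumes "k > 0"
  shows "lim_integrand \<delta> b d (s * k) t = of_real (k powi (- d)) *
     (((of_real k * wloop \<delta> b t) powi (d - 1) * exp (- of_real s * (of_real k * wloop \<delta> b t))) * (of_real k
       * wloop' \<delta> b t))"
proof -
  have "(of_real k :: complex) powi (d - 1) * of_real k = of_real (k powi d)"
    using assms power_int_add_1[of "of_real k :: complex" "d - 1"] by simp
  moreover have "of_real (k powi (- d)) * of_real (k powi d) = (1::complex)"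
    using assms by (simp add: power_int_minus)
  ultimately have "of_real (k powi (- d)) * ((of_real k :: complex) powi (d - 1) * of_real k) = 1" by simp
  then show ?thesis
    unfolding lim_integrand_def power_int_mult_distrib
    by (simp add: mult_ac)
qed

text \<open>The argument grows linearly in the parameter, so the real axis is met only at 1/2, on
  the negative side, and at 0 and 1, on the positive side. Thus the right arc avoids the negative
  slit and the left arc the positive one.\<close>

lemma wloop_real_cases:
  assumes "k > 0" "t \<in> {0..1}" "of_real k * wloop \<delta> b t = complex_of_real y"
  shows "t = 1/2 \<and> y < 0 \<or> (t = 0 \<or> t = 1) \<and> y > 0"
proof -
  define p where "p = k * exp (\<delta> * (cos (2 * pi * t) - b))"
  have p: "p > 0" using assms by (simp add: p_def)
  have "Re (of_real k * wloop \<delta> b t) = p * cos (2 * pi * t)" "Im (of_real k * wloop \<delta> b t) = p * sin (2 * pi * t)"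
    by (simp_all add: wloop_def unit_pt_cis p_def)
  then have y: "y = p * cos (2 * pi * t)" and s: "sin (2 * pi * t) = 0" using p by (auto simp: assms(3))
  from s obtain i :: int where i: "2 * pi * t = of_int i * pi" by (auto simp: sin_zero_iff_int2)
  then have "pi * (2 * t) = pi * of_int i" by (simp add: mult_ac)
  then have ti: "2 * t = of_int i" using mult_left_cancel[of pi "2 * t" "of_int i"] by simp
  then have "i = 0 \<or> i = 1 \<or> i = 2" using assms(2) by auto
  then consider "t = 0 \<or> t = 1" | "t = 1/2" using ti by fastforce
  then show ?thesis
  proof cases
    case 2
    have "cos (2 * pi * t) = -1" unfolding 2 by simp
    then have "y = - p" using y by simp
    then show ?thesis using 2 p by simp
  qed (use y p in auto)
qed

lemma wloop_not_neg:
  assumes "k > 0" "t \<in> {0..1}" "t \<noteq> 1/2" shows "of_real k * wloop \<delta> b t \<in> - complex_of_real ` {..0}"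
  using wloop_real_cases[OF assms(1,2)] assms(3) by fastforce

lemma wloop_not_pos:
  assumes "k > 0" "t \<in> {0<..<1}" shows "of_real k * wloop \<delta> b t \<in> - complex_of_real ` {0..}"
  using wloop_real_cases[OF assms(1), of t] assms(2) by fastforce

lemma wloop_at_level:
  assumes "cos (2 * pi * t) = b" shows "wloop \<delta> b t = cis (2 * pi * t)"
  by (simp add: wloop_def assms unit_pt_cis)

lemma cos_two_pi_one_minus: "cos (2 * pi * (1 - t)) = cos (2 * pi * t)"
  using cos_diff[of "2 * pi" "2 * pi * t"] by (simp add: right_diff_distrib)

section \<open>The two arcs joining z and its conjugate\<close>

context
  fixes b k s :: real and d :: int and z :: complex and \<tau> :: real
  assumes b: "-1 < b" "b < 1" and k: "k > 0"
    and \<tau>: "\<tau> = arccos b / (2 * pi)" and z: "z = of_real k * cis (2 * pi * \<tau>)"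
begin

lemma tau_bounds: "0 < \<tau>" "\<tau> < 1/2" and cos_tau: "cos (2 * pi * \<tau>) = b"
proof -
  have "0 < arccos b" "arccos b < pi" using arccos_lt_bounded[of b] b by auto
  then show "0 < \<tau>" "\<tau> < 1/2" by (auto simp: \<tau> field_simps)
  show "cos (2 * pi * \<tau>) = b" using b by (simp add: \<tau>)
qed

lemma cos_gt_level_iff:
  assumes "t \<in> {0..1}" shows "b < cos (2 * pi * t) \<longleftrightarrow> t < \<tau> \<or> 1 - \<tau> < t"
    and "cos (2 * pi * t) < b \<longleftrightarrow> \<tau> < t \<and> t < 1 - \<tau>"
proof -
  have half: "(b < cos (2 * pi * t) \<longleftrightarrow> t < \<tau>) \<and> (cos (2 * pi * t) < b \<longleftrightarrow> \<tau> < t)"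
    if "t \<in> {0..1/2}" for t
  proof -
    have "0 \<le> 2 * pi * t" "2 * pi * t \<le> pi" "0 \<le> 2 * pi * \<tau>" "2 * pi * \<tau> \<le> pi"
      using that tau_bounds by auto
    then show ?thesis
      using cos_mono_less_eq[of "2 * pi * t" "2 * pi * \<tau>"] cos_mono_less_eq[of "2 * pi * \<tau>" "2 * pi * t"] cos_tau by simp
  qed
  have "(b < cos (2 * pi * t) \<longleftrightarrow> t < \<tau> \<or> 1 - \<tau> < t) \<and> (cos (2 * pi * t) < b
    \<longleftrightarrow> \<tau> < t \<and> t < 1 - \<tau>)"
  proof (cases "t \<le> 1/2")
    case True
    then show ?thesis using half[of t] assms tau_bounds by auto
  next
    case False
    then show ?thesis using half[of "1 - t"] assms tau_bounds cos_two_pi_one_minus[of t] by auto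
  qed
  then show "b < cos (2 * pi * t) \<longleftrightarrow> t < \<tau> \<or> 1 - \<tau> < t" "cos (2 * pi * t) < b
    \<longleftrightarrow> \<tau> < t \<and> t < 1 - \<tau>" by auto
qed

lemma wloop_endpoints: "of_real k * wloop \<delta> b \<tau> = z" "of_real k * wloop \<delta> b (1 - \<tau>) = cnj z"
proof -
  show "of_real k * wloop \<delta> b \<tau> = z" by (simp add: wloop_at_level[OF cos_tau] z)
  have "cos (2 * pi * (1 - \<tau>)) = b" by (simp only: cos_two_pi_one_minus cos_tau)
  moreover have "cis (2 * pi * (1 - \<tau>)) = cis (- (2 * pi * \<tau>))"
    by (simp add: complex_eq_iff right_diff_distrib cos_diff sin_diff)
  ultimately show "of_real k * wloop \<delta> b (1 - \<tau>) = cnj z"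
    by (simp only: wloop_at_level z) (simp add: cis_cnj)
qed

text \<open>The arc runs from \<open>cnj z\<close> at 1 - \<tau> across the positive axis, where the
  parameter jumps from 1 to 0, to z at \<tau>. It is cut there, and the values of the primitive at
  the cut cancel.\<close>

lemma right_arc_limit:
  assumes g: "S_contour z s g" "s \<ge> 0"
  shows "(LINT t:{0..\<tau>} \<union> {1-\<tau>..1}|lborel. lim_integrand \<delta> b d (s * k) t)
     = of_real (k powi (- d)) * contour_integral g (\<lambda>u. u powi (d - 1) * exp (- of_real s * u))"
proof -
  define F where "F = (\<lambda>u::complex. u powi (d - 1) * exp (- of_real s * u))"
  obtain P where P: "\<And>u. u \<in> - complex_of_real ` {..0} \<Longrightarrow> (P has_field_derivative F u) (at u)"
    unfolding F_def using has_primitive_on_slit[of "- complex_of_real ` {..0}"] by blast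
  have li: "lim_integrand \<delta> b d (s * k) t = of_real (k powi (- d)) * (F (of_real k * wloop \<delta> b t) * (of_real k
    * wloop' \<delta> b t))" for t
    unfolding F_def by (rule scaled_lim_integrand[OF k])
  have cF: "continuous_on A (\<lambda>t. F (of_real k * wloop \<delta> b t))" for A
    unfolding F_def using k by (intro continuous_intros) auto
  have piece: "(LINT t:{x..y}|lborel. lim_integrand \<delta> b d (s * k) t)
      = of_real (k powi (- d)) * (P (of_real k * wloop \<delta> b y) - P (of_real k * wloop \<delta> b x))"
    if "x \<le> y" "{x..y} \<subseteq> {0..1}" "1/2 \<notin> {x..y}" for x y
  proof -
    have "(LINT t:{x..y}|lborel. F (of_real k * wloop \<delta> b t) * (of_real k * wloop' \<delta> b t))
       = P (of_real k * wloop \<delta> b y) - P (of_real k * wloop \<delta> b x)"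
    proof (rule wloop_FTC[OF that(1) _ cF])
      fix t assume t: "t \<in> {x..y}"
      have "of_real k * wloop \<delta> b t \<in> - complex_of_real ` {..0}"
        by (rule wloop_not_neg[OF k]) (use that t in auto)
      then show "(P has_field_derivative F (of_real k * wloop \<delta> b t)) (at (of_real k * wloop \<delta> b t))" by (rule P)
    qed
    then show ?thesis unfolding li by simp
  qed
  have "(LINT t:{0..\<tau>} \<union> {1-\<tau>..1}|lborel. lim_integrand \<delta> b d (s * k) t) =
     (LINT t:{0..\<tau>}|lborel. lim_integrand \<delta> b d (s * k) t) + (LINT t:{1-\<tau>..1}|lborel. lim_integrand \<delta> b d (s
       * k) t)"
    by (rule set_integral_Un) (use tau_bounds in \<open>auto intro!: set_integrable_lim_integrand\<close>)
  also have "\<dots> = of_real (k powi (- d)) * (P z - P (cnj z))"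
  proof -
    have p: "(LINT t:{0..\<tau>}|lborel. lim_integrand \<delta> b d (s * k) t)
        = of_real (k powi (- d)) * (P (of_real k * wloop \<delta> b \<tau>) - P (of_real k * wloop \<delta> b 0))"
      "(LINT t:{1-\<tau>..1}|lborel. lim_integrand \<delta> b d (s * k) t)
        = of_real (k powi (- d)) * (P (of_real k * wloop \<delta> b 1) - P (of_real k * wloop \<delta> b (1 - \<tau>)))"
      using tau_bounds by (intro piece; simp)+
    show ?thesis unfolding p wloop_endpoints wloop_closed by (simp add: algebra_simps)
  qed
  also have "P z - P (cnj z) = contour_integral g F"
  proof -
    have "path_image g \<subseteq> - complex_of_real ` {..0}"
    proof -
      have "complex_of_real ` {..0} = insert 0 (complex_of_real ` {..<0})" by (auto simp: image_iff)
      then show ?thesis using g by (auto simp: S_contour_def)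
    qed
    then show ?thesis
      using contour_integral_slit[where S = "- complex_of_real ` {..0}" and g = g, OF P] g by (simp add: S_contour_def)
  qed
  finally show ?thesis by (simp add: F_def)
qed

text \<open>As the parameter grows this arc runs from z to \<open>cnj z\<close>, opposite to g. The
  resulting minus sign cancels the one carried by entries with n1 < n2.\<close>

lemma left_arc_limit:
  assumes g: "S_contour z s g" "s < 0"
  shows "(LINT t:{\<tau>..1-\<tau>}|lborel. lim_integrand \<delta> b d (s * k) t)
     = - (of_real (k powi (- d)) * contour_integral g (\<lambda>u. u powi (d - 1) * exp (- of_real s * u)))"
proof -
  define F where "F = (\<lambda>u::complex. u powi (d - 1) * exp (- of_real s * u))"
  obtain P where P: "\<And>u. u \<in> - complex_of_real ` {0..} \<Longrightarrow> (P has_field_derivative F u) (at u)"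
    unfolding F_def using has_primitive_on_slit[of "- complex_of_real ` {0..}"] by blast
  have li: "lim_integrand \<delta> b d (s * k) t = of_real (k powi (- d)) * (F (of_real k * wloop \<delta> b t) * (of_real k
    * wloop' \<delta> b t))" for t
    unfolding F_def by (rule scaled_lim_integrand[OF k])
  have cF: "continuous_on A (\<lambda>t. F (of_real k * wloop \<delta> b t))" for A
    unfolding F_def using k by (intro continuous_intros) auto
  have "(LINT t:{\<tau>..1-\<tau>}|lborel. F (of_real k * wloop \<delta> b t) * (of_real k * wloop' \<delta> b t))
       = P (of_real k * wloop \<delta> b (1-\<tau>)) - P (of_real k * wloop \<delta> b \<tau>)"
  proof (rule wloop_FTC[OF _ _ cF])
    fix t assume t: "t \<in> {\<tau>..1-\<tau>}"
    have "of_real k * wloop \<delta> b t \<in> - complex_of_real ` {0..}"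
      by (rule wloop_not_pos[OF k]) (use tau_bounds t in auto)
    then show "(P has_field_derivative F (of_real k * wloop \<delta> b t)) (at (of_real k * wloop \<delta> b t))" by (rule P)
  qed (use tau_bounds in simp)
  also have "\<dots> = - (P z - P (cnj z))" by (simp add: wloop_endpoints)
  also have "P z - P (cnj z) = contour_integral g F"
  proof -
    have "path_image g \<subseteq> - complex_of_real ` {0..}"
    proof -
      have "complex_of_real ` {0..} = insert 0 (complex_of_real ` {0<..})" by (auto simp: image_iff)
      then show ?thesis using g by (auto simp: S_contour_def)
    qed
    then show ?thesis
      using contour_integral_slit[where S = "- complex_of_real ` {0..}" and g = g, OF P] g by (simp add: S_contour_def)
  qed
  finally show ?thesis by (simp add: F_def li)
qed

end

text \<open>In this range the roots of z^2 - c z + gp are conjugate, with modulus sqrt gp and real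
  part c / 2. So \<open>z_plus gp c\<close> divided by sqrt gp is the point of the unit circle in
  the upper half-plane at which the limiting loops cross.\<close>

lemma z_plus_polar:
  assumes gp: "gp > 0" and c: "- 2 * sqrt gp < c" "c < 2 * sqrt gp"
  shows "z_plus gp c = of_real (sqrt gp) * cis (arccos (c / (2 * sqrt gp)))"
proof -
  define b where "b = c / (2 * sqrt gp)"
  have sg: "sqrt gp > 0" using gp by simp
  have b: "-1 < b" "b < 1" using c sg by (auto simp: b_def field_simps)
  have cb: "c = 2 * sqrt gp * b" using sg by (simp add: b_def)
  have c2: "c\<^sup>2 - 4 * gp = - (4 * gp * (1 - b\<^sup>2))"
    using gp by (simp add: cb power_mult_distrib algebra_simps)
  have "b\<^sup>2 \<le> 1" using b by (simp add: abs_square_le_1)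
  then have nonneg: "0 \<le> 4 * gp * (1 - b\<^sup>2)" using gp by simp
  have "csqrt (of_real (c\<^sup>2 - 4 * gp)) = \<i> * of_real (sqrt (4 * gp * (1 - b\<^sup>2)))"
    unfolding c2 using nonneg by simp
  also have "sqrt (4 * gp * (1 - b\<^sup>2)) = 2 * sqrt gp * sqrt (1 - b\<^sup>2)"
    by (simp add: real_sqrt_mult)
  finally have "z_plus gp c = of_real (sqrt gp) * (of_real b + \<i> * of_real (sqrt (1 - b\<^sup>2)))"
    by (simp add: z_plus_def cb algebra_simps)
  also have "of_real b + \<i> * of_real (sqrt (1 - b\<^sup>2)) = cis (arccos b)"
    using b by (simp add: complex_eq_iff sin_arccos)
  finally show ?thesis by (simp add: b_def)
qed

lemma Bseq_if_near_bounded: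
  fixes f g :: "nat \<Rightarrow> complex"
  assumes "(\<lambda>N. f N - g N) \<longlonglongrightarrow> 0" "Bseq g" shows "Bseq f"
proof -
  obtain K1 K2 where K: "\<And>N. norm (f N - g N) \<le> K1" "\<And>N. norm (g N) \<le> K2"
    using convergent_imp_Bseq[OF convergentI[OF assms(1)]] assms(2) unfolding Bseq_def by auto
  have "norm (f N) \<le> K1 + K2" for N
    using K[of N] norm_triangle_ineq[of "f N - g N" "g N"] by simp
  then show ?thesis by (rule BseqI')
qed

lemma Bseq_if:
  fixes f g :: "nat \<Rightarrow> complex"
  assumes "Bseq f" "Bseq g" shows "Bseq (\<lambda>N. c * (if P N then - f N else g N))"
proof -
  obtain K1 K2 where K: "\<And>N. norm (f N) \<le> K1" "\<And>N. norm (g N) \<le> K2"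
    using assms unfolding Bseq_def by auto
  show ?thesis
  proof (rule BseqI')
    fix N
    have "norm (if P N then - f N else g N) \<le> max K1 K2" using K[of N] by auto
    then show "norm (c * (if P N then - f N else g N)) \<le> norm c * max K1 K2"
      unfolding norm_mult by (intro mult_left_mono) auto
  qed
qed

subsection \<open>The determinant\<close>

text \<open>Along any permutation p the product of the ratios f i / f (p i) is 1.\<close>

lemma det_diag_conjugate:
  fixes A :: "'k::finite \<Rightarrow> 'k \<Rightarrow> complex"
  assumes "\<And>i. f i \<noteq> 0"
  shows "det (\<chi> i j. A i j / (f i / f j) :: complex ^ 'k ^ 'k) = det (\<chi> i j. A i j)"
proof -
  have "(\<Prod>i\<in>UNIV. A i (p i) / (f i / f (p i))) = (\<Prod>i\<in>UNIV. A i (p i))" if p: "p permutes UNIV" for p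
  proof -
    have "(\<Prod>i\<in>UNIV. f (p i)) = (\<Prod>i\<in>UNIV. f i)"
      by (rule prod.reindex_bij_betw) (use p in \<open>simp add: permutes_imp_bij\<close>)
    moreover have "(\<Prod>i\<in>UNIV. f i) \<noteq> 0" using assms by simp
    ultimately show ?thesis by (simp add: prod_dividef prod.distrib)
  qed
  then show ?thesis unfolding det_def by (intro sum.cong) auto
qed

text \<open>The index of the small factor may change with N. The product is therefore compared with
  the sum of all factors, each truncated to those N at which P marks it.\<close>

lemma prod_tendsto_zero:
  fixes E :: "nat \<Rightarrow> 'k::finite \<Rightarrow> complex"
  assumes bd: "\<And>i. Bseq (\<lambda>N. E N i)"
    and small: "\<And>i. (\<lambda>N. if P N i then E N i else 0) \<longlonglongrightarrow> 0"
    and ex: "\<forall>\<^sub>F N in sequentially. \<exists>i. P N i"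
  shows "(\<lambda>N. \<Prod>i\<in>UNIV. E N i) \<longlonglongrightarrow> 0"
proof -
  have "\<forall>i. \<exists>B. \<forall>N. norm (E N i) \<le> B" using bd unfolding Bseq_def by blast
  then obtain B where B: "\<And>i N. norm (E N i) \<le> B i" by metis
  \<comment> \<open>Bounds of at least 1 are taken, so that the product over all indices also bounds
    the product with one index omitted.\<close>
  define M where "M = (\<Prod>i\<in>UNIV. 1 + B i)"
  have B0: "B i \<ge> 0" for i using B[of 0 i] norm_ge_zero order_trans by blast
  have bound: "norm (\<Prod>i\<in>UNIV. E N i) \<le> M * (\<Sum>i\<in>UNIV. norm (if P N i then E N i else 0))" if "P N k" for N k
  proof -
    have "norm (\<Prod>i\<in>UNIV. E N i) = norm (E N k) * (\<Prod>i\<in>UNIV-{k}. norm (E N i))"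
      by (simp add: prod.remove[of UNIV k] norm_mult prod_norm[symmetric])
    also have "\<dots> \<le> norm (E N k) * (\<Prod>i\<in>UNIV-{k}. 1 + B i)"
      using B by (intro mult_left_mono prod_mono) (auto intro: order_trans[OF B])
    also have "\<dots> \<le> norm (E N k) * M"
    proof (rule mult_left_mono)
      have "1 * (\<Prod>i\<in>UNIV-{k}. 1 + B i) \<le> (1 + B k) * (\<Prod>i\<in>UNIV-{k}. 1 + B i)"
        using B0 by (intro mult_right_mono prod_nonneg) (auto intro: add_nonneg_nonneg)
      then show "(\<Prod>i\<in>UNIV-{k}. 1 + B i) \<le> M" unfolding M_def by (simp add: prod.remove[of UNIV k])
    qed simp
    also have "norm (E N k) \<le> (\<Sum>i\<in>UNIV. norm (if P N i then E N i else 0))"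
      using that member_le_sum[of k UNIV "\<lambda>i. norm (if P N i then E N i else 0)"] by simp
    finally show ?thesis
      using B0 by (simp add: M_def prod_nonneg add_nonneg_nonneg mult_right_mono mult.commute)
  qed
  have "(\<lambda>N. M * (\<Sum>i\<in>UNIV. norm (if P N i then E N i else 0))) \<longlonglongrightarrow> M
    * (\<Sum>i\<in>(UNIV::'k set). 0)"
    by (intro tendsto_mult_left tendsto_sum tendsto_norm_zero small)
  then have "(\<lambda>N. M * (\<Sum>i\<in>UNIV. norm (if P N i then E N i else 0))) \<longlonglongrightarrow> 0" by simp
  then show ?thesis
    by (rule Lim_null_comparison[rotated]) (use ex in \<open>eventually_elim, auto intro: bound\<close>)
qed

lemma det_tendsto:
  fixes E :: "nat \<Rightarrow> 'k::finite \<Rightarrow> 'k \<Rightarrow> complex"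
  assumes "\<And>p. p permutes (UNIV :: 'k set) \<Longrightarrow> (\<lambda>N. \<Prod>i\<in>UNIV. E N i (p i))
    \<longlonglongrightarrow> l p"
  shows "(\<lambda>N. det (\<chi> i j. E N i j :: complex ^ 'k ^ 'k))
    \<longlonglongrightarrow> (\<Sum>p | p permutes (UNIV :: 'k set). of_int (sign p) * l p)"
  unfolding det_def by (auto intro!: tendsto_sum tendsto_mult_left assms)

section \<open>The entries in the three ranges of c\<close>

context
  fixes gp gm r e c :: real and n1 n2 :: "nat \<Rightarrow> nat" and x1 x2 :: "nat \<Rightarrow> int" and d :: int and t1 t2 :: real
    and E :: "nat \<Rightarrow> complex"
  assumes gp: "gp > 0" "gm > 0" and re: "0 < r" "0 < e" "e < 1 - r"
    and d: "\<And>N. x1 N - x2 N = d"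
    and n1: "(\<lambda>N. (real (n1 N) - real N) / sqrt (real N)) \<longlonglongrightarrow> t1"
    and n2: "(\<lambda>N. (real (n2 N) - real N) / sqrt (real N)) \<longlonglongrightarrow> t2"
    and x2: "(\<lambda>N. real_of_int (x2 N) / sqrt (real N)) \<longlonglongrightarrow> c"
    and E: "\<And>N. E N = plancherel_kernel gp gm r e (n1 N) (x1 N) (n2 N) (x2 N) / of_real (sqrt (gp / real N) powi d)"
begin

text \<open>Here b >= 1, so the limiting right arc is empty. Entries with n1 < n2 use the left arc,
  which becomes almost the whole loop; for them only boundedness is kept.\<close>

lemma entry_limit_right:
  assumes c: "c \<ge> 2 * sqrt gp"
  shows "Bseq E" "(\<lambda>N. if n2 N \<le> n1 N then E N else 0) \<longlonglongrightarrow> 0"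
proof -
  define \<sigma> where "\<sigma> = (t1 - t2) * sqrt gp"
  define b where "b = c / (2 * sqrt gp)"
  define c0 :: complex where "c0 = 1 / (2 * of_real pi * \<i>)"
  have b: "b \<ge> 1" using c gp by (simp add: b_def field_simps)
  obtain R L \<delta> where lim: "(\<lambda>N. E N - c0 * (if n1 N < n2 N then - L N else R N)) \<longlonglongrightarrow> 0"
    and R: "\<And>A. A \<in> sets borel \<Longrightarrow> (AE t in lborel. t \<in> A \<longleftrightarrow> t \<in> {0..1}
      \<and> b < cos (2 * pi * t)) \<Longrightarrow>
        R \<longlonglongrightarrow> (LINT t:A|lborel. lim_integrand \<delta> b d \<sigma> t)"
    and L: "\<And>A. A \<in> sets borel \<Longrightarrow> (AE t in lborel. t \<in> A \<longleftrightarrow> t \<in> {0..1} \<and> cos (2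
      * pi * t) < b) \<Longrightarrow>
        L \<longlonglongrightarrow> (LINT t:A|lborel. lim_integrand \<delta> b d \<sigma> t)"
    by (rule kernel_entry_limit[OF gp re d n1 n2 x2, folded E, folded \<sigma>_def b_def c0_def]) (rule that)
  have le: "cos (2 * pi * t) \<le> b" for t using cos_le_one[of "2 * pi * t"] b by linarith
  have lt: "\<not> b < cos (2 * pi * t)" for t using le[of t] by linarith
  have R0: "R \<longlonglongrightarrow> 0" using R[of "{}"] lt by (simp add: set_lebesgue_integral_def)
  have "AE t in lborel. t \<in> {0..1} \<longleftrightarrow> t \<in> {0..1} \<and> cos (2 * pi * t) < b"
    using AE_cos_neq[of b] by eventually_elim (use le in \<open>auto simp: less_le\<close>)
  then have "convergent L" using L[of "{0..1}"] convergentI by auto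
  then have BL: "Bseq L" by (rule convergent_imp_Bseq)
  have BR: "Bseq R" using R0 convergentI convergent_imp_Bseq by blast
  show "Bseq E"
    by (rule Bseq_if_near_bounded[OF lim Bseq_if])  (fact BL BR)+
  have "(\<lambda>N. norm (E N - c0 * (if n1 N < n2 N then - L N else R N)) + norm (c0 * R N)) \<longlonglongrightarrow> 0 + 0"
    by (intro tendsto_add tendsto_norm_zero lim tendsto_mult_right_zero R0)
  then show "(\<lambda>N. if n2 N \<le> n1 N then E N else 0) \<longlonglongrightarrow> 0"
  proof (rule Lim_null_comparison[rotated, OF tendsto_eq_rhs])
    show "\<forall>\<^sub>F N in sequentially. norm (if n2 N \<le> n1 N then E N else 0) \<le>
       norm (E N - c0 * (if n1 N < n2 N then - L N else R N)) + norm (c0 * R N)"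
      using norm_triangle_sub by (intro always_eventually) (auto simp: add.commute)
  qed simp
qed

text \<open>Here b <= -1, so the left arc disappears and R tends to the integral over the whole
  loop. For t1 = t2 that is 0 or a full residue, according to d; for different t1 and t2 only
  boundedness is kept when n1 >= n2.\<close>

lemma entry_limit_left:
  assumes c: "c \<le> - 2 * sqrt gp"
  shows "Bseq E" "(\<lambda>N. if n1 N < n2 N \<or> t1 = t2 \<and> d \<noteq> 0 then E N else 0) \<longlonglongrightarrow> 0"
    "n1 = n2 \<Longrightarrow> d = 0 \<Longrightarrow> E \<longlonglongrightarrow> 1"
proof -
  define \<sigma> where "\<sigma> = (t1 - t2) * sqrt gp"
  define b where "b = c / (2 * sqrt gp)"
  define c0 :: complex where "c0 = 1 / (2 * of_real pi * \<i>)"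
  have b: "b \<le> -1" using c gp by (simp add: b_def field_simps)
  obtain R L \<delta> where lim: "(\<lambda>N. E N - c0 * (if n1 N < n2 N then - L N else R N)) \<longlonglongrightarrow> 0"
    and R: "\<And>A. A \<in> sets borel \<Longrightarrow> (AE t in lborel. t \<in> A \<longleftrightarrow> t \<in> {0..1}
      \<and> b < cos (2 * pi * t)) \<Longrightarrow>
        R \<longlonglongrightarrow> (LINT t:A|lborel. lim_integrand \<delta> b d \<sigma> t)"
    and L: "\<And>A. A \<in> sets borel \<Longrightarrow> (AE t in lborel. t \<in> A \<longleftrightarrow> t \<in> {0..1} \<and> cos (2
      * pi * t) < b) \<Longrightarrow>
        L \<longlonglongrightarrow> (LINT t:A|lborel. lim_integrand \<delta> b d \<sigma> t)"
    by (rule kernel_entry_limit[OF gp re d n1 n2 x2, folded E, folded \<sigma>_def b_def c0_def]) (rule that)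
  have le: "b \<le> cos (2 * pi * t)" for t using cos_ge_minus_one[of "2 * pi * t"] b by linarith
  have lt: "\<not> cos (2 * pi * t) < b" for t using le[of t] by linarith
  have L0: "L \<longlonglongrightarrow> 0" using L[of "{}"] lt by (simp add: set_lebesgue_integral_def)
  have "AE t in lborel. t \<in> {0..1} \<longleftrightarrow> t \<in> {0..1} \<and> b < cos (2 * pi * t)"
    using AE_cos_neq[of b] by eventually_elim (use le in \<open>auto simp: less_le\<close>)
  then have R1: "R \<longlonglongrightarrow> (LINT t:{0..1}|lborel. lim_integrand \<delta> b d \<sigma> t)" using R[of "{0..1}"] by simp
  have R2: "R \<longlonglongrightarrow> (if d = 0 then 2 * of_real pi * \<i> else 0)" if "t1 = t2"
    using R1 that limit_integral_full[of \<delta> b d] by (simp add: \<sigma>_def)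
  have BL: "Bseq L" and BR: "Bseq R" using L0 R1 convergentI convergent_imp_Bseq by blast+
  show "Bseq E"
    by (rule Bseq_if_near_bounded[OF lim Bseq_if])  (fact BL BR)+
  \<comment> \<open>This keeps R only in the case where it tends to 0, so that one majorant serves
    both disjuncts.\<close>
  define R' where "R' = (\<lambda>N. if t1 = t2 \<and> d \<noteq> 0 then R N else 0)"
  have R': "R' \<longlonglongrightarrow> 0" unfolding R'_def using R2 by (cases "t1 = t2 \<and> d \<noteq> 0") auto
  have "(\<lambda>N. norm (E N - c0 * (if n1 N < n2 N then - L N else R N)) + norm (c0 * L N) + norm (c0 * R' N))
    \<longlonglongrightarrow> 0 + 0 + 0"
    by (intro tendsto_add tendsto_norm_zero lim tendsto_mult_right_zero L0 R')
  then show "(\<lambda>N. if n1 N < n2 N \<or> t1 = t2 \<and> d \<noteq> 0 then E N else 0) \<longlonglongrightarrow> 0"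
  proof (rule Lim_null_comparison[rotated, OF tendsto_eq_rhs])
    show "\<forall>\<^sub>F N in sequentially. norm (if n1 N < n2 N \<or> t1 = t2 \<and> d \<noteq> 0 then E N else 0) \<le>
       norm (E N - c0 * (if n1 N < n2 N then - L N else R N)) + norm (c0 * L N) + norm (c0 * R' N)"
    proof (intro always_eventually allI)
      fix N
      show "norm (if n1 N < n2 N \<or> t1 = t2 \<and> d \<noteq> 0 then E N else 0) \<le>
       norm (E N - c0 * (if n1 N < n2 N then - L N else R N)) + norm (c0 * L N) + norm (c0 * R' N)"
        using norm_triangle_sub[of "E N" "c0 * (if n1 N < n2 N then - L N else R N)"]
          norm_ge_zero[of "c0 * L N"] norm_ge_zero[of "c0 * R' N"]
          norm_ge_zero[of "E N - c0 * (if n1 N < n2 N then - L N else R N)"]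
        by (auto simp: R'_def simp del: norm_ge_zero)
    qed
  qed simp
  show "E \<longlonglongrightarrow> 1" if eq: "n1 = n2" "d = 0"
  proof -
    have "t1 = t2" using n1 n2 LIMSEQ_unique unfolding eq(1) by blast
    then have "R \<longlonglongrightarrow> 2 * of_real pi * \<i>" using R2 eq by simp
    then have "(\<lambda>N. (E N - c0 * (if n1 N < n2 N then - L N else R N)) + c0 * R N) \<longlonglongrightarrow> 0 + c0 * (2
      * of_real pi * \<i>)"
      by (intro tendsto_add lim tendsto_mult_left)
    then show ?thesis by (simp add: eq c0_def)
  qed
qed

text \<open>For different t1 and t2 the sign of t1 - t2 eventually decides the arc, in agreement
  with \<open>S_contour\<close>. For t1 = t2 the sign of n1 - n2 may keep changing: with nonzero d
  both arcs give the same limit, but with d = 0 the two limits differ by 1, and \<open>ev\<close>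
  settles the choice.\<close>

lemma entry_limit_bulk:
  assumes c: "- 2 * sqrt gp < c" "c < 2 * sqrt gp"
    and ev: "t1 = t2 \<Longrightarrow> d = 0 \<Longrightarrow> \<forall>\<^sub>F N in sequentially. n1 N = n2 N"
    and g: "S_contour (z_plus gp c) (t1 - t2) g"
  shows "E \<longlonglongrightarrow> S_kernel g (t1 - t2) d / of_real (sqrt gp powi d)"
proof -
  define k where "k = sqrt gp"
  define \<sigma> where "\<sigma> = (t1 - t2) * k"
  define b where "b = c / (2 * k)"
  define c0 :: complex where "c0 = 1 / (2 * of_real pi * \<i>)"
  define \<tau> where "\<tau> = arccos b / (2 * pi)"
  have k: "k > 0" using gp by (simp add: k_def)
  have b: "-1 < b" "b < 1" using c k by (auto simp: b_def k_def[symmetric] field_simps)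
  have z: "z_plus gp c = of_real k * cis (2 * pi * \<tau>)"
    using z_plus_polar[OF gp(1) c] by (simp add: k_def b_def \<tau>_def)
  obtain R L \<delta> where lim: "(\<lambda>N. E N - c0 * (if n1 N < n2 N then - L N else R N)) \<longlonglongrightarrow> 0"
    and R: "\<And>A. A \<in> sets borel \<Longrightarrow> (AE t in lborel. t \<in> A \<longleftrightarrow> t \<in> {0..1}
      \<and> b < cos (2 * pi * t)) \<Longrightarrow>
        R \<longlonglongrightarrow> (LINT t:A|lborel. lim_integrand \<delta> b d \<sigma> t)"
    and L: "\<And>A. A \<in> sets borel \<Longrightarrow> (AE t in lborel. t \<in> A \<longleftrightarrow> t \<in> {0..1} \<and> cos (2
      * pi * t) < b) \<Longrightarrow>
        L \<longlonglongrightarrow> (LINT t:A|lborel. lim_integrand \<delta> b d \<sigma> t)"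
    by (rule kernel_entry_limit[OF gp re d n1 n2 x2, folded E, folded k_def, folded \<sigma>_def b_def c0_def]) (rule that)
  define A1 where "A1 = {0..\<tau>} \<union> {1-\<tau>..1}"
  define A2 where "A2 = {\<tau>..1-\<tau>}"
  note tb = tau_bounds[OF b k \<tau>_def z] cos_tau[OF b k \<tau>_def z]
  have lev: "cos (2 * pi * t) \<noteq> b \<Longrightarrow> t \<noteq> \<tau> \<and> t \<noteq> 1 - \<tau>" for t
    using tb(3) cos_two_pi_one_minus[of \<tau>] by auto
  have "AE t in lborel. t \<in> A1 \<longleftrightarrow> t \<in> {0..1} \<and> b < cos (2 * pi * t)"
    using AE_cos_neq[of b]
  proof eventually_elim
    case (elim t)
    show ?case using cos_gt_level_iff(1)[OF b k \<tau>_def z, of t] lev[OF elim] tb(1,2) unfolding A1_def by auto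
  qed
  then have R1: "R \<longlonglongrightarrow> (LINT t:A1|lborel. lim_integrand \<delta> b d \<sigma> t)"
    by (rule R[rotated]) (simp add: A1_def)
  have "AE t in lborel. t \<in> A2 \<longleftrightarrow> t \<in> {0..1} \<and> cos (2 * pi * t) < b"
    using AE_cos_neq[of b]
  proof eventually_elim
    case (elim t)
    show ?case using cos_gt_level_iff(2)[OF b k \<tau>_def z, of t] lev[OF elim] tb(1,2) unfolding A2_def by auto
  qed
  then have L1: "L \<longlonglongrightarrow> (LINT t:A2|lborel. lim_integrand \<delta> b d \<sigma> t)"
    by (rule L[rotated]) (simp add: A2_def)
  define I where "I = contour_integral g (\<lambda>u. u powi (d - 1) * exp (- of_real (t1 - t2) * u))"
  define T where "T = of_real (k powi (- d)) * I"
  have target: "S_kernel g (t1 - t2) d / of_real (sqrt gp powi d) = c0 * T"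
  proof -
    have "of_real (k powi (- d)) = inverse (of_real (k powi d) :: complex)" by (simp add: power_int_minus)
    then show ?thesis
      unfolding S_kernel_def c0_def[symmetric] I_def[symmetric] k_def[symmetric] T_def by (simp add: divide_inverse)
  qed
  have "(\<lambda>N. (if n1 N < n2 N then - L N else R N) - T) \<longlonglongrightarrow> 0"
  proof (cases "t1 \<ge> t2")
    case True
    have "(LINT t:A1|lborel. lim_integrand \<delta> b d \<sigma> t) = T"
      unfolding A1_def \<sigma>_def T_def I_def by (rule right_arc_limit[OF b k \<tau>_def z g]) (use True in simp)
    then have RT: "R \<longlonglongrightarrow> T" using R1 by simp
    show ?thesis
    proof (cases "t1 = t2 \<and> d \<noteq> 0")
      case False
      have "\<forall>\<^sub>F N in sequentially. \<not> n1 N < n2 N"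
      proof (cases "t1 = t2")
        case True
        then have "\<forall>\<^sub>F N in sequentially. n1 N = n2 N" using ev False by simp
        then show ?thesis by eventually_elim simp
      next
        case neq: False
        then have "0 < t1 - t2" using True by simp
        from order_tendstoD(1)[OF tendsto_diff[OF n1 n2] this]
        show ?thesis
        proof eventually_elim
          case (elim N)
          then show ?case using divide_right_mono[of "real (n1 N) - real N" "real (n2 N) - real N" "sqrt (real N)"] by auto
        qed
      qed
      then have "\<forall>\<^sub>F N in sequentially. (if n1 N < n2 N then - L N else R N) - T = R N - T" by eventually_elim simp
      moreover have "(\<lambda>N. R N - T) \<longlonglongrightarrow> 0" using RT LIM_zero by blast
      ultimately show ?thesis using tendsto_cong by fastforce
    next
      case eq: True
      \<comment> \<open>The integral over the whole loop vanishes here, so minus the left arc equals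
        the right arc and either may represent the entry.\<close>
      have "(LINT t:A1 \<union> A2|lborel. lim_integrand \<delta> b d \<sigma> t)
        = (LINT t:A1|lborel. lim_integrand \<delta> b d \<sigma> t) + (LINT t:A2|lborel. lim_integrand \<delta> b d \<sigma> t)"
      proof (rule set_integral_Un_AE)
        show "AE t in lborel. \<not> (t \<in> A1 \<and> t \<in> A2)"
          using AE_cos_neq[of b] by eventually_elim (use lev tb in \<open>force simp: A1_def A2_def\<close>)
        show "set_integrable lborel A1 (lim_integrand \<delta> b d \<sigma>)" "set_integrable lborel A2 (lim_integrand \<delta> b d
          \<sigma>)"
          by (rule set_integrable_lim_integrand; use tb in \<open>auto simp: A1_def A2_def\<close>)+
      qed (auto simp: A1_def A2_def)
      moreover have "A1 \<union> A2 = {0..1}" using tb by (auto simp: A1_def A2_def)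
      ultimately have "(LINT t:A2|lborel. lim_integrand \<delta> b d \<sigma> t) = - T"
        using limit_integral_full[of \<delta> b d] eq \<open>(LINT t:A1|lborel. lim_integrand \<delta> b d \<sigma> t) = T\<close>
        by (simp add: \<sigma>_def add_eq_0_iff)
      then have LT: "(\<lambda>N. - L N) \<longlonglongrightarrow> T" using tendsto_minus[OF L1] by simp
      have "(\<lambda>N. norm (- L N - T) + norm (R N - T)) \<longlonglongrightarrow> 0 + 0"
        using LT RT by (intro tendsto_add tendsto_norm_zero) (auto intro: LIM_zero)
      then have "(\<lambda>N. norm (- L N - T) + norm (R N - T)) \<longlonglongrightarrow> 0" by simp
      then show ?thesis
        by (rule Lim_null_comparison[rotated]) (intro always_eventually allI, simp)
    qed
  next
    case False
    have "(LINT t:A2|lborel. lim_integrand \<delta> b d \<sigma> t) = - T"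
      unfolding A2_def \<sigma>_def T_def I_def by (rule left_arc_limit[OF b k \<tau>_def z g]) (use False in simp)
    then have LT: "(\<lambda>N. - L N) \<longlonglongrightarrow> T" using tendsto_minus[OF L1] by simp
    have "0 < t2 - t1" using False by simp
    from order_tendstoD(1)[OF tendsto_diff[OF n2 n1] this]
    have "\<forall>\<^sub>F N in sequentially. n1 N < n2 N"
    proof eventually_elim
      case (elim N)
      then show ?case using divide_right_mono[of "real (n2 N) - real N" "real (n1 N) - real N" "sqrt (real N)"] by force
    qed
    then have "\<forall>\<^sub>F N in sequentially. (if n1 N < n2 N then - L N else R N) - T = - L N - T" by eventually_elim simp
    moreover have "(\<lambda>N. - L N - T) \<longlonglongrightarrow> 0" using LT LIM_zero by blast
    ultimately show ?thesis using tendsto_cong by fastforce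
  qed
  then have "(\<lambda>N. (E N - c0 * (if n1 N < n2 N then - L N else R N)) + c0 * ((if n1 N < n2 N then - L N else R N) - T) + c0 * T)
    \<longlonglongrightarrow> 0 + c0 * 0 + c0 * T"
    by (intro tendsto_add lim tendsto_mult_left tendsto_const)
  moreover have "(E N - c0 * y) + c0 * (y - T) + c0 * T = E N" for N y by (simp add: algebra_simps)
  ultimately show ?thesis unfolding target by simp
qed

end

text \<open>The eventual conditions in the last two cases exclude real exceptions. If two points
  coincide, two rows agree and the determinant is 0, not 1. In the bulk, if t i = t j and d i j = 0
  while n i and n j differ for infinitely many N, then along these N one of the entries (i, j) and
  (j, i) comes close to S - 1 instead of S.\<close>

theorem theorem4p2:
  fixes gp gm r e c :: real
    and n :: "'k::finite \<Rightarrow> nat \<Rightarrow> nat"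
    and x :: "'k \<Rightarrow> nat \<Rightarrow> int"
    and d :: "'k \<Rightarrow> 'k \<Rightarrow> int"
    and t :: "'k \<Rightarrow> real"
  assumes gamma: "gp > 0" "gm > 0"
    and radii: "0 < r" "r < 1" "0 < e" "e < 1 - r"
    and n_pos: "\<And>i N. n i N > 0"
    and x_diff: "\<And>i j N. x i N - x j N = d i j"
    and n_lim: "\<And>j. (\<lambda>N. (real (n j N) - real N) / sqrt (real N)) \<longlonglongrightarrow> t j"
    and x_lim: "\<And>i. (\<lambda>N. real_of_int (x i N) / sqrt (real N)) \<longlonglongrightarrow> c"
  defines "D \<equiv> \<lambda>N. det (\<chi> i j. plancherel_kernel gp gm r e (n i N) (x i N) (n j N) (x j N)
                          :: complex ^ 'k ^ 'k)"
  shows "(c \<ge> 2 * sqrt gp \<longrightarrow> D \<longlonglongrightarrow> 0) \<and>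
         (c \<le> - 2 * sqrt gp \<longrightarrow>
            (\<forall>\<^sub>F N in sequentially. inj (\<lambda>i. (n i N, x i N))) \<longrightarrow>
            D \<longlonglongrightarrow> 1) \<and>
         (- 2 * sqrt gp < c \<and> c < 2 * sqrt gp \<longrightarrow>
            (\<forall>i j. t i = t j \<and> d i j = 0 \<longrightarrow> (\<forall>\<^sub>F N in sequentially. n i N = n j N)) \<longrightarrow>
            (\<forall>\<Gamma>. (\<forall>i j. S_contour (z_plus gp c) (t i - t j) (\<Gamma> i j)) \<longrightarrow>
                 D \<longlonglongrightarrow> det (\<chi> i j. S_kernel (\<Gamma> i j) (t i - t j) (d i j) :: complex ^ 'k ^ 'k)))"
proof -
  define E where "E = (\<lambda>N i j. plancherel_kernel gp gm r e (n i N) (x i N) (n j N) (x j N)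
      / of_real (sqrt (gp / real N) powi d i j))"
  have E: "E N i j = plancherel_kernel gp gm r e (n i N) (x i N) (n j N) (x j N)
      / of_real (sqrt (gp / real N) powi d i j)" for N i j
    by (simp add: E_def)
  \<comment> \<open>The weights factor as f i / f j with f i = y^(x i 0). As the differences of x
    are constant, the values at index 0 serve for every N.\<close>
  have conj: "det (\<chi> i j. A i j / of_real (y powi d i j) :: complex ^ 'k ^ 'k) = det (\<chi> i j. A i j)"
    if "y > 0" for y :: real and A :: "'k \<Rightarrow> 'k \<Rightarrow> complex"
  proof -
    have "of_real (y powi d i j) = (of_real (y powi x i 0) / of_real (y powi x j 0) :: complex)" for i j
      using that power_int_diff[of y "x i 0" "x j 0"] by (simp add: x_diff)
    then show ?thesis
      using det_diag_conjugate[of "\<lambda>i. of_real (y powi x i 0)" A] that by simp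
  qed
  \<comment> \<open>The scale vanishes at N = 0 by the convention for division by zero, so this
    holds for N > 0.\<close>
  have "\<forall>\<^sub>F N in sequentially. det (\<chi> i j. E N i j :: complex ^ 'k ^ 'k) = D N"
    using eventually_gt_at_top[of 0]
  proof eventually_elim
    case (elim N)
    then show ?case unfolding D_def E using gamma by (intro conj) simp
  qed
  then have D_lim: "D \<longlonglongrightarrow> l" if "(\<lambda>N. det (\<chi> i j. E N i j :: complex ^ 'k ^ 'k))
    \<longlonglongrightarrow> l" for l
    using that by (rule Lim_transform_eventually[rotated])
  note hyps = gamma radii(1,3,4) x_diff n_lim n_lim x_lim E
  show ?thesis
  proof (intro conjI impI allI)
    assume c: "c \<ge> 2 * sqrt gp"
    have "(\<lambda>N. \<Prod>i\<in>UNIV. E N i (p i)) \<longlonglongrightarrow> 0" for p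
    \<comment> \<open>An index with maximal n is marked for every p, the identity included.\<close>
    proof (rule prod_tendsto_zero[where P = "\<lambda>N i. n (p i) N \<le> n i N"])
      show "Bseq (\<lambda>N. E N i (p i))" for i by (rule entry_limit_right(1)[OF hyps c])
      show "(\<lambda>N. if n (p i) N \<le> n i N then E N i (p i) else 0) \<longlonglongrightarrow> 0" for i
        by (rule entry_limit_right(2)[OF hyps c])
      have "\<exists>i. n (p i) N \<le> n i N" for N
      proof -
        have "Max (range (\<lambda>i. n i N)) \<in> range (\<lambda>i. n i N)" by (rule Max_in) auto
        then obtain i where i: "Max (range (\<lambda>i. n i N)) = n i N" by (rule imageE)
        have "n (p i) N \<le> Max (range (\<lambda>i. n i N))" by (rule Max_ge) auto
        then show ?thesis unfolding i by blast
      qed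
      then show "\<forall>\<^sub>F N in sequentially. \<exists>i. n (p i) N \<le> n i N" by simp
    qed
    then have "(\<lambda>N. det (\<chi> i j. E N i j :: complex ^ 'k ^ 'k))
      \<longlonglongrightarrow> (\<Sum>p | p permutes (UNIV :: 'k set). of_int (sign p) * 0)"
      by (rule det_tendsto)
    then show "D \<longlonglongrightarrow> 0" by (intro D_lim) simp
  next
    assume c: "c \<le> - 2 * sqrt gp" and inj: "\<forall>\<^sub>F N in sequentially. inj (\<lambda>i. (n i N, x i N))"
    have neq: "\<forall>\<^sub>F N in sequentially. n i N \<noteq> n j N" if "t i \<noteq> t j" for i j
    proof -
      have "\<forall>\<^sub>F N in sequentially. (real (n i N) - real N) / sqrt (real N) - (real (n j N) - real N)
        / sqrt (real N) \<noteq> 0"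
        by (rule tendsto_imp_eventually_ne[OF tendsto_diff[OF n_lim n_lim]]) (use that in simp)
      then show ?thesis by eventually_elim auto
    qed
    \<comment> \<open>Different limits t make the n eventually different, so a tie in n leaves t i =
      t j. Injectivity then gives nonzero d, the case in which the loop integral vanishes.\<close>
    have ev: "\<forall>\<^sub>F N in sequentially. \<forall>i j. i \<noteq> j \<longrightarrow> n i N = n j N \<longrightarrow> t i = t j
      \<and> d i j \<noteq> 0"
    proof -
      have "\<forall>\<^sub>F N in sequentially. t i = t j \<or> n i N \<noteq> n j N" for i j
        using neq[of i j] by (cases "t i = t j") auto
      then have "\<forall>\<^sub>F N in sequentially. \<forall>i j. t i = t j \<or> n i N \<noteq> n j N"
        by (simp add: eventually_all_finite)
      then show ?thesis using inj
      proof eventually_elim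
        case (elim N)
        show ?case
        proof (intro allI impI conjI)
          fix i j assume ij: "i \<noteq> j" "n i N = n j N"
          then show "t i = t j" using elim by blast
          have "x i N \<noteq> x j N" using ij elim(2) by (auto dest: injD)
          then show "d i j \<noteq> 0" using x_diff[of i N j] by auto
        qed
      qed
    qed
    have "(\<lambda>N. \<Prod>i\<in>UNIV. E N i (p i)) \<longlonglongrightarrow> (if p = id then 1 else 0)"
      if p: "p permutes (UNIV :: 'k set)" for p
    proof (cases "p = id")
      case True
      have "(\<lambda>N. E N i i) \<longlonglongrightarrow> 1" for i
        by (rule entry_limit_left(3)[OF hyps c]) (use x_diff[of i 0 i] in auto)
      then have "(\<lambda>N. \<Prod>i\<in>UNIV. E N i i) \<longlonglongrightarrow> (\<Prod>i\<in>(UNIV :: 'k set). 1)"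
        by (rule tendsto_prod)
      then show ?thesis using True by simp
    next
      case False
      have "(\<lambda>N. \<Prod>i\<in>UNIV. E N i (p i)) \<longlonglongrightarrow> 0"
      proof (rule prod_tendsto_zero[where P = "\<lambda>N i. n i N < n (p i) N \<or> t i = t (p i) \<and> d i (p i) \<noteq> 0"])
        show "Bseq (\<lambda>N. E N i (p i))" for i by (rule entry_limit_left(1)[OF hyps c])
        show "(\<lambda>N. if n i N < n (p i) N \<or> t i = t (p i) \<and> d i (p i) \<noteq> 0 then E N i (p i) else 0)
          \<longlonglongrightarrow> 0" for i
          by (rule entry_limit_left(2)[OF hyps c])
        show "\<forall>\<^sub>F N in sequentially. \<exists>i. n i N < n (p i) N \<or> t i = t (p i) \<and> d i (p i) \<noteq> 0"
          using ev
        proof eventually_elim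
          case (elim N)
          \<comment> \<open>Choose i with n minimal among the indices moved by p. Since p maps M
            into itself, n i <= n (p i), and \<open>ev\<close> covers equality.\<close>
          define M where "M = {i. p i \<noteq> i}"
          have "M \<noteq> {}" using False by (auto simp: M_def fun_eq_iff)
          then have "Min ((\<lambda>i. n i N) ` M) \<in> (\<lambda>i. n i N) ` M" by (intro Min_in) auto
          then obtain i where i: "Min ((\<lambda>i. n i N) ` M) = n i N" "i \<in> M" by (rule imageE)
          have "inj p" using p by (rule permutes_inj)
          then have "p i \<in> M" using i(2) by (auto simp: M_def dest: injD)
          then have "n i N \<le> n (p i) N" unfolding i(1)[symmetric] by (intro Min_le) auto
          moreover have "p i \<noteq> i" using i(2) by (simp add: M_def)
          ultimately show ?case using elim[rule_format, of i "p i"] by (metis le_neq_implies_less)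
        qed
      qed
      then show ?thesis using False by simp
    qed
    then have "(\<lambda>N. det (\<chi> i j. E N i j :: complex ^ 'k ^ 'k)) \<longlonglongrightarrow>
        (\<Sum>p | p permutes (UNIV :: 'k set). of_int (sign p) * (if p = id then 1 else 0))"
      by (rule det_tendsto)
    also have "(\<Sum>p | p permutes (UNIV :: 'k set). of_int (sign p) * (if p = id then 1 else 0))
        = (\<Sum>p | p permutes (UNIV :: 'k set). if p = id then 1 else (0::complex))"
      by (intro sum.cong) auto
    also have "\<dots> = 1"
      by (subst sum.delta) (auto simp: finite_permutations permutes_id)
    finally show "D \<longlonglongrightarrow> 1" by (rule D_lim)
  next
    fix \<Gamma>
    assume c: "- 2 * sqrt gp < c \<and> c < 2 * sqrt gp"
      and ev: "\<forall>i j. t i = t j \<and> d i j = 0 \<longrightarrow> (\<forall>\<^sub>F N in sequentially. n i N = n j N)"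
      and \<Gamma>: "\<forall>i j. S_contour (z_plus gp c) (t i - t j) (\<Gamma> i j)"
    define L where "L = (\<lambda>i j. S_kernel (\<Gamma> i j) (t i - t j) (d i j) / of_real (sqrt gp powi d i j))"
    have "(\<lambda>N. E N i j) \<longlonglongrightarrow> L i j" for i j
      unfolding L_def by (rule entry_limit_bulk[OF hyps]) (use c ev \<Gamma> in auto)
    then have "(\<lambda>N. det (\<chi> i j. E N i j :: complex ^ 'k ^ 'k)) \<longlonglongrightarrow>
        (\<Sum>p | p permutes (UNIV :: 'k set). of_int (sign p) * (\<Prod>i\<in>UNIV. L i (p i)))"
      by (intro det_tendsto tendsto_prod)
    also have "(\<Sum>p | p permutes (UNIV :: 'k set). of_int (sign p) * (\<Prod>i\<in>UNIV. L i (p i)))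
      = det (\<chi> i j. L i j :: complex ^ 'k ^ 'k)"
      by (simp add: det_def)
    also have "\<dots> = det (\<chi> i j. S_kernel (\<Gamma> i j) (t i - t j) (d i j) :: complex ^ 'k ^ 'k)"
      unfolding L_def by (rule conj) (use gamma in simp)
    finally show "D \<longlonglongrightarrow> det (\<chi> i j. S_kernel (\<Gamma> i j) (t i - t j) (d i j) :: complex ^ 'k ^ 'k)"
      by (rule D_lim)
  qed
qed

end
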